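(* Let $F$ be a field of characteristic zero, $A\subseteq M_n(F)$ a semisimple subalgebra containing the identity, and $\mathcal G$ the group of units of the centralizer of $A$ in $M_n(F)$. Let $X_1,\dots,X_k$ be generic $n\times n$ matrices over $F[x_{ij}^{(\alpha)}]$, and let $\bar R(A,n,k)$ be the subalgebra of $M_n(F[x_{ij}^{(\alpha)}])$ generated by $A$, $X_1,\dots,X_k$ and the scalar matrices $tr(u)\cdot1$ for $u$ in the ring generated by $A$ and the $X_\alpha$. Then $M_n(F[x_{ij}^{(\alpha)}])^{\mathcal G}=\bar R(A,n,k)$.
   Context: $\mathcal G$ acts on $M_n(F[x_{ij}^{(\alpha)}])\cong F[x_{ij}^{(\alpha)}]\otimes M_n(F)$ by letting $g(x_{ij}^{(\alpha)})$ be the $(i,j)$ entry of $gX_\alpha g^{-1}$ on the first factor and $a\mapsto g^{-1}ag$ on the second factor. *)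

theory Defs
  imports "HOL-Library.Poly_Mapping" "Jordan_Normal_Form.Matrix"
begin

text \<open>Commutative polynomials over 'a in variables x_ij^(alpha), a variable being
  the triple (alpha, i, j).\<close>
type_synonym 'a mpol = "((nat \<times> nat \<times> nat) \<Rightarrow>\<^sub>0 nat) \<Rightarrow>\<^sub>0 'a"

definition pconst :: "'a::comm_ring_1 \<Rightarrow> 'a mpol" where
  "pconst c = Poly_Mapping.single 0 c"

definition pvar :: "nat \<times> nat \<times> nat \<Rightarrow> 'a::comm_ring_1 mpol" where
  "pvar v = Poly_Mapping.single (Poly_Mapping.single v 1) 1"

definition pvars :: "'a::comm_ring_1 mpol \<Rightarrow> (nat \<times> nat \<times> nat) set" where
  "pvars p = (\<Union>m\<in>Poly_Mapping.keys p. Poly_Mapping.keys m)"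

definition genvars :: "nat \<Rightarrow> nat \<Rightarrow> (nat \<times> nat \<times> nat) set" where
  "genvars n k = {(a, i, j). a < k \<and> i < n \<and> j < n}"

definition poly_ring :: "nat \<Rightarrow> nat \<Rightarrow> 'a::comm_ring_1 mpol set" where
  "poly_ring n k = {p. pvars p \<subseteq> genvars n k}"

definition psubst :: "(nat \<times> nat \<times> nat \<Rightarrow> 'a::comm_ring_1 mpol) \<Rightarrow> 'a mpol \<Rightarrow> 'a mpol" where
  "psubst \<sigma> p = (\<Sum>m\<in>Poly_Mapping.keys p. pconst (Poly_Mapping.lookup p m) * (\<Prod>v\<in>Poly_Mapping.keys m. \<sigma> v ^ Poly_Mapping.lookup m v))"

definition generic_mat :: "nat \<Rightarrow> nat \<Rightarrow> 'a::comm_ring_1 mpol mat" where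
  "generic_mat n a = mat n n (\<lambda>(i, j). pvar (a, i, j))"

definition const_mat :: "'a::comm_ring_1 mat \<Rightarrow> 'a mpol mat" where
  "const_mat B = map_mat pconst B"

text \<open>Action of g (with inverse gi) on M_n(F[x]): g(x_ij^(alpha)) is the (i,j) entry of
  g X_alpha g^-1 on the polynomial factor, and a |-> g^-1 a g on the matrix factor.\<close>
definition var_action :: "nat \<Rightarrow> 'a::comm_ring_1 mat \<Rightarrow> 'a mat \<Rightarrow> nat \<times> nat \<times> nat \<Rightarrow> 'a mpol" where
  "var_action n g gi = (\<lambda>(a, i, j). (const_mat g * generic_mat n a * const_mat gi) $$ (i, j))"

definition mat_action :: "nat \<Rightarrow> 'a::comm_ring_1 mat \<Rightarrow> 'a mat \<Rightarrow> 'a mpol mat \<Rightarrow> 'a mpol mat" where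
  "mat_action n g gi M = const_mat gi * map_mat (psubst (var_action n g gi)) M * const_mat g"

definition subalgebra :: "nat \<Rightarrow> 'a::field mat set \<Rightarrow> bool" where
  "subalgebra n A \<longleftrightarrow> A \<subseteq> carrier_mat n n \<and> 1\<^sub>m n \<in> A \<and> 0\<^sub>m n n \<in> A \<and>
     (\<forall>x\<in>A. \<forall>y\<in>A. x + y \<in> A \<and> x * y \<in> A) \<and> (\<forall>c. \<forall>x\<in>A. c \<cdot>\<^sub>m x \<in> A)"

definition two_sided_ideal :: "nat \<Rightarrow> 'a::field mat set \<Rightarrow> 'a mat set \<Rightarrow> bool" where
  "two_sided_ideal n A I \<longleftrightarrow> I \<subseteq> A \<and> 0\<^sub>m n n \<in> I \<and>
     (\<forall>x\<in>I. \<forall>y\<in>I. x + y \<in> I) \<and> (\<forall>c. \<forall>x\<in>I. c \<cdot>\<^sub>m x \<in> I) \<and>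
     (\<forall>a\<in>A. \<forall>x\<in>I. a * x \<in> I \<and> x * a \<in> I)"

definition nilpotent_set :: "nat \<Rightarrow> 'a::field mat set \<Rightarrow> bool" where
  "nilpotent_set n I \<longleftrightarrow> (\<exists>m>0. \<forall>xs. length xs = m \<longrightarrow> set xs \<subseteq> I \<longrightarrow>
       foldr (*) xs (1\<^sub>m n) = 0\<^sub>m n n)"

text \<open>Semisimple (finite-dimensional) algebra: zero (Jacobson) radical, i.e. no nonzero
  nilpotent two-sided ideal.\<close>
definition semisimple_subalgebra :: "nat \<Rightarrow> 'a::field mat set \<Rightarrow> bool" where
  "semisimple_subalgebra n A \<longleftrightarrow> subalgebra n A \<and>
     (\<forall>I. two_sided_ideal n A I \<and> nilpotent_set n I \<longrightarrow> I = {0\<^sub>m n n})"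

inductive_set gen_alg :: "nat \<Rightarrow> 'a::comm_ring_1 mpol mat set \<Rightarrow> 'a mpol mat set"
  for n S where
  gen: "x \<in> S \<Longrightarrow> x \<in> gen_alg n S"
| one: "1\<^sub>m n \<in> gen_alg n S"
| zero: "0\<^sub>m n n \<in> gen_alg n S"
| add: "x \<in> gen_alg n S \<Longrightarrow> y \<in> gen_alg n S \<Longrightarrow> x + y \<in> gen_alg n S"
| mult: "x \<in> gen_alg n S \<Longrightarrow> y \<in> gen_alg n S \<Longrightarrow> x * y \<in> gen_alg n S"
| smult: "x \<in> gen_alg n S \<Longrightarrow> pconst c \<cdot>\<^sub>m x \<in> gen_alg n S"

definition mtrace :: "'a::comm_ring_1 mat \<Rightarrow> 'a" where
  "mtrace M = (\<Sum>i<dim_row M. M $$ (i, i))"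

definition R_ring :: "'a::field mat set \<Rightarrow> nat \<Rightarrow> nat \<Rightarrow> 'a mpol mat set" where
  "R_ring A n k = gen_alg n (const_mat ` A \<union> generic_mat n ` {..<k})"

definition Rbar :: "'a::field mat set \<Rightarrow> nat \<Rightarrow> nat \<Rightarrow> 'a mpol mat set" where
  "Rbar A n k = gen_alg n (const_mat ` A \<union> generic_mat n ` {..<k} \<union>
      {mtrace u \<cdot>\<^sub>m 1\<^sub>m n | u. u \<in> R_ring A n k})"

definition invariants :: "'a::field mat set \<Rightarrow> nat \<Rightarrow> nat \<Rightarrow> 'a mpol mat set" where
  "invariants A n k = {M \<in> carrier_mat n n. (\<forall>i<n. \<forall>j<n. M $$ (i, j) \<in> poly_ring n k) \<and>
     (\<forall>g gi. g \<in> carrier_mat n n \<longrightarrow> gi \<in> carrier_mat n n \<longrightarrow> g * gi = 1\<^sub>m n \<longrightarrow>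
        (\<forall>a\<in>A. g * a = a * g) \<longrightarrow> mat_action n g gi M = M)}"

end

theory Submission
  imports Defs "HOL-Library.Function_Algebras" "HOL-Library.FuncSet"
    "HOL-Combinatorics.Permutations" "Jordan_Normal_Form.Char_Poly"
begin

text \<open>
  The degree \<open>d\<close> part of a matrix of polynomials has a unique symmetric coefficient tensor, which
  becomes, for each choice of the superscripts \<open>\<alpha>\<close>, an endomorphism \<open>T\<close> of the tensor power
  \<open>V\<^bsup>\<otimes>(d+1)\<^esup>\<close> of \<open>V = F\<^bsup>n\<^esup>\<close>; the last factor carries the row and column index of the matrix.
  By uniqueness, the matrix is invariant iff every \<open>T\<close> commutes with \<open>g\<^bsup>\<otimes>(d+1)\<^esup>\<close> for all units \<open>g\<close>
  of the centralizer \<open>B\<close> of \<open>A\<close>. Units are Zariski dense in \<open>B\<close>, so \<open>T\<close> commutes with all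
  \<open>b\<^bsup>\<otimes>(d+1)\<^esup>\<close> and, polarizing, with all symmetrizations of \<open>b\<^sub>0 \<otimes> \<dots> \<otimes> b\<^sub>d\<close>.
  Since \<open>A\<close> is semisimple and \<open>F\<close> has characteristic zero, the trace form of the regular
  representation is nondegenerate and yields a separability idempotent \<open>\<Sum> u\<^sub>i \<otimes> v\<^sub>i\<close> of \<open>A\<close>.
  Averaging with it and over the symmetric group sends arbitrary endomorphisms to symmetrized tensors
  over \<open>B\<close>, and this forces \<open>T\<close> into the span of the operators \<open>(a\<^sub>0 \<otimes> \<dots> \<otimes> a\<^sub>d) \<sigma>\<close> with \<open>a\<^sub>t \<in> A\<close>.
  Contracting such an operator with the generic matrices along the cycles of \<open>\<sigma>\<close> gives a word in
  \<open>A\<close> and the \<open>X\<^sub>\<alpha>\<close> times traces of such words.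
\<close>

section \<open>Linear algebra of functions and kernels\<close>

text \<open>Over a field that is not algebraically closed, \<open>A\<close> need not split into full
  matrix algebras, so the usual double centralizer argument is replaced by an explicit element. Let
  \<open>\<Sum> u\<^sub>i \<otimes> v\<^sub>i\<close> be the Casimir element of the regular trace
  form. The pairs \<open>u\<^sub>I \<sigma>\<close> and
  \<open>\<sigma>\<^sup>-\<^sup>1 v\<^sub>I\<close>, for all multi-indices \<open>I\<close> and all
  permutations \<open>\<sigma>\<close>, then play the same part for the algebra spanned by the
  permuted tensors over \<open>A\<close>: their products add up to the scalar \<open>(d+1)!\<close>,
  and a matrix placed between the two legs becomes a symmetrized tensor over the centralizer. An
  operator that commutes with those tensors can be carried from the left leg to the right one, and
  this alone places it in the algebra; its full commutant is never computed. Characteristic zero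
  enters four times: the trace of an idempotent is its rank, the scalar \<open>(d+1)!\<close> is
  invertible, so is the number of words that spell a given monomial, and the field contains
  infinitely many shifts. Polarization needs only signs.\<close>

declare plus_fun_apply [simp del] zero_fun_apply [simp del]
text \<open>Matrices, columns, coordinate vectors and tensors are all plain functions into the
  field, and this scaling makes each such type a vector space. The pointwise rules for sum and zero
  are kept out of the simplifier so that functions can be handled as vectors.\<close>

definition fscale :: "'a::field \<Rightarrow> ('b \<Rightarrow> 'a) \<Rightarrow> 'b \<Rightarrow> 'a" where
  "fscale c f = (\<lambda>x. c * f x)"

lemma fscale_apply: "fscale c f x = c * f x"
  by (simp add: fscale_def)

interpretation fs: vector_space "fscale :: 'a::field \<Rightarrow> ('b \<Rightarrow> 'a) \<Rightarrow> 'b \<Rightarrow> 'a"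
  by unfold_locales (auto simp: fun_eq_iff fscale_apply plus_fun_apply algebra_simps)

interpretation fsp: vector_space_pair "fscale :: 'a::field \<Rightarrow> ('b \<Rightarrow> 'a) \<Rightarrow> 'b \<Rightarrow> 'a"
  "fscale :: 'a \<Rightarrow> ('c \<Rightarrow> 'a) \<Rightarrow> 'c \<Rightarrow> 'a" ..

lemma sum_fun_apply: "(\<Sum>i\<in>I. f i) x = (\<Sum>i\<in>I. f i x)"
  for f :: "'i \<Rightarrow> 'b \<Rightarrow> 'a::comm_monoid_add"
  by (induction I rule: infinite_finite_induct) (auto simp: plus_fun_apply zero_fun_apply)

lemmas fun_app = plus_fun_apply zero_fun_apply fscale_apply sum_fun_apply

text \<open>Source of the dimension bounds: delta functions on a finite set span everything
  supported there.\<close>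

lemma finite_support_in_span:
  fixes x :: "'b \<Rightarrow> 'a::field"
  assumes "finite P" "\<And>p. p \<notin> P \<Longrightarrow> x p = 0"
  shows "x \<in> fs.span ((\<lambda>p q. if q = p then 1 else 0) ` P)"
proof -
  have "x = (\<Sum>p\<in>P. fscale (x p) (\<lambda>q. if q = p then 1 else 0))"
    using assms by (auto simp: fun_eq_iff fun_app if_distrib[of "(*) _"] cong: if_cong)
  also have "\<dots> \<in> fs.span ((\<lambda>p q. if q = p then 1 else 0) ` P)"
    by (intro fs.span_sum fs.span_scale fs.span_base) auto
  finally show ?thesis .
qed

text \<open>There are more vectors than the dimension allows, and in a relation the vector of least
  index is the dependent one. That the span is taken over later members is essential: in both
  applications the later members are multiples of the earlier ones.\<close>

lemma family_dependent:
  fixes v :: "nat \<Rightarrow> 'b \<Rightarrow> 'a::field"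
  assumes fin: "finite B" and card: "card B \<le> m" and v: "\<And>t. t \<le> m \<Longrightarrow> v t \<in> fs.span B"
  shows "\<exists>t\<le>m. v t \<in> fs.span (v ` {t<..m})"
proof (rule ccontr)
  assume neg: "\<not> ?thesis"
  \<comment> \<open>Taken from the last index downwards, each vector lies outside the span of the
    tail already collected, so the tail stays independent and free of repetitions.\<close>
  have ind: "fs.independent (v ` {m-j..m}) \<and> card (v ` {m-j..m}) = Suc j" if "j \<le> m" for j
    using that
  proof (induction j)
    case 0
    have "v m \<notin> fs.span (v ` {m<..m})" using neg by blast
    then show ?case by simp
  next
    case (Suc j)
    have eq: "{m - Suc j<..m} = {m-j..m}" using Suc.prems by auto
    have ins: "{m - Suc j..m} = insert (m - Suc j) {m-j..m}" using Suc.prems by auto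
    have "v (m - Suc j) \<notin> fs.span (v ` {m - Suc j<..m})" using neg by (metis diff_le_self)
    then have n: "v (m - Suc j) \<notin> fs.span (v ` {m-j..m})" unfolding eq .
    then have n': "v (m - Suc j) \<notin> v ` {m-j..m}" using fs.span_base by blast
    show ?case unfolding ins image_insert
      using Suc n' fs.independent_insertI[OF n] by simp
  qed
  from ind[of m] have "fs.independent (v ` {..m})" "card (v ` {..m}) = Suc m"
    by (auto simp: atMost_atLeast0)
  moreover have "v ` {..m} \<subseteq> fs.span B" using v by auto
  ultimately show False using fs.independent_span_bound[OF fin] card by fastforce
qed

text \<open>A matrix is a function on pairs of indices. The index set may consist of numbers, of
  multi-indices or of a basis of an algebra, so one product serves matrices, tensor powers and the
  regular representation.\<close>

definition kmul :: "'i set \<Rightarrow> ('i \<times> 'i \<Rightarrow> 'a::comm_ring_1) \<Rightarrow> ('i \<times> 'i \<Rightarrow> 'a) \<Rightarrow> 'i \<times> 'i \<Rightarrow> 'a" where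
  "kmul S x y = (\<lambda>(i, j). \<Sum>l\<in>S. x (i, l) * y (l, j))"

definition kone :: "'i set \<Rightarrow> 'i \<times> 'i \<Rightarrow> 'a::comm_ring_1" where
  "kone S = (\<lambda>(i, j). if i = j \<and> i \<in> S then 1 else 0)"

lemma kmul_apply: "kmul S x y (i, j) = (\<Sum>l\<in>S. x (i, l) * y (l, j))"
  by (simp add: kmul_def)

lemma kmul_assoc: "kmul S (kmul S x y) z = kmul S x (kmul S y z)"
proof (rule ext, clarify)
  fix i j
  have "kmul S (kmul S x y) z (i, j) = (\<Sum>l\<in>S. \<Sum>m\<in>S. x (i, m) * y (m, l) * z (l, j))"
    by (simp add: kmul_apply sum_distrib_right)
  also have "\<dots> = (\<Sum>m\<in>S. \<Sum>l\<in>S. x (i, m) * y (m, l) * z (l, j))"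
    by (rule sum.swap)
  also have "\<dots> = kmul S x (kmul S y z) (i, j)"
    by (simp add: kmul_apply sum_distrib_left mult.assoc)
  finally show "kmul S (kmul S x y) z (i, j) = kmul S x (kmul S y z) (i, j)" .
qed

lemma kmul_add_left: "kmul S (x + y) z = kmul S x z + kmul S y z"
  by (auto simp: fun_eq_iff fun_app kmul_apply distrib_right sum.distrib)
lemma kmul_add_right: "kmul S z (x + y) = kmul S z x + kmul S z y"
  by (auto simp: fun_eq_iff fun_app kmul_apply distrib_left sum.distrib)
lemma kmul_scale_left: "kmul S (fscale c x) z = fscale c (kmul S x z)"
  by (auto simp: fun_eq_iff fun_app kmul_apply sum_distrib_left mult.assoc)
lemma kmul_scale_right: "kmul S z (fscale c x) = fscale c (kmul S z x)"
  by (auto simp: fun_eq_iff fun_app kmul_apply sum_distrib_left mult.left_commute)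
lemma kmul_zero_left [simp]: "kmul S 0 z = 0"
  by (auto simp: fun_eq_iff fun_app kmul_apply)
lemma kmul_zero_right [simp]: "kmul S z 0 = 0"
  by (auto simp: fun_eq_iff fun_app kmul_apply)
lemma kmul_sum_left: "kmul S (\<Sum>i\<in>I. f i) z = (\<Sum>i\<in>I. kmul S (f i) z)"
  by (induction I rule: infinite_finite_induct) (auto simp: kmul_add_left)
lemma kmul_sum_right: "kmul S z (\<Sum>i\<in>I. f i) = (\<Sum>i\<in>I. kmul S z (f i))"
  by (induction I rule: infinite_finite_induct) (auto simp: kmul_add_right)

lemma kmul_one_left:
  assumes "finite S" "\<And>p. p \<notin> S \<times> S \<Longrightarrow> x p = 0"
  shows "kmul S (kone S) x = x"
proof (rule ext, clarify)
  fix i j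
  have "kmul S (kone S) x (i, j) = (\<Sum>l\<in>S. if l = i then x (i, j) else 0)"
    by (auto simp: kmul_apply kone_def intro!: sum.cong)
  also have "\<dots> = x (i, j)" using assms by auto
  finally show "kmul S (kone S) x (i, j) = x (i, j)" .
qed

lemma kmul_one_right:
  assumes "finite S" "\<And>p. p \<notin> S \<times> S \<Longrightarrow> x p = 0"
  shows "kmul S x (kone S) = x"
proof (rule ext, clarify)
  fix i j
  have "kmul S x (kone S) (i, j) = (\<Sum>l\<in>S. if l = j then x (i, j) else 0)"
    by (auto simp: kmul_apply kone_def intro!: sum.cong)
  also have "\<dots> = x (i, j)" using assms by auto
  finally show "kmul S x (kone S) (i, j) = x (i, j)" .
qed

text \<open>In characteristic zero the trace of an idempotent is its rank.\<close>

lemma idempotent_trace_zero: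
  fixes E :: "'i \<times> 'i \<Rightarrow> 'a::field_char_0"
  assumes fin: "finite S" and idem: "\<And>i j. i \<in> S \<Longrightarrow> j \<in> S \<Longrightarrow> kmul S E E (i, j) = E (i, j)"
    and tr: "(\<Sum>s\<in>S. E (s, s)) = 0" and ij: "i \<in> S" "j \<in> S"
  shows "E (i, j) = 0"
proof -
  define col where "col j = (\<lambda>i. if i \<in> S then E (i, j) else 0)" for j
  obtain W where W: "W \<subseteq> col ` S" "fs.independent W" "col ` S \<subseteq> fs.span W"
    using fs.maximal_independent_subset by metis
  have finW: "finite W" using W(1) fin finite_subset by blast
  define r where "r j = fs.representation W (col j)" for j
  have col: "col j = (\<Sum>w\<in>W. fscale (r j w) w)" if "j \<in> S" for j
    unfolding r_def using W that finW by (intro fs.sum_representation_eq[symmetric]) auto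
  \<comment> \<open>With \<open>W\<close> read as a matrix of independent columns, \<open>E\<close>
    factors as \<open>W\<close> times the coordinates \<open>r\<close>. Idempotence makes
    \<open>E\<close> fix its own columns, which yields the diagonal entries of \<open>r W\<close>;
    exchanging the factors under the trace then counts \<open>W\<close>.\<close>
  have one: "(\<Sum>j\<in>S. w j * r j w) = 1" if w: "w \<in> W" for w
  proof -
    obtain l where l: "l \<in> S" "w = col l" using w W by auto
    have "w = (\<Sum>j\<in>S. fscale (w j) (col j))"
    proof
      fix i
      show "w i = (\<Sum>j\<in>S. fscale (w j) (col j)) i"
        using idem[of i l] l by (auto simp: fun_app col_def kmul_apply mult.commute)
    qed
    then have "fs.representation W w = fs.representation W (\<Sum>j\<in>S. fscale (w j) (col j))"
      by simp
    also have "\<dots> = (\<lambda>b. \<Sum>j\<in>S. fs.representation W (fscale (w j) (col j)) b)"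
      using W by (intro fs.representation_sum) (auto intro: fs.span_scale)
    also have "\<dots> = (\<lambda>b. \<Sum>j\<in>S. w j * r j b)"
      unfolding r_def using W by (intro ext sum.cong refl) (subst fs.representation_scale, auto)
    finally show ?thesis using fs.representation_basis[OF W(2) w] by (metis (full_types))
  qed
  have "(\<Sum>s\<in>S. E (s, s)) = (\<Sum>s\<in>S. col s s)" by (simp add: col_def)
  also have "\<dots> = (\<Sum>s\<in>S. \<Sum>w\<in>W. r s w * w s)"
    by (intro sum.cong refl) (subst col, auto simp: fun_app)
  also have "\<dots> = (\<Sum>w\<in>W. \<Sum>s\<in>S. w s * r s w)"
    by (subst sum.swap) (simp add: mult.commute)
  also have "\<dots> = of_nat (card W)" using one by simp
  finally have "W = {}" using tr finW by simp
  then have "col j = 0" using W ij by auto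
  then show ?thesis using ij by (auto simp: col_def fun_eq_iff fun_app split: if_splits)
qed

section \<open>Separability of semisimple algebras\<close>

primrec kpow :: "'i set \<Rightarrow> ('i \<times> 'i \<Rightarrow> 'a::comm_ring_1) \<Rightarrow> nat \<Rightarrow> 'i \<times> 'i \<Rightarrow> 'a" where
  "kpow S c 0 = kone S"
| "kpow S c (Suc t) = kmul S c (kpow S c t)"

text \<open>A unital algebra of matrices over \<open>S\<close>. Vanishing outside
  \<open>S \<times> S\<close> makes equality of functions agree with equality of matrices.\<close>

locale kernel_algebra =
  fixes S :: "'i set" and A :: "('i \<times> 'i \<Rightarrow> 'a::field_char_0) set"
  assumes finS: "finite S"
    and supp: "x \<in> A \<Longrightarrow> p \<notin> S \<times> S \<Longrightarrow> x p = 0"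
    and subsp: "fs.subspace A"
    and mulA: "x \<in> A \<Longrightarrow> y \<in> A \<Longrightarrow> kmul S x y \<in> A"
    and oneA: "kone S \<in> A"
begin

abbreviation mul (infixl "\<cdot>" 70) where "mul \<equiv> kmul S"

lemma one_left: "x \<in> A \<Longrightarrow> kone S \<cdot> x = x"
  using kmul_one_left finS supp by blast

lemma one_right: "x \<in> A \<Longrightarrow> x \<cdot> kone S = x"
  using kmul_one_right finS supp by blast

lemma powA: "c \<in> A \<Longrightarrow> kpow S c t \<in> A"
  by (induction t) (auto simp: oneA mulA)

lemma pow_add: "c \<in> A \<Longrightarrow> kpow S c (s + t) = kpow S c s \<cdot> kpow S c t"
  by (induction s) (auto simp: kmul_assoc one_left powA)

lemma pow_commute: "c \<in> A \<Longrightarrow> kpow S c s \<cdot> kpow S c t = kpow S c t \<cdot> kpow S c s"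
  by (metis pow_add add.commute)

definition supp_basis :: "('i \<times> 'i \<Rightarrow> 'a) set" where
  "supp_basis = (\<lambda>p q. if q = p then 1 else 0) ` (S \<times> S)"

lemma finite_supp_basis: "finite supp_basis"
  by (simp add: supp_basis_def finS)

lemma in_span_supp_basis: "x \<in> A \<Longrightarrow> x \<in> fs.span supp_basis"
  unfolding supp_basis_def using finS supp by (intro finite_support_in_span) auto

lemma foldr_mul_append: "set xs \<subseteq> A \<Longrightarrow> set ys \<subseteq> A \<Longrightarrow>
   foldr mul (xs @ ys) (kone S) = foldr mul xs (kone S) \<cdot> foldr mul ys (kone S)
   \<and> foldr mul xs (kone S) \<in> A \<and> foldr mul ys (kone S) \<in> A"
proof (induction xs)
  case Nil
  have "foldr mul ys (kone S) \<in> A" using Nil(2) by (induction ys) (auto simp: oneA mulA)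
  then show ?case by (simp add: one_left oneA)
next
  case (Cons x xs)
  then show ?case by (simp add: kmul_assoc mulA)
qed

definition is_ideal :: "('i \<times> 'i \<Rightarrow> 'a) set \<Rightarrow> bool" where
  "is_ideal I \<longleftrightarrow> I \<subseteq> A \<and> fs.subspace I \<and> (\<forall>a\<in>A. \<forall>x\<in>I. a \<cdot> x \<in> I \<and> x \<cdot> a \<in> I)"

definition is_nilpotent :: "('i \<times> 'i \<Rightarrow> 'a) set \<Rightarrow> bool" where
  "is_nilpotent I \<longleftrightarrow> (\<exists>m. \<forall>xs. length xs = m \<longrightarrow> set xs \<subseteq> I \<longrightarrow> foldr mul xs (kone S) = 0)"

text \<open>If a product of \<^term>\<open>m\<close> elements of a nil ideal were nonzero for large \<^term>\<open>m\<close>, a linear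
  relation between its partial products \<open>v\<^sub>t\<close> would give \<open>v\<^sub>t = v\<^sub>t b\<close> with nilpotent \<open>b\<close>.\<close>

lemma nil_ideal_nilpotent:
  assumes I: "is_ideal I" and nil: "\<And>c. c \<in> I \<Longrightarrow> \<exists>t. kpow S c t = 0"
  shows "is_nilpotent I"
proof -
  define m where "m = card supp_basis"
  have IA: "I \<subseteq> A" and Isub: "fs.subspace I" using I by (auto simp: is_ideal_def)
  have ne: "foldr mul ys (kone S) \<in> I" if "ys \<noteq> []" "set ys \<subseteq> I" for ys
    using that
  proof (induction ys)
    case (Cons y ys)
    have "foldr mul ys (kone S) \<in> A" using foldr_mul_append[of ys "[]"] Cons.prems IA by auto
    then show ?case using I Cons.prems by (auto simp: is_ideal_def)
  qed simp
  have "foldr mul xs (kone S) = 0" if len: "length xs = m" and xs: "set xs \<subseteq> I" for xs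
  proof -
    define v where "v t = foldr mul (take t xs) (kone S)" for t
    have vA: "v t \<in> A" for t
      unfolding v_def using foldr_mul_append[of "take t xs" "[]"] xs IA set_take_subset[of t xs] by auto
    have split: "v t' = v t \<cdot> foldr mul (take (t' - t) (drop t xs)) (kone S)" if "t \<le> t'" for t t'
    proof -
      have "take t' xs = take t xs @ take (t' - t) (drop t xs)"
        using that by (metis le_add_diff_inverse take_add)
      moreover have "set (take t xs) \<subseteq> A" "set (take (t' - t) (drop t xs)) \<subseteq> A"
        using xs IA by (meson dual_order.trans set_take_subset set_drop_subset)+
      ultimately show ?thesis unfolding v_def using foldr_mul_append by metis
    qed
    obtain t where t: "t \<le> m" "v t \<in> fs.span (v ` {t<..m})"
      using family_dependent[OF finite_supp_basis, of m v] in_span_supp_basis[OF vA] m_def by blast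
    \<comment> \<open>Each later partial product extends \<open>v t\<close> by at least one factor
      from the ideal. All of them lie in this set, and so does any combination of them once it is a
      subspace.\<close>
    have sub: "fs.subspace {v t \<cdot> b | b. b \<in> I}"
    proof (rule fs.subspaceI)
      show "0 \<in> {v t \<cdot> b | b. b \<in> I}" using fs.subspace_0[OF Isub] by (auto intro!: exI[of _ 0])
    next
      fix x y assume "x \<in> {v t \<cdot> b | b. b \<in> I}" "y \<in> {v t \<cdot> b | b. b \<in> I}"
      then show "x + y \<in> {v t \<cdot> b | b. b \<in> I}"
        using fs.subspace_add[OF Isub] by (auto simp: kmul_add_right[symmetric])
    next
      fix c x assume "x \<in> {v t \<cdot> b | b. b \<in> I}"
      then show "fscale c x \<in> {v t \<cdot> b | b. b \<in> I}"
        using fs.subspace_scale[OF Isub] by (auto simp: kmul_scale_right[symmetric])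
    qed
    have "v ` {t<..m} \<subseteq> {v t \<cdot> b | b. b \<in> I}"
    proof (rule image_subsetI)
      fix t' assume t': "t' \<in> {t<..m}"
      have "take (t' - t) (drop t xs) \<noteq> []" using t' len by auto
      moreover have "set (take (t' - t) (drop t xs)) \<subseteq> I"
        using xs by (meson dual_order.trans set_take_subset set_drop_subset)
      ultimately have "foldr mul (take (t' - t) (drop t xs)) (kone S) \<in> I" by (rule ne)
      then show "v t' \<in> {v t \<cdot> b | b. b \<in> I}" using split[of t t'] t' by auto
    qed
    then have "v t \<in> {v t \<cdot> b | b. b \<in> I}" using t(2) fs.span_minimal[OF _ sub] by blast
    then obtain b where b: "b \<in> I" "v t = v t \<cdot> b" by auto
    then have bA: "b \<in> A" using IA by auto
    have "v t = v t \<cdot> kpow S b s" for s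
      by (induction s) (use one_right[OF vA] b(2) in \<open>auto simp: kmul_assoc[symmetric]\<close>)
    then have "v t = 0" using nil[OF b(1)] kmul_zero_right by metis
    then have "v m = 0" using split[of t m] t(1) by simp
    then show ?thesis using len by (simp add: v_def)
  qed
  then show ?thesis unfolding is_nilpotent_def by blast
qed

section \<open>The regular representation and its trace form\<close>

definition Bs where "Bs = (SOME B. B \<subseteq> A \<and> fs.independent B \<and> A \<subseteq> fs.span B)"

lemma Bs: "Bs \<subseteq> A" "fs.independent Bs" "A \<subseteq> fs.span Bs" "finite Bs"
proof -
  have "\<exists>B. B \<subseteq> A \<and> fs.independent B \<and> A \<subseteq> fs.span B"
    using fs.maximal_independent_subset by metis
  then have "Bs \<subseteq> A \<and> fs.independent Bs \<and> A \<subseteq> fs.span Bs" unfolding Bs_def by (rule someI_ex)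
  then show *: "Bs \<subseteq> A" "fs.independent Bs" "A \<subseteq> fs.span Bs" by auto
  then show "finite Bs"
    using fs.independent_span_bound[OF finite_supp_basis] in_span_supp_basis by blast
qed

abbreviation rep where "rep \<equiv> fs.representation Bs"

lemma rep_sum: "x \<in> A \<Longrightarrow> (\<Sum>a\<in>Bs. fscale (rep x a) a) = x"
  using Bs by (intro fs.sum_representation_eq) auto

lemma rep_add: "x \<in> A \<Longrightarrow> y \<in> A \<Longrightarrow> rep (x + y) a = rep x a + rep y a"
  using Bs by (subst fs.representation_add) auto

lemma rep_scale: "x \<in> A \<Longrightarrow> rep (fscale c x) a = c * rep x a"
  using Bs by (subst fs.representation_scale) auto

lemma sumA: "(\<And>i. i \<in> J \<Longrightarrow> f i \<in> A) \<Longrightarrow> sum f J \<in> A"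
  using fs.subspace_sum[OF subsp] by blast

lemma scaleA: "x \<in> A \<Longrightarrow> fscale c x \<in> A"
  using fs.subspace_scale[OF subsp] by blast

lemma rep_lincomb: "(\<And>i. i \<in> J \<Longrightarrow> f i \<in> A) \<Longrightarrow>
    rep (\<Sum>i\<in>J. fscale (c i) (f i)) a = (\<Sum>i\<in>J. c i * rep (f i) a)"
  using Bs by (subst fs.representation_sum) (auto simp: rep_scale scaleA intro: fs.span_scale)

text \<open>The matrix of left multiplication by \<open>b\<close>, with the basis elements
  themselves as row and column indices; column \<open>a'\<close> holds the coordinates of
  \<open>b a'\<close>.\<close>

definition reg :: "('i \<times> 'i \<Rightarrow> 'a) \<Rightarrow> ('i \<times> 'i \<Rightarrow> 'a) \<times> ('i \<times> 'i \<Rightarrow> 'a) \<Rightarrow> 'a" where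
  "reg b = (\<lambda>(a, a'). rep (b \<cdot> a') a)"

definition regtr :: "('i \<times> 'i \<Rightarrow> 'a) \<Rightarrow> 'a" where
  "regtr b = (\<Sum>a\<in>Bs. reg b (a, a))"

lemma reg_mul:
  assumes "b \<in> A" "c \<in> A" "a' \<in> Bs"
  shows "reg (b \<cdot> c) (a, a') = kmul Bs (reg b) (reg c) (a, a')"
proof -
  have a': "a' \<in> A" using assms Bs by auto
  have "b \<cdot> c \<cdot> a' = b \<cdot> (c \<cdot> a')" by (simp add: kmul_assoc)
  also have "c \<cdot> a' = (\<Sum>k\<in>Bs. fscale (rep (c \<cdot> a') k) k)" 
    using assms(2) a' by (intro rep_sum[symmetric] mulA) auto
  also have "b \<cdot> \<dots> = (\<Sum>k\<in>Bs. fscale (rep (c \<cdot> a') k) (b \<cdot> k))"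
    by (simp add: kmul_sum_right kmul_scale_right)
  finally have "rep (b \<cdot> c \<cdot> a') a = (\<Sum>k\<in>Bs. rep (c \<cdot> a') k * rep (b \<cdot> k) a)"
    using assms Bs(1) mulA by (subst rep_lincomb[symmetric]) auto
  then show ?thesis by (simp add: reg_def kmul_apply mult.commute)
qed

lemma regtr_commute:
  assumes "b \<in> A" "c \<in> A" shows "regtr (b \<cdot> c) = regtr (c \<cdot> b)"
proof -
  have "regtr (b \<cdot> c) = (\<Sum>a\<in>Bs. \<Sum>k\<in>Bs. reg b (a, k) * reg c (k, a))"
    using assms by (simp add: regtr_def reg_mul kmul_apply)
  also have "\<dots> = (\<Sum>k\<in>Bs. \<Sum>a\<in>Bs. reg c (k, a) * reg b (a, k))"
    by (subst sum.swap) (simp add: mult.commute)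
  also have "\<dots> = regtr (c \<cdot> b)"
    using assms by (simp add: regtr_def reg_mul kmul_apply)
  finally show ?thesis .
qed

lemma regtr_add: "x \<in> A \<Longrightarrow> y \<in> A \<Longrightarrow> regtr (x + y) = regtr x + regtr y"
  using Bs(1) unfolding regtr_def reg_def sum.distrib[symmetric]
  by (intro sum.cong refl) (auto simp: kmul_add_left rep_add mulA subset_iff)

lemma regtr_scale: "x \<in> A \<Longrightarrow> regtr (fscale c x) = c * regtr x"
  using Bs(1) unfolding regtr_def reg_def sum_distrib_left
  by (intro sum.cong refl) (auto simp: kmul_scale_left rep_scale mulA subset_iff)

lemma regtr_lincomb:
  "finite J \<Longrightarrow> (\<And>i. i \<in> J \<Longrightarrow> f i \<in> A) \<Longrightarrow> regtr (\<Sum>i\<in>J. fscale (c i) (f i)) = (\<Sum>i\<in>J. c i * regtr (f i))"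
proof (induction J rule: finite_induct)
  case empty
  have "regtr (fscale 0 (kone S)) = 0" using regtr_scale[OF oneA, of 0] by simp
  then show ?case by simp
next
  case (insert i J)
  then show ?case by (simp add: regtr_add regtr_scale scaleA sumA)
qed

text \<open>Left multiplication by an idempotent is an idempotent operator on \<open>A\<close>, so
  trace zero makes it the zero operator; applied to the unit it returns \<open>e\<close>.\<close>

lemma idempotent_regtr_zero:
  assumes e: "e \<in> A" "e \<cdot> e = e" "regtr e = 0"
  shows "e = 0"
proof -
  have z: "reg e (a, a') = 0" if "a \<in> Bs" "a' \<in> Bs" for a a'
  proof (rule idempotent_trace_zero[of Bs "reg e"])
    show "kmul Bs (reg e) (reg e) (i, j) = reg e (i, j)" if "i \<in> Bs" "j \<in> Bs" for i j
      using reg_mul[of e e j i] e that by simp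
  qed (use Bs e that in \<open>auto simp: regtr_def\<close>)
  have ea: "e \<cdot> a = 0" if "a \<in> Bs" for a
  proof -
    have "e \<cdot> a = (\<Sum>k\<in>Bs. fscale (rep (e \<cdot> a) k) k)" 
      using e(1) Bs(1) that by (intro rep_sum[symmetric] mulA) auto
    also have "\<dots> = 0" using z that by (intro sum.neutral) (auto simp: reg_def)
    finally show ?thesis .
  qed
  have "e = e \<cdot> kone S" using one_right e by simp
  also have "\<dots> = e \<cdot> (\<Sum>a\<in>Bs. fscale (rep (kone S) a) a)" by (simp only: rep_sum[OF oneA])
  also have "\<dots> = 0" using ea by (simp add: kmul_sum_right kmul_scale_right)
  finally show ?thesis .
qed

text \<open>The radical of the trace form \<open>regtr (b c)\<close>. It will be shown to be a
  nilpotent ideal, and this is how semisimplicity comes to imply nondegeneracy.\<close>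

definition Rad where "Rad = {c \<in> A. \<forall>b\<in>A. regtr (b \<cdot> c) = 0}"

lemma Rad_ideal: "is_ideal Rad"
proof -
  have "fs.subspace Rad"
  proof (rule fs.subspaceI)
    show "0 \<in> Rad" using fs.subspace_0[OF subsp] regtr_scale[OF oneA, of 0] by (auto simp: Rad_def)
  qed (auto simp: Rad_def kmul_add_right kmul_scale_right regtr_add regtr_scale mulA
      scaleA fs.subspace_add[OF subsp])
  moreover have "a \<cdot> x \<in> Rad \<and> x \<cdot> a \<in> Rad" if a: "a \<in> A" and x: "x \<in> Rad" for a x
  proof -
    have xA: "x \<in> A" using x by (simp add: Rad_def)
    have "regtr (b \<cdot> (a \<cdot> x)) = 0" if "b \<in> A" for b
      using x a that mulA unfolding Rad_def kmul_assoc[symmetric] by blast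
    \<comment> \<open>On the left associativity is enough; on the right, cyclicity of the trace
      brings \<open>a\<close> to the front.\<close>
    moreover have "regtr (b \<cdot> (x \<cdot> a)) = 0" if b: "b \<in> A" for b
    proof -
      have "regtr (b \<cdot> (x \<cdot> a)) = regtr ((b \<cdot> x) \<cdot> a)" by (simp add: kmul_assoc)
      also have "\<dots> = regtr (a \<cdot> (b \<cdot> x))" using regtr_commute a xA b mulA by blast
      also have "\<dots> = regtr ((a \<cdot> b) \<cdot> x)" by (simp add: kmul_assoc)
      also have "\<dots> = 0" using x a b mulA unfolding Rad_def by blast
      finally show ?thesis .
    qed
    ultimately show ?thesis using a xA mulA by (auto simp: Rad_def)
  qed
  ultimately show ?thesis unfolding is_ideal_def by (auto simp: Rad_def)
qed

text \<open>A linear relation between the powers \<open>c\<^bsup>2^t\<^esup>\<close> gives \<open>d = d\<^sup>2 g\<close> for some power \<open>d\<close>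
  of \<open>c\<close> and some \<open>g\<close> commuting with \<open>d\<close>, so that \<open>d g\<close> is an idempotent in the radical.\<close>

lemma Rad_nil:
  assumes c: "c \<in> Rad" shows "\<exists>t. kpow S c t = 0"
proof -
  have cA: "c \<in> A" using c by (simp add: Rad_def)
  \<comment> \<open>Doubling the exponents makes every later power divisible by the square of an
    earlier one, which is what produces the factor \<open>d d\<close> in the relation.\<close>
  define v where "v t = kpow S c (2 ^ t)" for t
  have vA: "v t \<in> A" for t unfolding v_def using powA cA by blast
  obtain t where t: "v t \<in> fs.span (v ` {t<..card supp_basis})"
    using family_dependent[OF finite_supp_basis order_refl, of v] in_span_supp_basis[OF vA] by blast
  define d where "d = v t"
  have dA: "d \<in> A" using vA d_def by simp
  \<comment> \<open>The later powers lie in this subspace. The condition that \<open>g\<close>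
    commutes with \<open>d\<close> survives linear combinations and will make \<open>d g\<close>
    idempotent.\<close>
  define C where "C = {d \<cdot> d \<cdot> g | g. g \<in> A \<and> d \<cdot> g = g \<cdot> d}"
  have "fs.subspace C"
  proof (rule fs.subspaceI)
    show "0 \<in> C" unfolding C_def using fs.subspace_0[OF subsp] by (auto intro!: exI[of _ 0])
  next
    fix x y assume "x \<in> C" "y \<in> C"
    then obtain g h where gh: "x = d \<cdot> d \<cdot> g" "g \<in> A" "d \<cdot> g = g \<cdot> d" "y = d \<cdot> d \<cdot> h" "h \<in> A" "d \<cdot> h = h \<cdot> d"
      unfolding C_def by auto
    then have "x + y = d \<cdot> d \<cdot> (g + h)" "g + h \<in> A" "d \<cdot> (g + h) = (g + h) \<cdot> d"
      using fs.subspace_add[OF subsp] by (auto simp: kmul_add_right kmul_add_left)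
    then show "x + y \<in> C" unfolding C_def by blast
  next
    fix r x assume "x \<in> C"
    then obtain g where gh: "x = d \<cdot> d \<cdot> g" "g \<in> A" "d \<cdot> g = g \<cdot> d"
      unfolding C_def by auto
    then have "fscale r x = d \<cdot> d \<cdot> (fscale r g)" "fscale r g \<in> A" "d \<cdot> (fscale r g) = (fscale r g) \<cdot> d"
      using scaleA by (auto simp: kmul_scale_right kmul_scale_left)
    then show "fscale r x \<in> C" unfolding C_def by blast
  qed
  moreover have "v ` {t<..card supp_basis} \<subseteq> C"
  proof (rule image_subsetI)
    fix t' assume "t' \<in> {t<..card supp_basis}"
    then have "(2::nat) ^ Suc t \<le> 2 ^ t'" by (intro power_increasing) auto
    then have "2 ^ t' = 2 ^ t + 2 ^ t + ((2::nat) ^ t' - 2 ^ Suc t)" by simp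
    then have "v t' = d \<cdot> d \<cdot> kpow S c (2 ^ t' - 2 ^ Suc t)"
      unfolding v_def d_def using pow_add[OF cA] by metis
    moreover have "d \<cdot> kpow S c (2 ^ t' - 2 ^ Suc t) = kpow S c (2 ^ t' - 2 ^ Suc t) \<cdot> d"
      unfolding d_def v_def by (rule pow_commute[OF cA])
    ultimately show "v t' \<in> C" unfolding C_def using powA[OF cA] by blast
  qed
  ultimately have "d \<in> C" using t fs.span_minimal unfolding d_def by blast
  then obtain g where g: "d = d \<cdot> d \<cdot> g" "g \<in> A" "d \<cdot> g = g \<cdot> d" unfolding C_def by auto
  define e where "e = d \<cdot> g"
  have "kpow S c (Suc n) \<in> Rad" for n
    using Rad_ideal c powA[OF cA, of n] by (auto simp: is_ideal_def)
  \<comment> \<open>The exponent \<open>2 ^ t\<close> is positive; the zeroth power would be the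
    unit.\<close>
  then have "d \<in> Rad" unfolding d_def v_def by (metis Suc_pred pos2 zero_less_power)
  then have eR: "e \<in> Rad" unfolding e_def using Rad_ideal g(2) by (auto simp: is_ideal_def)
  have "e \<cdot> e = d \<cdot> (g \<cdot> d) \<cdot> g" by (simp add: e_def kmul_assoc)
  also have "\<dots> = (d \<cdot> d \<cdot> g) \<cdot> g" by (simp add: g(3)[symmetric] kmul_assoc)
  also have "\<dots> = e" using g(1) e_def by simp
  finally have idem: "e \<cdot> e = e" .
  have eA: "e \<in> A" using eR by (simp add: Rad_def)
  have "regtr (kone S \<cdot> e) = 0" using eR oneA unfolding Rad_def by blast
  then have "e = 0" using idempotent_regtr_zero[OF eA idem] one_left[OF eA] by simp
  then have "d = 0" using g(1) by (simp add: e_def kmul_assoc)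
  then show ?thesis unfolding d_def v_def by blast
qed

lemma Rad_nilpotent: "is_nilpotent Rad"
  by (intro nil_ideal_nilpotent Rad_ideal Rad_nil)

end

locale semisimple_kernel_algebra = kernel_algebra S A
  for S :: "'i set" and A :: "('i \<times> 'i \<Rightarrow> 'a::field_char_0) set" +
  assumes semisimple: "\<And>I. is_ideal I \<Longrightarrow> is_nilpotent I \<Longrightarrow> I \<subseteq> {0}"
begin

text \<open>Values on a basis determine the form, so \<open>c\<close> lies in its radical, a
  nilpotent ideal, which semisimplicity forces to be zero.\<close>

lemma regtr_nondegenerate: "c \<in> A \<Longrightarrow> (\<And>b. b \<in> Bs \<Longrightarrow> regtr (b \<cdot> c) = 0) \<Longrightarrow> c = 0"
proof -
  assume c: "c \<in> A" and z: "\<And>b. b \<in> Bs \<Longrightarrow> regtr (b \<cdot> c) = 0"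
  have "regtr (b \<cdot> c) = 0" if b: "b \<in> A" for b
  proof -
    have "b \<cdot> c = (\<Sum>a\<in>Bs. fscale (rep b a) (a \<cdot> c))"
      by (subst rep_sum[OF b, symmetric]) (simp add: kmul_sum_left kmul_scale_left)
    then have "regtr (b \<cdot> c) = regtr (\<Sum>a\<in>Bs. fscale (rep b a) (a \<cdot> c))" by (rule arg_cong)
    also have "\<dots> = (\<Sum>a\<in>Bs. rep b a * regtr (a \<cdot> c))"
      using Bs c mulA by (intro regtr_lincomb) auto
    finally show ?thesis using z by simp
  qed
  then have "c \<in> Rad" using c by (simp add: Rad_def)
  then show "c = 0" using semisimple[OF Rad_ideal Rad_nilpotent] by blast
qed

text \<open>The map from \<open>A\<close> to its dual given by the trace form; a functional is
  recorded by its values on \<open>Bs\<close> and extended by zero.\<close>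

definition pairing :: "('i \<times> 'i \<Rightarrow> 'a) \<Rightarrow> ('i \<times> 'i \<Rightarrow> 'a) \<Rightarrow> 'a" where
  "pairing c = (\<lambda>b. if b \<in> Bs then regtr (b \<cdot> c) else 0)"

lemma pairing_lincomb: "finite J \<Longrightarrow> (\<And>i. i \<in> J \<Longrightarrow> f i \<in> A) \<Longrightarrow>
    pairing (\<Sum>i\<in>J. fscale (u i) (f i)) = (\<Sum>i\<in>J. fscale (u i) (pairing (f i)))"
  using Bs(1) by (auto simp: fun_eq_iff fun_app pairing_def kmul_sum_right kmul_scale_right
      regtr_lincomb mulA subset_iff)

text \<open>Nondegeneracy makes \<open>pairing\<close> injective, so it sends the basis to as many
  independent functions on \<open>Bs\<close> as there are coordinates. These span, and the preimages
  of the delta functions form the dual basis.\<close>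

lemma ex_dual_basis: "\<exists>d. \<forall>a\<in>Bs. d a \<in> A \<and> (\<forall>b\<in>Bs. regtr (b \<cdot> d a) = (if b = a then 1 else 0))"
proof -
  define D where "D = (\<lambda>p q. if q = p then 1 else 0 :: 'a) ` Bs"
  have key: "u b = 0" if rel: "(\<Sum>c\<in>Bs. fscale (u c) (pairing c)) = 0" and b: "b \<in> Bs" for u b
  proof -
    have "pairing (\<Sum>c\<in>Bs. fscale (u c) c) = 0"
      using rel Bs by (subst pairing_lincomb) auto
    then have "\<forall>x\<in>Bs. regtr (x \<cdot> (\<Sum>c\<in>Bs. fscale (u c) c)) = 0"
      by (auto simp: pairing_def fun_eq_iff fun_app split: if_splits)
    then have "(\<Sum>c\<in>Bs. fscale (u c) c) = 0"
      using Bs by (intro regtr_nondegenerate sumA scaleA) auto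
    then show ?thesis using fs.independentD[OF Bs(2) Bs(4) subset_refl] b by blast
  qed
  have inj: "inj_on pairing Bs"
  proof (rule inj_onI, rule ccontr)
    fix x y assume xy: "x \<in> Bs" "y \<in> Bs" "pairing x = pairing y" "x \<noteq> y"
    \<comment> \<open>Equal images of two basis elements would make their difference a
      relation.\<close>
    define u where "u c = (if c = x then 1 else if c = y then -1 else 0 :: 'a)" for c
    have "(\<Sum>c\<in>Bs. fscale (u c) (pairing c)) = (\<Sum>c\<in>{x, y}. fscale (u c) (pairing c))"
      using xy Bs(4) by (intro sum.mono_neutral_right) (auto simp: u_def)
    also have "\<dots> = 0" using xy by (simp add: u_def)
    finally have "u x = 0" by (rule key[OF _ xy(1)])
    then show False by (simp add: u_def)
  qed
  have ind: "fs.independent (pairing ` Bs)"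
  proof
    assume "fs.dependent (pairing ` Bs)"
    then obtain f c where f: "(\<Sum>x\<in>pairing ` Bs. fscale (f x) x) = 0"
      and c: "c \<in> Bs" "f (pairing c) \<noteq> 0"
      unfolding fs.dependent_finite[OF finite_imageI[OF Bs(4)]] by blast
    define u where "u c = f (pairing c)" for c
    have "(\<Sum>c\<in>Bs. fscale (u c) (pairing c)) = 0"
      using f by (simp only: sum.reindex[OF inj] o_def u_def)
    then have "u c = 0" by (rule key[OF _ c(1)])
    then show False using c(2) by (simp add: u_def)
  qed
  have cardD: "card D = card Bs"
    unfolding D_def
  proof (intro card_image inj_onI)
    fix x y :: "'i \<times> 'i \<Rightarrow> 'a"
    assume "(\<lambda>q. if q = x then 1 else 0 :: 'a) = (\<lambda>q. if q = y then 1 else 0)"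
    from fun_cong[OF this, of x] show "x = y" by (simp split: if_splits)
  qed
  have sub: "pairing ` Bs \<subseteq> fs.span D"
    unfolding D_def using Bs by (intro image_subsetI finite_support_in_span) (auto simp: pairing_def)
  have finD: "finite D" using Bs by (simp add: D_def)
  have DS: "D \<subseteq> fs.span (pairing ` Bs)"
  proof
    fix x assume x: "x \<in> D"
    show "x \<in> fs.span (pairing ` Bs)"
    proof (rule ccontr)
      \<comment> \<open>A delta function outside the span would give one independent vector more
        than the dimension permits.\<close>
      assume n: "x \<notin> fs.span (pairing ` Bs)"
      then have i2: "fs.independent (insert x (pairing ` Bs))" using ind fs.independent_insertI by blast
      have "insert x (pairing ` Bs) \<subseteq> fs.span D" using sub x fs.span_base by blast
      then have "card (insert x (pairing ` Bs)) \<le> card D"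
        using fs.independent_span_bound[OF finD i2] by blast
      moreover have "x \<notin> pairing ` Bs" using n fs.span_base by blast
      ultimately show False using Bs(4) cardD card_image[OF inj] by simp
    qed
  qed
  have "\<exists>d. d \<in> A \<and> (\<forall>b\<in>Bs. regtr (b \<cdot> d) = (if b = a then 1 else 0))" if a: "a \<in> Bs" for a
  proof -
    have "(\<lambda>q. if q = a then 1 else 0) \<in> fs.span (pairing ` Bs)" using DS a by (auto simp: D_def)
    then obtain u where u: "(\<lambda>q. if q = a then 1 else 0) = (\<Sum>x\<in>pairing ` Bs. fscale (u x) x)"
      unfolding fs.span_finite[OF finite_imageI[OF Bs(4)]] by blast
    define d where "d = (\<Sum>c\<in>Bs. fscale (u (pairing c)) c)"
    have dA: "d \<in> A" unfolding d_def using Bs by (intro sumA scaleA) auto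
    have "pairing d = (\<lambda>q. if q = a then 1 else 0)"
      unfolding d_def u using Bs by (subst pairing_lincomb) (auto simp: sum.reindex[OF inj])
    then have "\<forall>b\<in>Bs. regtr (b \<cdot> d) = (if b = a then 1 else 0)"
      by (auto simp: pairing_def fun_eq_iff split: if_splits)
    then show ?thesis using dA by blast
  qed
  then show ?thesis by metis
qed

text \<open>This is the Casimir element of the regular trace form. Expanding \<open>b a\<close> in
  the basis and \<open>d a b\<close> in the dual basis gives the same coefficients by cyclicity,
  which moves \<open>b\<close> from the left leg to the right one. The product of the legs is
  exactly the unit because the trace of its product with \<open>b\<close> is the trace of left
  multiplication by \<open>b\<close>. Equality in \<open>A \<otimes> A\<close> is expressed
  entrywise, with free positions \<open>p\<close> and \<open>q\<close> in the two legs.\<close>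

lemma separability_idempotent:
  "\<exists>B d. finite B \<and> B \<subseteq> A \<and> d ` B \<subseteq> A \<and> (\<Sum>a\<in>B. a \<cdot> d a) = kone S
    \<and> (\<forall>b\<in>A. \<forall>p q. (\<Sum>a\<in>B. (b \<cdot> a) p * d a q) = (\<Sum>a\<in>B. a p * (d a \<cdot> b) q))"
proof -
  obtain d where d: "\<And>a. a \<in> Bs \<Longrightarrow> d a \<in> A"
    "\<And>a b. a \<in> Bs \<Longrightarrow> b \<in> Bs \<Longrightarrow> regtr (b \<cdot> d a) = (if b = a then 1 else 0)"
    using ex_dual_basis by metis
  have BsA: "\<And>a. a \<in> Bs \<Longrightarrow> a \<in> A" using Bs by auto
  have coord: "regtr (y \<cdot> d a) = rep y a" if y: "y \<in> A" and a: "a \<in> Bs" for y a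
  proof -
    have "y \<cdot> d a = (\<Sum>c\<in>Bs. fscale (rep y c) (c \<cdot> d a))"
      by (subst rep_sum[OF y, symmetric]) (simp add: kmul_sum_left kmul_scale_left)
    then have "regtr (y \<cdot> d a) = regtr (\<Sum>c\<in>Bs. fscale (rep y c) (c \<cdot> d a))" by (rule arg_cong)
    also have "\<dots> = (\<Sum>c\<in>Bs. rep y c * regtr (c \<cdot> d a))"
      using Bs d a mulA by (intro regtr_lincomb) auto
    also have "\<dots> = (\<Sum>c\<in>Bs. if c = a then rep y a else 0)"
      using d a by (intro sum.cong) auto
    finally show ?thesis using a Bs(4) by simp
  qed
  have exp1: "y = (\<Sum>a\<in>Bs. fscale (regtr (y \<cdot> d a)) a)" if "y \<in> A" for y
    using rep_sum[OF that] coord[OF that] by simp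
  \<comment> \<open>The dual family also reproduces \<open>y\<close>: the difference pairs to zero
    with every basis element.\<close>
  have exp2: "y = (\<Sum>a\<in>Bs. fscale (regtr (a \<cdot> y)) (d a))" (is "y = ?z") if y: "y \<in> A" for y
  proof -
    have zA: "?z \<in> A" using d by (intro sumA scaleA)
    have "regtr (b \<cdot> (y - ?z)) = 0" if b: "b \<in> Bs" for b
    proof -
      have "b \<cdot> ?z = (\<Sum>a\<in>Bs. fscale (regtr (a \<cdot> y)) (b \<cdot> d a))"
        by (simp add: kmul_sum_right kmul_scale_right)
      then have "regtr (b \<cdot> ?z) = regtr (\<Sum>a\<in>Bs. fscale (regtr (a \<cdot> y)) (b \<cdot> d a))" by (rule arg_cong)
      also have "\<dots> = (\<Sum>a\<in>Bs. regtr (a \<cdot> y) * regtr (b \<cdot> d a))"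
        using Bs d b mulA by (intro regtr_lincomb) auto
      also have "\<dots> = (\<Sum>a\<in>Bs. if a = b then regtr (b \<cdot> y) else 0)"
        using d b by (intro sum.cong) auto
      also have "\<dots> = regtr (b \<cdot> y)" using b Bs(4) by simp
      finally have eq: "regtr (b \<cdot> ?z) = regtr (b \<cdot> y)" .
      have "b \<cdot> y = b \<cdot> (y - ?z) + b \<cdot> ?z"
        using kmul_add_right[of S b "y - ?z" ?z] by simp
      then have "regtr (b \<cdot> y) = regtr (b \<cdot> (y - ?z)) + regtr (b \<cdot> ?z)"
        using regtr_add mulA BsA[OF b] y zA fs.subspace_diff[OF subsp] by simp
      then show ?thesis using eq by simp
    qed
    then have "y - ?z = 0"
      using y zA fs.subspace_diff[OF subsp] by (intro regtr_nondegenerate) auto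
    then show ?thesis by simp
  qed
  have cas: "(\<Sum>a\<in>Bs. (b \<cdot> a) p * d a q) = (\<Sum>a\<in>Bs. a p * (d a \<cdot> b) q)" if b: "b \<in> A" for b p q
  proof -
    have "(b \<cdot> a) p = (\<Sum>a'\<in>Bs. regtr (b \<cdot> a \<cdot> d a') * a' p)" if "a \<in> Bs" for a
      using fun_cong[OF exp1[of "b \<cdot> a"], of p] that b mulA BsA by (simp add: fun_app)
    then have "(\<Sum>a\<in>Bs. (b \<cdot> a) p * d a q) = (\<Sum>a\<in>Bs. \<Sum>a'\<in>Bs. regtr (b \<cdot> a \<cdot> d a') * a' p * d a q)"
      by (simp add: sum_distrib_right)
    also have "\<dots> = (\<Sum>a'\<in>Bs. \<Sum>a\<in>Bs. regtr (a \<cdot> (d a' \<cdot> b)) * a' p * d a q)"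
    proof (subst sum.swap, intro sum.cong refl)
      fix a a' assume a: "a \<in> Bs" "a' \<in> Bs"
      have "regtr (b \<cdot> a \<cdot> d a') = regtr (b \<cdot> (a \<cdot> d a'))" by (simp add: kmul_assoc)
      also have "\<dots> = regtr (a \<cdot> (d a' \<cdot> b))"
        using regtr_commute[of b "a \<cdot> d a'"] b a BsA d mulA by (simp add: kmul_assoc)
      finally show "regtr (b \<cdot> a \<cdot> d a') * a' p * d a q = regtr (a \<cdot> (d a' \<cdot> b)) * a' p * d a q"
        by simp
    qed
    also have "\<dots> = (\<Sum>a'\<in>Bs. a' p * (d a' \<cdot> b) q)"
    proof (intro sum.cong refl)
      fix a' assume a': "a' \<in> Bs"
      have "(d a' \<cdot> b) q = (\<Sum>a\<in>Bs. regtr (a \<cdot> (d a' \<cdot> b)) * d a q)"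
        using fun_cong[OF exp2[of "d a' \<cdot> b"], of q] a' b mulA d by (simp add: fun_app)
      then show "(\<Sum>a\<in>Bs. regtr (a \<cdot> (d a' \<cdot> b)) * a' p * d a q) = a' p * (d a' \<cdot> b) q"
        by (simp add: sum_distrib_left mult_ac)
    qed
    finally show ?thesis .
  qed
  have "(\<Sum>a\<in>Bs. a \<cdot> d a) = kone S" (is "?u = _")
  proof -
    have uA: "?u \<in> A" using d BsA mulA by (intro sumA) auto
    have "regtr (b \<cdot> (?u - kone S)) = 0" if b: "b \<in> Bs" for b
    proof -
      have "b \<cdot> ?u = (\<Sum>a\<in>Bs. fscale 1 (b \<cdot> a \<cdot> d a))"
        by (simp add: kmul_sum_right kmul_assoc)
      then have "regtr (b \<cdot> ?u) = regtr (\<Sum>a\<in>Bs. fscale 1 (b \<cdot> a \<cdot> d a))" by (rule arg_cong)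
      also have "\<dots> = (\<Sum>a\<in>Bs. 1 * regtr (b \<cdot> a \<cdot> d a))"
        using Bs(4) d(1) BsA[OF b] BsA mulA by (intro regtr_lincomb) auto
      also have "\<dots> = (\<Sum>a\<in>Bs. rep (b \<cdot> a) a)"
        using coord b BsA mulA by (intro sum.cong) auto
      also have "\<dots> = regtr b" by (simp add: regtr_def reg_def)
      finally have eq: "regtr (b \<cdot> ?u) = regtr b" .
      have "b \<cdot> ?u = b \<cdot> (?u - kone S) + b \<cdot> kone S"
        using kmul_add_right[of S b "?u - kone S" "kone S"] by simp
      then have "regtr (b \<cdot> ?u) = regtr (b \<cdot> (?u - kone S)) + regtr b"
        using regtr_add mulA BsA[OF b] uA oneA fs.subspace_diff[OF subsp] one_right by simp
      then show ?thesis using eq by simp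
    qed
    then have "?u - kone S = 0"
      using uA oneA fs.subspace_diff[OF subsp] by (intro regtr_nondegenerate) auto
    then show ?thesis by simp
  qed
  then show ?thesis
  proof (intro exI[of _ Bs] exI[of _ d] conjI ballI allI)
    show "d ` Bs \<subseteq> A" using d(1) by auto
  qed (simp_all only: Bs cas)
qed

end

section \<open>Tensor powers and their bicommutants\<close>

lemma projection_onto_subspace:
  assumes "fs.subspace (D :: ('b \<Rightarrow> 'a::field) set)"
  obtains \<pi> where "\<And>x. \<pi> x \<in> D" "\<And>x. x \<in> D \<Longrightarrow> \<pi> x = x"
    "\<And>J c f. \<pi> (\<Sum>j\<in>J. fscale (c j) (f j)) = (\<Sum>j\<in>J. fscale (c j) (\<pi> (f j)))"
proof -
  obtain g where g: "range g \<subseteq> D" "Vector_Spaces.linear fscale fscale g" "\<forall>v\<in>D. g (id v) = v"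
    using fsp.linear_exists_left_inverse_on[OF fs.linear_id assms inj_on_id] by blast
  interpret g: Vector_Spaces.linear fscale fscale g by fact
  show ?thesis
    by (rule that[of g]) (use g in \<open>auto simp: g.sum g.scale\<close>)
qed

text \<open>A commuting family identity \<open>T u x v = u x v T\<close> for all \<open>x\<close> says that
  \<open>\<Sum> T u \<otimes> v = \<Sum> u \<otimes> v T\<close>; projecting the first factor to \<^term>\<open>D\<close> and
  multiplying the two factors yields \<^term>\<open>T\<close>.\<close>

lemma bicommutant_criterion:
  fixes T :: "'i \<times> 'i \<Rightarrow> 'a::field" and J :: "'j set"
  assumes fin: "finite X" "finite J" and D: "fs.subspace D"
    and Dsupp: "\<And>x p. x \<in> D \<Longrightarrow> p \<notin> X \<times> X \<Longrightarrow> x p = 0"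
    and T: "\<And>p. p \<notin> X \<times> X \<Longrightarrow> T p = 0"
    and u: "\<And>j. j \<in> J \<Longrightarrow> u j \<in> D"
    and v: "\<And>j x. j \<in> J \<Longrightarrow> x \<in> D \<Longrightarrow> kmul X x (v j) \<in> D"
    and unit: "(\<Sum>j\<in>J. kmul X (u j) (v j)) = fscale c (kone X)" "c \<noteq> 0"
    and comm: "\<And>p q a b. p \<in> X \<Longrightarrow> q \<in> X \<Longrightarrow> a \<in> X \<Longrightarrow> b \<in> X \<Longrightarrow>
       (\<Sum>j\<in>J. kmul X T (u j) (a, p) * v j (q, b)) = (\<Sum>j\<in>J. u j (a, p) * kmul X (v j) T (q, b))"
  shows "T \<in> D"
proof -
  obtain \<pi> where \<pi>: "\<And>x. \<pi> x \<in> D" "\<And>x. x \<in> D \<Longrightarrow> \<pi> x = x"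
    "\<And>(J :: 'j set) c f. \<pi> (\<Sum>j\<in>J. fscale (c j) (f j)) = (\<Sum>j\<in>J. fscale (c j) (\<pi> (f j :: 'i \<times> 'i \<Rightarrow> 'a)))"
    using projection_onto_subspace[OF D] by blast
  \<comment> \<open>The hypothesis \<open>comm\<close> is commutation tested on matrix units. For
    fixed \<open>q\<close> and \<open>b\<close> the second leg consists of scalars, so it becomes an
    equality of vectors in the first leg, where \<open>\<pi>\<close> can be applied.\<close>
  have eq: "(\<Sum>j\<in>J. fscale (v j (q, b)) (kmul X T (u j))) = (\<Sum>j\<in>J. fscale (kmul X (v j) T (q, b)) (u j))"
    if "q \<in> X" "b \<in> X" for q b
  proof (rule ext, clarify)
    fix a p
    show "(\<Sum>j\<in>J. fscale (v j (q, b)) (kmul X T (u j))) (a, p)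
        = (\<Sum>j\<in>J. fscale (kmul X (v j) T (q, b)) (u j)) (a, p)"
    proof (cases "a \<in> X \<and> p \<in> X")
      case True
      then show ?thesis using comm[of p q a b] that by (simp add: fun_app mult.commute)
    next
      case False
      then have "kmul X T (u j) (a, p) = 0 \<and> u j (a, p) = 0" if "j \<in> J" for j
        using T Dsupp[OF u[OF that]] by (auto simp: kmul_apply intro!: sum.neutral)
      then show ?thesis by (simp add: fun_app)
    qed
  qed
  define R where "R = (\<Sum>j\<in>J. kmul X (\<pi> (kmul X T (u j))) (v j))"
  have RD: "R \<in> D" unfolding R_def by (intro fs.subspace_sum[OF D] v \<pi>(1))
  \<comment> \<open>After the projection, one side of \<open>eq\<close> is assembled into
    \<open>R\<close>. On the other side \<open>\<pi>\<close> fixes every \<open>u j\<close>, and the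
    sum collapses to \<open>(\<Sum> u v) T = c T\<close>.\<close>
  have RT: "R (a, b) = c * T (a, b)" if ab: "a \<in> X" "b \<in> X" for a b
  proof -
    have "R (a, b) = (\<Sum>j\<in>J. \<Sum>q\<in>X. v j (q, b) * \<pi> (kmul X T (u j)) (a, q))"
      by (simp add: R_def fun_app kmul_apply mult.commute)
    also have "\<dots> = (\<Sum>q\<in>X. \<Sum>j\<in>J. v j (q, b) * \<pi> (kmul X T (u j)) (a, q))"
      by (rule sum.swap)
    also have "\<dots> = (\<Sum>q\<in>X. \<pi> (\<Sum>j\<in>J. fscale (v j (q, b)) (kmul X T (u j))) (a, q))"
      by (simp add: \<pi>(3) fun_app)
    also have "\<dots> = (\<Sum>q\<in>X. \<pi> (\<Sum>j\<in>J. fscale (kmul X (v j) T (q, b)) (u j)) (a, q))"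
      using eq ab by simp
    also have "\<dots> = (\<Sum>q\<in>X. \<Sum>j\<in>J. u j (a, q) * kmul X (v j) T (q, b))"
      using \<pi>(2) u by (simp add: \<pi>(3) fun_app mult.commute)
    also have "\<dots> = (\<Sum>j\<in>J. kmul X (u j) (kmul X (v j) T)) (a, b)"
      by (subst sum.swap) (simp add: fun_app kmul_apply)
    also have "(\<Sum>j\<in>J. kmul X (u j) (kmul X (v j) T)) = kmul X (\<Sum>j\<in>J. kmul X (u j) (v j)) T"
      by (simp only: kmul_sum_left kmul_assoc)
    also have "\<dots> = fscale c T"
      using unit(1) kmul_one_left[OF fin(1) T] by (simp add: kmul_scale_left)
    finally show ?thesis by (simp add: fun_app)
  qed
  have "T = fscale (1 / c) R"
  proof (rule ext, clarify)
    fix a b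
    show "T (a, b) = fscale (1 / c) R (a, b)"
    proof (cases "a \<in> X \<and> b \<in> X")
      case True
      then show ?thesis using RT unit(2) by (simp add: fscale_apply)
    next
      case False
      then show ?thesis using T[of "(a, b)"] Dsupp[OF RD, of "(a, b)"] by (auto simp: fscale_apply)
    qed
  qed
  then show ?thesis using fs.subspace_scale[OF D RD] by metis
qed

text \<open>Multi-indices of the \<open>N\<close>-fold tensor power. They are extensional, so they
  are equal as soon as they agree below \<open>N\<close>, and products of sums expand over
  them.\<close>

definition idx :: "'i set \<Rightarrow> nat \<Rightarrow> (nat \<Rightarrow> 'i) set" where
  "idx S N = PiE {..<N} (\<lambda>_. S)"

text \<open>The operator \<open>(a\<^sub>0 \<otimes> a\<^sub>1 \<otimes> \<dots>) \<sigma>\<close>.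
  The permutation acts on the column positions, which is why permutations compose in reversed order
  in \<open>tens_mul\<close>.\<close>

definition tens :: "'i set \<Rightarrow> nat \<Rightarrow> (nat \<Rightarrow> 'i \<times> 'i \<Rightarrow> 'a::comm_ring_1) \<Rightarrow> (nat \<Rightarrow> nat)
    \<Rightarrow> (nat \<Rightarrow> 'i) \<times> (nat \<Rightarrow> 'i) \<Rightarrow> 'a" where
  "tens S N a \<sigma> = (\<lambda>(P, Q). if P \<in> idx S N \<and> Q \<in> idx S N then \<Prod>t<N. a t (P t, Q (\<sigma> t)) else 0)"

lemma finite_idx: "finite S \<Longrightarrow> finite (idx S N)"
  by (simp add: idx_def finite_PiE)

lemma tens_apply: "P \<in> idx S N \<Longrightarrow> Q \<in> idx S N \<Longrightarrow> tens S N a \<sigma> (P, Q) = (\<Prod>t<N. a t (P t, Q (\<sigma> t)))"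
  by (simp add: tens_def)

lemma tens_supp: "p \<notin> idx S N \<times> idx S N \<Longrightarrow> tens S N a \<sigma> p = 0"
  by (auto simp: tens_def split: prod.splits)

lemma idx_mem: "P \<in> idx S N \<Longrightarrow> t < N \<Longrightarrow> P t \<in> S"
  by (auto simp: idx_def)

lemma tens_cong:
  assumes "\<And>t i j. t < N \<Longrightarrow> i \<in> S \<Longrightarrow> j \<in> S \<Longrightarrow> a t (i, j) = b t (i, j)"
    and "\<sigma> permutes {..<N}" and "\<And>t. t < N \<Longrightarrow> \<sigma> t = \<tau> t"
  shows "tens S N a \<sigma> = tens S N b \<tau>"
proof (rule ext, clarify)
  fix P Q
  show "tens S N a \<sigma> (P, Q) = tens S N b \<tau> (P, Q)"
  proof (cases "P \<in> idx S N \<and> Q \<in> idx S N")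
    case True
    have "a t (P t, Q (\<sigma> t)) = b t (P t, Q (\<tau> t))" if "t < N" for t
      using that assms True permutes_in_image[OF assms(2), of t] by (metis idx_mem lessThan_iff)
    then show ?thesis using True by (simp add: tens_apply)
  qed (auto simp: tens_def)
qed

lemma sum_tens:
  assumes "finite B"
  shows "(\<Sum>I\<in>PiE {..<N} (\<lambda>_. B). tens S N (\<lambda>t. f t (I t)) \<sigma>) = tens S N (\<lambda>t. \<Sum>a\<in>B. f t a) \<sigma>"
proof (rule ext, clarify)
  fix P Q
  show "(\<Sum>I\<in>PiE {..<N} (\<lambda>_. B). tens S N (\<lambda>t. f t (I t)) \<sigma>) (P, Q)
      = tens S N (\<lambda>t. \<Sum>a\<in>B. f t a) \<sigma> (P, Q)"
    using assms by (auto simp: tens_def sum_fun_apply prod_sum_PiE)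
qed

text \<open>The intermediate component \<open>R (\<sigma> t)\<close> occurs only in factor
  \<open>t\<close> on the left and in factor \<open>\<sigma> t\<close> on the right. Once these are
  paired, the sum over all \<open>R\<close> is a product of one-component sums, each a matrix
  product.\<close>

lemma tens_mul:
  assumes fin: "finite S" and \<sigma>: "\<sigma> permutes {..<N}" and \<tau>: "\<tau> permutes {..<N}"
  shows "kmul (idx S N) (tens S N a \<sigma>) (tens S N b \<tau>)
       = tens S N (\<lambda>t. kmul S (a t) (b (\<sigma> t))) (\<tau> \<circ> \<sigma>)"
proof (rule ext, clarify)
  fix P Q :: "nat \<Rightarrow> 'a"
  show "kmul (idx S N) (tens S N a \<sigma>) (tens S N b \<tau>) (P, Q)
       = tens S N (\<lambda>t. kmul S (a t) (b (\<sigma> t))) (\<tau> \<circ> \<sigma>) (P, Q)"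
  proof (cases "P \<in> idx S N \<and> Q \<in> idx S N")
    case True
    define F where "F t l = a t (P t, l) * b (\<sigma> t) (l, Q (\<tau> (\<sigma> t)))" for t l
    have "kmul (idx S N) (tens S N a \<sigma>) (tens S N b \<tau>) (P, Q)
        = (\<Sum>R\<in>idx S N. (\<Prod>t<N. a t (P t, R (\<sigma> t))) * (\<Prod>t<N. b t (R t, Q (\<tau> t))))"
      using True by (simp add: kmul_apply tens_apply)
    also have "\<dots> = (\<Sum>R\<in>idx S N. \<Prod>t<N. F (inv_into UNIV \<sigma> t) (R t))"
    proof (rule sum.cong[OF refl])
      fix R
      have "(\<Prod>t<N. b t (R t, Q (\<tau> t))) = (\<Prod>t<N. b (\<sigma> t) (R (\<sigma> t), Q (\<tau> (\<sigma> t))))"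
        by (subst prod.permute[OF \<sigma>]) (simp add: o_def)
      then have "(\<Prod>t<N. a t (P t, R (\<sigma> t))) * (\<Prod>t<N. b t (R t, Q (\<tau> t))) = (\<Prod>t<N. F t (R (\<sigma> t)))"
        by (simp add: F_def prod.distrib)
      also have "\<dots> = (\<Prod>t<N. F (inv_into UNIV \<sigma> t) (R t))"
        by (subst prod.permute[OF permutes_inv[OF \<sigma>]]) (simp add: o_def permutes_inverses[OF \<sigma>])
      finally show "(\<Prod>t<N. a t (P t, R (\<sigma> t))) * (\<Prod>t<N. b t (R t, Q (\<tau> t))) = (\<Prod>t<N. F (inv_into UNIV \<sigma> t) (R t))" .
    qed
    also have "\<dots> = (\<Prod>t<N. \<Sum>l\<in>S. F (inv_into UNIV \<sigma> t) l)"
      unfolding idx_def using fin by (subst prod_sum_PiE) auto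
    also have "\<dots> = (\<Prod>t<N. \<Sum>l\<in>S. F t l)"
      by (subst prod.permute[OF \<sigma>]) (simp add: o_def permutes_inverses[OF \<sigma>])
    also have "\<dots> = tens S N (\<lambda>t. kmul S (a t) (b (\<sigma> t))) (\<tau> \<circ> \<sigma>) (P, Q)"
      using True by (simp add: tens_apply F_def kmul_apply)
    finally show ?thesis .
  next
    case False
    then show ?thesis by (auto simp: kmul_apply tens_def)
  qed
qed

lemma sum_alternating_Pow:
  assumes "finite W"
  shows "(\<Sum>Y\<in>Pow W. (-1) ^ card Y) = (if W = {} then 1 else 0 :: 'a::comm_ring_1)"
  using assms
proof (induction W rule: finite_induct)
  case (insert x W)
  have inj: "inj_on (insert x) (Pow W)" using insert.hyps by (auto intro!: inj_onI)
  have "(\<Sum>Y\<in>Pow (insert x W). (-1) ^ card Y) = (\<Sum>Y\<in>Pow W. (-1) ^ card Y) + (\<Sum>Y\<in>insert x ` Pow W. (-1) ^ card Y :: 'a)"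
    unfolding Pow_insert using insert.hyps by (intro sum.union_disjoint) auto
  also have "(\<Sum>Y\<in>insert x ` Pow W. (-1) ^ card Y :: 'a) = (\<Sum>Y\<in>Pow W. - ((-1) ^ card Y))"
    unfolding sum.reindex[OF inj] o_def
    using insert.hyps by (intro sum.cong refl) (subst card_insert_disjoint, auto intro: finite_subset)
  finally show ?case by (simp add: sum_negf)
qed simp

text \<open>Ryser's formula for the permanent. Expanded over all maps \<open>f\<close>, the right
  side gives \<open>f\<close> an alternating sum over the sets \<open>Y\<close> that contain its
  image; this vanishes unless \<open>f\<close> is onto, hence a permutation. Applied to entries, it
  is the polarization identity for tensor powers.\<close>

lemma ryser:
  fixes M :: "nat \<Rightarrow> nat \<Rightarrow> 'a::comm_ring_1"
  shows "(\<Sum>\<pi> | \<pi> permutes {..<N}. \<Prod>t<N. M t (\<pi> t))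
       = (\<Sum>Y\<in>Pow {..<N}. (-1) ^ (N - card Y) * (\<Prod>t<N. \<Sum>s\<in>Y. M t s))"
proof -
  let ?X = "{..<N}"
  let ?F = "PiE ?X (\<lambda>_. ?X)"
  have inner: "(\<Sum>Y\<in>Pow ?X. if f ` ?X \<subseteq> Y then (-1) ^ (N - card Y) else 0) = (if f ` ?X = ?X then 1 else 0 :: 'a)"
    if "f \<in> ?F" for f
  proof -
    have sub: "f ` ?X \<subseteq> ?X" using that by auto
    have "(\<Sum>Y\<in>Pow ?X. if f ` ?X \<subseteq> Y then (-1) ^ (N - card Y) else 0 :: 'a)
        = (\<Sum>Y | Y \<in> Pow ?X \<and> f ` ?X \<subseteq> Y. (-1) ^ (N - card Y))"
      by (intro sum.inter_filter[symmetric]) simp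
    \<comment> \<open>Complementation turns the sets above the image into subsets of its complement,
      and the exponent of the sign into their size.\<close>
    also have "\<dots> = (\<Sum>Z\<in>Pow (?X - f ` ?X). (-1) ^ card Z)"
      by (rule sum.reindex_bij_witness[of _ "\<lambda>Z. ?X - Z" "\<lambda>Y. ?X - Y"])
         (use sub in \<open>auto simp: card_Diff_subset finite_subset double_diff\<close>)
    also have "\<dots> = (if ?X - f ` ?X = {} then 1 else 0)"
      by (rule sum_alternating_Pow) simp
    finally show ?thesis using sub by auto
  qed
  have "(\<Sum>Y\<in>Pow ?X. (-1) ^ (N - card Y) * (\<Prod>t<N. \<Sum>s\<in>Y. M t s))
     = (\<Sum>Y\<in>Pow ?X. \<Sum>f\<in>?F. (if f ` ?X \<subseteq> Y then (-1) ^ (N - card Y) else 0) * (\<Prod>t<N. M t (f t)))"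
  proof (rule sum.cong[OF refl])
    fix Y assume Y: "Y \<in> Pow ?X"
    then have finY: "finite Y" using finite_subset by auto
    have eq: "PiE ?X (\<lambda>_. Y) = {f \<in> ?F. f ` ?X \<subseteq> Y}" using Y by (auto simp: PiE_iff extensional_def image_subset_iff)
    have "(\<Prod>t<N. \<Sum>s\<in>Y. M t s) = (\<Sum>f\<in>PiE ?X (\<lambda>_. Y). \<Prod>t<N. M t (f t))"
      using finY by (intro prod_sum_PiE) auto
    also have "\<dots> = (\<Sum>f\<in>?F. if f ` ?X \<subseteq> Y then \<Prod>t<N. M t (f t) else 0)"
      unfolding eq by (intro sum.inter_filter finite_PiE) auto
    finally have eq2: "(\<Prod>t<N. \<Sum>s\<in>Y. M t s) = (\<Sum>f\<in>?F. if f ` ?X \<subseteq> Y then \<Prod>t<N. M t (f t) else 0)" .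
    show "(-1) ^ (N - card Y) * (\<Prod>t<N. \<Sum>s\<in>Y. M t s) =
       (\<Sum>f\<in>?F. (if f ` ?X \<subseteq> Y then (-1) ^ (N - card Y) else 0) * (\<Prod>t<N. M t (f t)))"
      unfolding eq2 sum_distrib_left by (intro sum.cong refl) simp
  qed
  also have "\<dots> = (\<Sum>f\<in>?F. (\<Sum>Y\<in>Pow ?X. if f ` ?X \<subseteq> Y then (-1) ^ (N - card Y) else 0) * (\<Prod>t<N. M t (f t)))"
    by (subst sum.swap) (simp add: sum_distrib_right)
  also have "\<dots> = (\<Sum>f\<in>?F. if f ` ?X = ?X then \<Prod>t<N. M t (f t) else 0)"
    by (intro sum.cong refl) (simp add: inner)
  also have "\<dots> = (\<Sum>f | f \<in> ?F \<and> f ` ?X = ?X. \<Prod>t<N. M t (f t))"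
    by (intro sum.inter_filter[symmetric] finite_PiE) auto
  also have "\<dots> = (\<Sum>\<pi> | \<pi> permutes ?X. \<Prod>t<N. M t (\<pi> t))"
  \<comment> \<open>The two sides differ in their default values: the maps in \<open>?F\<close> are
    undefined outside \<open>?X\<close>, permutations are the identity there.\<close>
  proof (rule sum.reindex_bij_witness[of _ "\<lambda>\<pi>. restrict \<pi> ?X" "\<lambda>f t. if t < N then f t else t"])
    fix f assume f: "f \<in> {f. f \<in> ?F \<and> f ` ?X = ?X}"
    then show "restrict (\<lambda>t. if t < N then f t else t) ?X = f"
      by (auto simp: fun_eq_iff PiE_iff extensional_def)
    have "inj_on f ?X" using f by (simp add: eq_card_imp_inj_on)
    then have "bij_betw (\<lambda>t. if t < N then f t else t) ?X ?X"
      using f by (auto simp: bij_betw_def inj_on_def image_def)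
    then show "(\<lambda>t. if t < N then f t else t) \<in> {\<pi>. \<pi> permutes ?X}"
      unfolding mem_Collect_eq by (rule bij_imp_permutes) auto
  next
    fix \<pi> assume p: "\<pi> \<in> {\<pi>. \<pi> permutes ?X}"
    then show "(\<lambda>t. if t < N then restrict \<pi> ?X t else t) = \<pi>"
      by (auto simp: fun_eq_iff permutes_def)
    show "restrict \<pi> ?X \<in> {f. f \<in> ?F \<and> f ` ?X = ?X}"
      using p permutes_image[of \<pi> ?X] permutes_in_image[of \<pi> ?X] by auto
  qed auto
  finally show ?thesis by simp
qed

lemma prod_of_bool:
  "(\<Prod>t<N. if R t then 1 else 0) = (if \<forall>t<N. R t then 1 else 0 :: 'a::comm_semiring_1)"
  for N :: nat
proof (cases "\<forall>t<N. R t")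
  case False
  then have "(\<Prod>t<N. if R t then 1 else 0 :: 'a) = 0" by (intro prod_zero) auto
  then show ?thesis using False by simp
qed simp

lemma idx_eq_iff: "P \<in> idx S N \<Longrightarrow> Q \<in> idx S N \<Longrightarrow> P = Q \<longleftrightarrow> (\<forall>t<N. P t = Q t)"
  unfolding idx_def by (auto intro: PiE_ext)

lemma tens_one: "tens S N (\<lambda>_. kone S) id = kone (idx S N)"
proof (rule ext, clarify)
  fix P Q
  show "tens S N (\<lambda>_. kone S) id (P, Q) = kone (idx S N) (P, Q)"
  proof (cases "P \<in> idx S N \<and> Q \<in> idx S N")
    case True
    then have "tens S N (\<lambda>_. kone S) id (P, Q) = (\<Prod>t<N. if P t = Q t then 1 else 0)"
      by (auto simp: tens_apply kone_def idx_mem intro!: prod.cong)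
    also have "\<dots> = kone (idx S N) (P, Q)"
      unfolding prod_of_bool kone_def using True idx_eq_iff[of P S N Q] by (auto simp: idx_mem)
    finally show ?thesis .
  qed (auto simp: tens_def kone_def)
qed

text \<open>Matrix units of the tensor power are themselves pure tensors, so the averaging formula
  for pure tensors applies to them.\<close>

lemma tens_unit:
  assumes "p \<in> idx S N" "q \<in> idx S N"
  shows "tens S N (\<lambda>t r. if r = (p t, q t) then 1 else 0) id = (\<lambda>r. if r = (p, q) then 1 else 0)"
proof (rule ext, clarify)
  fix P Q
  show "tens S N (\<lambda>t r. if r = (p t, q t) then 1 else 0) id (P, Q) = (if (P, Q) = (p, q) then 1 else 0)"
  proof (cases "P \<in> idx S N \<and> Q \<in> idx S N")
    case True
    then have "tens S N (\<lambda>t r. if r = (p t, q t) then 1 else 0) id (P, Q)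
      = (\<Prod>t<N. if (P t, Q t) = (p t, q t) then 1 else 0)" by (simp add: tens_apply)
    also have "\<dots> = (if (P, Q) = (p, q) then 1 else 0)"
      unfolding prod_of_bool using True assms idx_eq_iff[of P S N p] idx_eq_iff[of Q S N q] by auto
    finally show ?thesis .
  qed (use assms in \<open>auto simp: tens_def\<close>)
qed

text \<open>A matrix unit between \<open>y\<close> and \<open>z\<close> separates them into a
  product of entries. This converts commutation with averaged operators into the entrywise
  hypothesis of \<open>bicommutant_criterion\<close>.\<close>

lemma kmul_unit:
  assumes "finite X" "p \<in> X" "q \<in> X"
  shows "kmul X (kmul X y (\<lambda>r. if r = (p, q) then 1 else 0)) z (a, b) = y (a, p) * z (q, b)"
proof -
  have "kmul X y (\<lambda>r. if r = (p, q) then 1 else 0) (a, l) = (if l = q then y (a, p) else 0)" for l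
  proof -
    have "kmul X y (\<lambda>r. if r = (p, q) then 1 else 0) (a, l) = (\<Sum>m\<in>X. if m = p then (if l = q then y (a, p) else 0) else 0)"
      unfolding kmul_apply by (intro sum.cong) auto
    also have "\<dots> = (if l = q then y (a, p) else 0)" using assms by simp
    finally show ?thesis .
  qed
  then have "kmul X (kmul X y (\<lambda>r. if r = (p, q) then 1 else 0)) z (a, b) = (\<Sum>l\<in>X. if l = q then y (a, p) * z (q, b) else 0)"
    unfolding kmul_apply[of X "kmul X y _"] by (intro sum.cong) auto
  also have "\<dots> = y (a, p) * z (q, b)" using assms by simp
  finally show ?thesis .
qed

section \<open>Centralizer, permuted tensors over the algebra, and polarization\<close>

context kernel_algebra
begin

definition centralizer :: "('i \<times> 'i \<Rightarrow> 'a) set" where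
  "centralizer = {b. (\<forall>p. p \<notin> S \<times> S \<longrightarrow> b p = 0) \<and> (\<forall>a\<in>A. a \<cdot> b = b \<cdot> a)}"

definition tensor_algebra :: "nat \<Rightarrow> ((nat \<Rightarrow> 'i) \<times> (nat \<Rightarrow> 'i) \<Rightarrow> 'a) set" where
  "tensor_algebra N = fs.span {tens S N a \<sigma> | a \<sigma>. (\<forall>t<N. a t \<in> A) \<and> \<sigma> permutes {..<N}}"

lemma centralizer_sum: "(\<And>i. i \<in> J \<Longrightarrow> f i \<in> centralizer) \<Longrightarrow> sum f J \<in> centralizer"
  unfolding centralizer_def by (auto simp: fun_app kmul_sum_left kmul_sum_right)

lemma tensor_algebra_supp: "x \<in> tensor_algebra N \<Longrightarrow> p \<notin> idx S N \<times> idx S N \<Longrightarrow> x p = 0"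
proof -
  assume x: "x \<in> tensor_algebra N" and p: "p \<notin> idx S N \<times> idx S N"
  have "fs.subspace {x. x p = 0}" by (rule fs.subspaceI) (auto simp: fun_app)
  then have "tensor_algebra N \<subseteq> {x. x p = 0}"
    unfolding tensor_algebra_def by (intro fs.span_minimal) (use tens_supp p in blast)
  then show ?thesis using x by blast
qed

lemma tensor_algebra_mul:
  assumes x: "x \<in> tensor_algebra N" and b: "\<And>t. t < N \<Longrightarrow> b t \<in> A" and \<tau>: "\<tau> permutes {..<N}"
  shows "kmul (idx S N) x (tens S N b \<tau>) \<in> tensor_algebra N"
proof -
  let ?G = "{tens S N a \<sigma> | a \<sigma>. (\<forall>t<N. a t \<in> A) \<and> \<sigma> permutes {..<N}}"
  let ?C = "{x. kmul (idx S N) x (tens S N b \<tau>) \<in> tensor_algebra N}"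
  have sub: "fs.subspace (tensor_algebra N)" unfolding tensor_algebra_def by simp
  have "fs.subspace ?C"
    using fs.subspace_0[OF sub] fs.subspace_add[OF sub] fs.subspace_scale[OF sub]
    by (intro fs.subspaceI) (auto simp: kmul_add_left kmul_scale_left)
  moreover have "?G \<subseteq> ?C"
  proof clarify
    fix a \<sigma> assume a: "\<forall>t<N. a t \<in> A" and \<sigma>: "\<sigma> permutes {..<N}"
    have "\<forall>t<N. a t \<cdot> b (\<sigma> t) \<in> A"
      using a b permutes_in_image[OF \<sigma>] mulA by auto
    moreover have "\<tau> \<circ> \<sigma> permutes {..<N}" using \<sigma> \<tau> by (rule permutes_compose)
    ultimately have "tens S N (\<lambda>t. a t \<cdot> b (\<sigma> t)) (\<tau> \<circ> \<sigma>) \<in> ?G" by blast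
    then show "kmul (idx S N) (tens S N a \<sigma>) (tens S N b \<tau>) \<in> tensor_algebra N"
      unfolding tens_mul[OF finS \<sigma> \<tau>] tensor_algebra_def by (rule fs.span_base)
  qed
  ultimately show ?thesis using x fs.span_minimal unfolding tensor_algebra_def by blast
qed

text \<open>By Ryser's formula, entry by entry, the symmetrization is a signed combination of tensor
  powers of the subset sums of the \<open>b t\<close>, and these sums stay in the
  centralizer.\<close>

lemma commute_symmetrized:
  assumes T: "\<And>b. b \<in> centralizer \<Longrightarrow>
      kmul (idx S N) T (tens S N (\<lambda>_. b) id) = kmul (idx S N) (tens S N (\<lambda>_. b) id) T"
    and b: "\<And>t. t < N \<Longrightarrow> b t \<in> centralizer"
  defines "\<Omega> \<equiv> \<Sum>\<sigma> | \<sigma> permutes {..<N}. tens S N (\<lambda>t. b (\<sigma> t)) id"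
  shows "kmul (idx S N) T \<Omega> = kmul (idx S N) \<Omega> T"
proof -
  have "\<Omega> = (\<Sum>Y\<in>Pow {..<N}. fscale ((-1) ^ (N - card Y)) (tens S N (\<lambda>_. \<Sum>s\<in>Y. b s) id))"
  proof (rule ext, clarify)
    fix P Q :: "nat \<Rightarrow> 'i"
    show "\<Omega> (P, Q) = (\<Sum>Y\<in>Pow {..<N}. fscale ((-1) ^ (N - card Y)) (tens S N (\<lambda>_. \<Sum>s\<in>Y. b s) id)) (P, Q)"
    proof (cases "P \<in> idx S N \<and> Q \<in> idx S N")
      case True
      then show ?thesis
        using ryser[where N = N and M = "\<lambda>t s. b s (P t, Q t)"] by (simp add: \<Omega>_def tens_apply fun_app)
    qed (auto simp: \<Omega>_def tens_def fun_app)
  qed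
  moreover have "(\<Sum>s\<in>Y. b s) \<in> centralizer" if "Y \<in> Pow {..<N}" for Y
    using that b by (intro centralizer_sum) auto
  ultimately show ?thesis
    by (simp add: kmul_sum_left kmul_sum_right kmul_scale_left kmul_scale_right T)
qed

end

context semisimple_kernel_algebra
begin

theorem bicommutant_tensor_power:
  assumes supp: "\<And>p. p \<notin> idx S N \<times> idx S N \<Longrightarrow> T p = 0"
    and comm: "\<And>b. b \<in> centralizer \<Longrightarrow>
      kmul (idx S N) T (tens S N (\<lambda>_. b) id) = kmul (idx S N) (tens S N (\<lambda>_. b) id) T"
  shows "T \<in> tensor_algebra N"
proof -
  obtain B d where Bd: "finite B \<and> B \<subseteq> A \<and> d ` B \<subseteq> A \<and> (\<Sum>a\<in>B. a \<cdot> d a) = kone S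
    \<and> (\<forall>b\<in>A. \<forall>p q. (\<Sum>a\<in>B. (b \<cdot> a) p * d a q) = (\<Sum>a\<in>B. a p * (d a \<cdot> b) q))"
    using separability_idempotent by (elim exE)
  then have B: "finite B" "B \<subseteq> A" "d ` B \<subseteq> A" and one: "(\<Sum>a\<in>B. a \<cdot> d a) = kone S"
    by simp_all
  have cas: "(\<Sum>a\<in>B. (b \<cdot> a) p * d a q) = (\<Sum>a\<in>B. a p * (d a \<cdot> b) q)" if "b \<in> A" for b p q
  proof -
    have "\<forall>b\<in>A. \<forall>p q. (\<Sum>a\<in>B. (b \<cdot> a) p * d a q) = (\<Sum>a\<in>B. a p * (d a \<cdot> b) q)"
      using Bd by (elim conjE)
    then show ?thesis using that by (elim ballE allE) auto
  qed
  \<comment> \<open>Averaging with the separability idempotent lands in the centralizer for every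
    matrix \<open>x\<close>: a factor \<open>c\<close> enters at the left leg and comes out at the
    right one.\<close>
  define E where "E x = (\<Sum>a\<in>B. a \<cdot> x \<cdot> d a)" for x
  have EC: "E x \<in> centralizer" for x
  proof -
    have s: "E x p = 0" if "p \<notin> S \<times> S" for p
    proof -
      have "(a \<cdot> x \<cdot> d a) p = 0" if "a \<in> B" for a
      proof -
        obtain i j where p: "p = (i, j)" by (cases p)
        have a: "a \<in> A" "d a \<in> A" using B that by auto
        have "a (i, l) = 0" if "i \<notin> S" for l using that kernel_algebra.supp[OF kernel_algebra_axioms a(1), of "(i, l)"] by simp
        moreover have "d a (l, j) = 0" if "j \<notin> S" for l
          using that kernel_algebra.supp[OF kernel_algebra_axioms a(2), of "(l, j)"] by simp
        ultimately show ?thesis using \<open>p \<notin> S \<times> S\<close> by (cases "i \<in> S") (simp_all add: p kmul_apply)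
      qed
      then show ?thesis by (simp add: E_def fun_app)
    qed
    have "c \<cdot> E x = E x \<cdot> c" if c: "c \<in> A" for c
    proof (rule ext, clarify)
      fix i j
      have "(c \<cdot> E x) (i, j) = (\<Sum>a\<in>B. (c \<cdot> a \<cdot> x \<cdot> d a) (i, j))"
        by (simp add: E_def kmul_sum_right kmul_assoc fun_app)
      also have "\<dots> = (\<Sum>a\<in>B. \<Sum>m\<in>S. \<Sum>l\<in>S. x (l, m) * ((c \<cdot> a) (i, l) * d a (m, j)))"
        unfolding kmul_apply[of S "c \<cdot> _ \<cdot> x"] kmul_apply[of S "c \<cdot> _" x]
        by (simp add: sum_distrib_left sum_distrib_right mult_ac)
      also have "\<dots> = (\<Sum>m\<in>S. \<Sum>l\<in>S. x (l, m) * (\<Sum>a\<in>B. (c \<cdot> a) (i, l) * d a (m, j)))"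
        unfolding sum_distrib_left by (subst sum.swap, rule sum.cong[OF refl], rule sum.swap)
      also have "\<dots> = (\<Sum>m\<in>S. \<Sum>l\<in>S. x (l, m) * (\<Sum>a\<in>B. a (i, l) * (d a \<cdot> c) (m, j)))"
        by (simp only: cas[OF c])
      also have "\<dots> = (\<Sum>a\<in>B. \<Sum>m\<in>S. \<Sum>l\<in>S. x (l, m) * (a (i, l) * (d a \<cdot> c) (m, j)))"
        unfolding sum_distrib_left by (subst (2) sum.swap, rule sum.cong[OF refl], rule sum.swap)
      also have "\<dots> = (\<Sum>a\<in>B. (a \<cdot> x \<cdot> (d a \<cdot> c)) (i, j))"
        unfolding kmul_apply[of S "_ \<cdot> x"] kmul_apply[of S _ x]
        by (simp add: sum_distrib_left sum_distrib_right mult_ac)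
      also have "\<dots> = (E x \<cdot> c) (i, j)"
        by (simp add: E_def kmul_sum_left kmul_assoc fun_app)
      finally show "(c \<cdot> E x) (i, j) = (E x \<cdot> c) (i, j)" .
    qed
    then show ?thesis using s by (simp add: centralizer_def)
  qed
  define Per where "Per = {\<sigma>. \<sigma> permutes {..<N}}"
  define BN where "BN = PiE {..<N} (\<lambda>_. B)"
  define J where "J = Per \<times> BN"
  define u where "u j = tens S N (snd j) (fst j)" for j :: "(nat \<Rightarrow> nat) \<times> (nat \<Rightarrow> 'i \<times> 'i \<Rightarrow> 'a)"
  \<comment> \<open>The inverse permutation followed by the dual elements. In the shape of
    \<open>tens\<close> the coefficients stand in front, which shifts their positions by the
    inverse.\<close>
  define v where "v j = tens S N (\<lambda>t. d (snd j (inv_into UNIV (fst j) t))) (inv_into UNIV (fst j))"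
    for j :: "(nat \<Rightarrow> nat) \<times> (nat \<Rightarrow> 'i \<times> 'i \<Rightarrow> 'a)"
  have finPer: "finite Per" unfolding Per_def by (rule finite_permutations) simp
  have finJ: "finite J" unfolding J_def BN_def using finPer B(1) by (intro finite_SigmaI finite_PiE) auto
  have PerD: "\<sigma> permutes {..<N}" "inv_into UNIV \<sigma> permutes {..<N}" if "\<sigma> \<in> Per" for \<sigma>
    using that permutes_inv by (auto simp: Per_def)
  have uxv: "kmul (idx S N) (kmul (idx S N) (u (\<sigma>, I)) (tens S N x id)) (v (\<sigma>, I))
      = tens S N (\<lambda>t. I t \<cdot> x (\<sigma> t) \<cdot> d (I t)) id" if \<sigma>: "\<sigma> \<in> Per" for \<sigma> I x
    unfolding u_def v_def fst_conv snd_conv tens_mul[OF finS PerD(1)[OF \<sigma>] permutes_id] id_o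
      tens_mul[OF finS PerD[OF \<sigma>]] permutes_inv_o[OF PerD(1)[OF \<sigma>]]
    by (simp add: permutes_inverses[OF PerD(1)[OF \<sigma>]])
  have uv: "kmul (idx S N) (u (\<sigma>, I)) (v (\<sigma>, I)) = tens S N (\<lambda>t. I t \<cdot> d (I t)) id" if \<sigma>: "\<sigma> \<in> Per" for \<sigma> I
    unfolding u_def v_def fst_conv snd_conv tens_mul[OF finS PerD[OF \<sigma>]] permutes_inv_o[OF PerD(1)[OF \<sigma>]]
    by (simp add: permutes_inverses[OF PerD(1)[OF \<sigma>]])
  \<comment> \<open>For fixed \<open>\<sigma>\<close>, the sum over multi-indices averages each
    tensor factor independently.\<close>
  have sum_uxv: "(\<Sum>j\<in>J. kmul (idx S N) (kmul (idx S N) (u j) (tens S N x id)) (v j))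
      = (\<Sum>\<sigma>\<in>Per. tens S N (\<lambda>t. E (x (\<sigma> t))) id)" for x
    unfolding J_def sum.cartesian_product' BN_def E_def sum_tens[OF B(1), symmetric]
    by (intro sum.cong refl) (simp add: uxv)
  show ?thesis
  proof (rule bicommutant_criterion[of "idx S N" J "tensor_algebra N" T u v "of_nat (card Per)"])
    show "finite (idx S N)" by (rule finite_idx[OF finS])
    show "fs.subspace (tensor_algebra N)" unfolding tensor_algebra_def by simp
    show "u j \<in> tensor_algebra N" if "j \<in> J" for j
      unfolding u_def tensor_algebra_def
      by (intro fs.span_base CollectI exI[of _ "snd j"] exI[of _ "fst j"] conjI refl) (use that B(2) PerD(1) in \<open>auto simp: J_def BN_def PiE_iff subset_iff\<close>)
    show "kmul (idx S N) x (v j) \<in> tensor_algebra N" if "j \<in> J" "x \<in> tensor_algebra N" for j x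
      unfolding v_def
    proof (rule tensor_algebra_mul[OF that(2)])
      have p: "inv_into UNIV (fst j) permutes {..<N}" using PerD(2) that(1) by (auto simp: J_def)
      then show "inv_into UNIV (fst j) permutes {..<N}" .
      fix t assume "t < N"
      then have "inv_into UNIV (fst j) t < N" using permutes_in_image[OF p, of t] by simp
      then show "d (snd j (inv_into UNIV (fst j) t)) \<in> A"
        using that(1) B(3) by (auto simp: J_def BN_def PiE_iff)
    qed
    \<comment> \<open>With nothing between the legs every permutation contributes the identity, so
      the constant in the criterion is the number of permutations.\<close>
    have "(\<Sum>j\<in>J. kmul (idx S N) (u j) (v j)) = (\<Sum>\<sigma>\<in>Per. tens S N (\<lambda>_. \<Sum>a\<in>B. a \<cdot> d a) id)"
      unfolding J_def sum.cartesian_product' BN_def sum_tens[OF B(1), symmetric]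
      by (intro sum.cong refl) (rule uv)
    also have "\<dots> = (\<Sum>\<sigma>\<in>Per. kone (idx S N))" by (simp only: one tens_one)
    finally have "(\<Sum>j\<in>J. kmul (idx S N) (u j) (v j)) = (\<Sum>\<sigma>\<in>Per. kone (idx S N))" .
    then show "(\<Sum>j\<in>J. kmul (idx S N) (u j) (v j)) = fscale (of_nat (card Per)) (kone (idx S N))"
      by (auto simp: fun_eq_iff fun_app)
    have "id \<in> Per" by (simp add: Per_def)
    then show "of_nat (card Per) \<noteq> (0 :: 'a)" using finPer by auto
    fix p q a b
    assume pq: "p \<in> idx S N" "q \<in> idx S N" "a \<in> idx S N" "b \<in> idx S N"
    let ?x = "\<lambda>t r. if r = (p t, q t) then 1 else 0 :: 'a"
    let ?e = "\<lambda>r. if r = (p, q) then 1 else 0 :: 'a"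
    let ?m = "kmul (idx S N)"
    \<comment> \<open>The matrix unit \<open>?e\<close> between the legs averages to a symmetrized
      tensor over the centralizer, with which \<open>T\<close> commutes.\<close>
    have "?m T (\<Sum>j\<in>J. ?m (?m (u j) ?e) (v j)) = ?m (\<Sum>j\<in>J. ?m (?m (u j) ?e) (v j)) T"
      unfolding tens_unit[OF pq(1,2), symmetric] sum_uxv Per_def
      by (rule commute_symmetrized[OF comm EC])
    then have "(\<Sum>j\<in>J. ?m (?m (?m T (u j)) ?e) (v j)) (a, b) = (\<Sum>j\<in>J. ?m (?m (u j) ?e) (?m (v j) T)) (a, b)"
      by (simp only: kmul_sum_left kmul_sum_right kmul_assoc)
    then    show "(\<Sum>j\<in>J. kmul (idx S N) T (u j) (a, p) * v j (q, b)) =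
          (\<Sum>j\<in>J. u j (a, p) * kmul (idx S N) (v j) T (q, b))"
      by (simp only: sum_fun_apply kmul_unit[OF finite_idx[OF finS] pq(1,2)])
  qed (use finJ supp tensor_algebra_supp in auto)
qed

end

section \<open>Substitution and the action of the group\<close>

lemma pconst_hom: "comm_ring_hom (pconst :: 'a::comm_ring_1 \<Rightarrow> 'a mpol)"
  by unfold_locales (simp_all add: pconst_def single_add mult_single)

interpretation pc: comm_ring_hom "pconst :: 'a::comm_ring_1 \<Rightarrow> 'a mpol"
  by (rule pconst_hom)

text \<open>The inner product in \<open>psubst\<close>, which thus becomes the linear extension of a
  multiplicative map on monomials.\<close>

definition mval :: "(nat \<times> nat \<times> nat \<Rightarrow> 'a::comm_ring_1 mpol) \<Rightarrow> ((nat \<times> nat \<times> nat) \<Rightarrow>\<^sub>0 nat) \<Rightarrow> 'a mpol" where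
  "mval \<sigma> m = (\<Prod>v\<in>Poly_Mapping.keys m. \<sigma> v ^ Poly_Mapping.lookup m v)"

lemma mval_superset:
  "finite K \<Longrightarrow> Poly_Mapping.keys m \<subseteq> K \<Longrightarrow> mval \<sigma> m = (\<Prod>v\<in>K. \<sigma> v ^ Poly_Mapping.lookup m v)"
  unfolding mval_def by (intro prod.mono_neutral_left) (auto simp: in_keys_iff)

lemma mval_add: "mval \<sigma> (m + m') = mval \<sigma> m * mval \<sigma> m'"
proof -
  let ?K = "Poly_Mapping.keys m \<union> Poly_Mapping.keys m'"
  have "Poly_Mapping.keys (m + m') \<subseteq> ?K" by (rule keys_add)
  then show ?thesis
    by (simp add: mval_superset[of ?K] lookup_add power_add prod.distrib)
qed

lemma psubst_superset:
  assumes "finite K" "Poly_Mapping.keys p \<subseteq> K"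
  shows "psubst \<sigma> p = (\<Sum>m\<in>K. pconst (Poly_Mapping.lookup p m) * mval \<sigma> m)"
  unfolding psubst_def mval_def[symmetric]
  using assms by (intro sum.mono_neutral_left) (auto simp: in_keys_iff)

lemma psubst_add: "psubst \<sigma> (p + q) = psubst \<sigma> p + psubst \<sigma> q"
proof -
  let ?K = "Poly_Mapping.keys p \<union> Poly_Mapping.keys q"
  have "Poly_Mapping.keys (p + q) \<subseteq> ?K" by (rule keys_add)
  then show ?thesis
    by (simp add: psubst_superset[of ?K] lookup_add pc.hom_add distrib_right sum.distrib)
qed

lemma psubst_single: "psubst \<sigma> (Poly_Mapping.single m c) = pconst c * mval \<sigma> m"
  by (subst psubst_superset[of "{m}"]) auto

lemma psubst_zero: "psubst \<sigma> 0 = 0"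
  by (simp add: psubst_def)

lemma psubst_sum: "psubst \<sigma> (\<Sum>i\<in>I. f i) = (\<Sum>i\<in>I. psubst \<sigma> (f i))"
  by (induction I rule: infinite_finite_induct) (auto simp: psubst_add psubst_zero)

lemma sum_of_singles:
  fixes p :: "'b \<Rightarrow>\<^sub>0 'a::comm_monoid_add"
  shows "p = (\<Sum>m\<in>Poly_Mapping.keys p. Poly_Mapping.single m (Poly_Mapping.lookup p m))"
proof (rule poly_mapping_eqI)
  fix m
  show "Poly_Mapping.lookup p m
    = Poly_Mapping.lookup (\<Sum>m\<in>Poly_Mapping.keys p. Poly_Mapping.single m (Poly_Mapping.lookup p m)) m"
    by (simp add: lookup_sum lookup_single when_def in_keys_iff)
qed

lemma psubst_mult: "psubst \<sigma> (p * q) = psubst \<sigma> p * psubst \<sigma> q"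
proof -
  let ?s = "\<lambda>p m. Poly_Mapping.single m (Poly_Mapping.lookup p m)"
  have "p * q = (\<Sum>m\<in>Poly_Mapping.keys p. \<Sum>m'\<in>Poly_Mapping.keys q. ?s p m * ?s q m')"
    by (subst (1) sum_of_singles[of p], subst (1) sum_of_singles[of q]) (simp add: sum_product)
  also have "psubst \<sigma> \<dots> = (\<Sum>m\<in>Poly_Mapping.keys p. \<Sum>m'\<in>Poly_Mapping.keys q.
      (pconst (Poly_Mapping.lookup p m) * mval \<sigma> m) * (pconst (Poly_Mapping.lookup q m') * mval \<sigma> m'))"
    by (simp add: psubst_sum mult_single psubst_single mval_add pc.hom_mult mult_ac)
  also have "\<dots> = psubst \<sigma> p * psubst \<sigma> q"
    unfolding psubst_def mval_def[symmetric] by (simp add: sum_product)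
  finally show ?thesis .
qed

lemma psubst_pconst [simp]: "psubst \<sigma> (pconst c) = pconst c"
  by (simp add: pconst_def[of c] psubst_single mval_def)

lemma psubst_pvar [simp]: "psubst \<sigma> (pvar v) = \<sigma> v"
  by (simp add: pvar_def psubst_single mval_def)

lemma psubst_hom: "comm_ring_hom (psubst \<sigma> :: 'a::comm_ring_1 mpol \<Rightarrow> 'a mpol)"
  by unfold_locales
    (auto simp: psubst_add psubst_mult psubst_zero psubst_pconst[of _ 1, simplified pc.hom_one])

interpretation ps: comm_ring_hom "psubst \<sigma> :: 'a::comm_ring_1 mpol \<Rightarrow> 'a mpol" for \<sigma>
  by (rule psubst_hom)

section \<open>Polynomials in the generic variables\<close>

lemma poly_ring_add: "p \<in> poly_ring n k \<Longrightarrow> q \<in> poly_ring n k \<Longrightarrow> p + q \<in> poly_ring n k"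
  using keys_add[of p q] unfolding poly_ring_def pvars_def by blast

lemma poly_ring_mult: "p \<in> poly_ring n k \<Longrightarrow> q \<in> poly_ring n k \<Longrightarrow> p * q \<in> poly_ring n k"
proof -
  assume pq: "p \<in> poly_ring n k" "q \<in> poly_ring n k"
  have "Poly_Mapping.keys m \<subseteq> genvars n k" if m: "m \<in> Poly_Mapping.keys (p * q)" for m
  proof -
    obtain a b where ab: "a \<in> Poly_Mapping.keys p" "b \<in> Poly_Mapping.keys q" "m = a + b"
      using keys_mult[of p q] m by blast
    then show ?thesis using pq keys_add[of a b] unfolding poly_ring_def pvars_def by blast
  qed
  then show ?thesis by (auto simp: poly_ring_def pvars_def)
qed

lemma poly_ring_const: "pconst c \<in> poly_ring n k"
  by (auto simp: poly_ring_def pvars_def pconst_def split: if_splits)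

lemma poly_ring_0: "0 \<in> poly_ring n k"
  using poly_ring_const[of 0 n k] by simp

lemma poly_ring_1: "1 \<in> poly_ring n k"
  using poly_ring_const[of 1 n k] by simp

lemma poly_ring_sum: "(\<And>i. i \<in> I \<Longrightarrow> f i \<in> poly_ring n k) \<Longrightarrow> sum f I \<in> poly_ring n k"
  by (induction I rule: infinite_finite_induct) (auto simp: poly_ring_add poly_ring_0)

lemma poly_ring_var: "v \<in> genvars n k \<Longrightarrow> pvar v \<in> poly_ring n k"
  by (auto simp: poly_ring_def pvars_def pvar_def split: if_splits)

section \<open>Constant and generic matrices, traces and generated algebras\<close>

lemma const_mat_carrier [simp]: "const_mat B \<in> carrier_mat n m \<longleftrightarrow> B \<in> carrier_mat n m"
  by (auto simp: const_mat_def)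

lemma generic_mat_carrier [simp]: "generic_mat n a \<in> carrier_mat n n"
  by (auto simp: generic_mat_def)

lemma const_mat_mult: "A \<in> carrier_mat n m \<Longrightarrow> B \<in> carrier_mat m l \<Longrightarrow> const_mat (A * B) = const_mat A * const_mat B"
  unfolding const_mat_def by (rule pc.mat_hom_mult)

lemma const_mat_one [simp]: "const_mat (1\<^sub>m n) = 1\<^sub>m n"
  unfolding const_mat_def by (rule pc.mat_hom_one)

lemma mtrace_mult_commute:
  assumes "A \<in> carrier_mat n n" "B \<in> carrier_mat n n"
  shows "mtrace (A * B) = mtrace (B * A)"
proof -
  have "mtrace (A * B) = (\<Sum>i<n. \<Sum>j<n. A $$ (i, j) * B $$ (j, i))"
    using assms by (auto simp: mtrace_def scalar_prod_def atLeast0LessThan intro!: sum.cong)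
  also have "\<dots> = (\<Sum>j<n. \<Sum>i<n. B $$ (j, i) * A $$ (i, j))"
    by (subst sum.swap) (simp add: mult.commute)
  also have "\<dots> = mtrace (B * A)"
    using assms by (auto simp: mtrace_def scalar_prod_def atLeast0LessThan intro!: sum.cong)
  finally show ?thesis .
qed

lemma gen_alg_carrier: "x \<in> gen_alg n G \<Longrightarrow> G \<subseteq> carrier_mat n n \<Longrightarrow> x \<in> carrier_mat n n"
  by (induction rule: gen_alg.induct) auto

lemma gen_alg_mono: "x \<in> gen_alg n G \<Longrightarrow> G \<subseteq> H \<Longrightarrow> x \<in> gen_alg n H"
  by (induction rule: gen_alg.induct) (auto intro: gen_alg.intros)

text \<open>Carries the dimensions along in the induction, because the ring laws for matrices hold
  only within a fixed carrier.\<close>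

lemma gen_alg_induct_carrier [consumes 2, case_names gen one zero add mult smult]:
  assumes "x \<in> gen_alg n G" "G \<subseteq> carrier_mat n n"
    and "\<And>x. x \<in> G \<Longrightarrow> P x" "P (1\<^sub>m n)" "P (0\<^sub>m n n)"
    and "\<And>x y. x \<in> carrier_mat n n \<Longrightarrow> y \<in> carrier_mat n n \<Longrightarrow> P x \<Longrightarrow> P y \<Longrightarrow> P (x + y)"
    and "\<And>x y. x \<in> carrier_mat n n \<Longrightarrow> y \<in> carrier_mat n n \<Longrightarrow> P x \<Longrightarrow> P y \<Longrightarrow> P (x * y)"
    and "\<And>c x. x \<in> carrier_mat n n \<Longrightarrow> P x \<Longrightarrow> P (pconst c \<cdot>\<^sub>m x)"
  shows "P x"
  using assms(1)
proof (induction rule: gen_alg.induct)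
  case (add x y)
  then show ?case using gen_alg_carrier[OF _ assms(2)] by (intro assms(6))
next
  case (mult x y)
  then show ?case using gen_alg_carrier[OF _ assms(2)] by (intro assms(7))
next
  case (smult x c)
  then show ?case using gen_alg_carrier[OF _ assms(2)] by (intro assms(8))
qed (fact assms)+

lemma gen_alg_poly_ring:
  assumes "x \<in> gen_alg n G" "G \<subseteq> carrier_mat n n"
    and "\<And>x i j. x \<in> G \<Longrightarrow> i < n \<Longrightarrow> j < n \<Longrightarrow> x $$ (i, j) \<in> poly_ring n k"
  shows "\<forall>i<n. \<forall>j<n. x $$ (i, j) \<in> poly_ring n k"
  using assms(1,2)
proof (induction rule: gen_alg_induct_carrier)
  case (mult x y)
  then show ?case
    by (auto simp: scalar_prod_def intro!: poly_ring_sum poly_ring_mult)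
qed (use assms in \<open>auto simp: poly_ring_0 poly_ring_1 intro!: poly_ring_add poly_ring_mult poly_ring_const\<close>)

section \<open>The action of a single invertible matrix\<close>

context
  fixes n :: nat and g gi :: "'a::field mat"
  assumes g: "g \<in> carrier_mat n n" "gi \<in> carrier_mat n n" "g * gi = 1\<^sub>m n"
begin

lemma gi_g: "gi * g = 1\<^sub>m n"
  using mat_mult_left_right_inverse g by blast

lemma const_g_gi: "const_mat g * const_mat gi = 1\<^sub>m n" "const_mat gi * const_mat g = 1\<^sub>m n"
  using g gi_g by (simp_all add: const_mat_mult[symmetric])

lemma sandwich_mult:
  assumes "x \<in> carrier_mat n n" "y \<in> carrier_mat n n"
  shows "const_mat gi * (x * y) * const_mat g = (const_mat gi * x * const_mat g) * (const_mat gi * y * const_mat g)"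
proof -
  have c: "const_mat gi \<in> carrier_mat n n" "const_mat g \<in> carrier_mat n n" using g by simp_all
  have "(const_mat gi * x * const_mat g) * (const_mat gi * y * const_mat g)
      = const_mat gi * x * (const_mat g * const_mat gi) * y * const_mat g"
    using assms c by (simp add: assoc_mult_mat[of _ n n _ n _ n])
  also have "\<dots> = const_mat gi * (x * y) * const_mat g"
    using assms c const_g_gi by (simp add: assoc_mult_mat[of _ n n _ n _ n])
  finally show ?thesis by simp
qed

lemma mat_action_mult:
  "x \<in> carrier_mat n n \<Longrightarrow> y \<in> carrier_mat n n \<Longrightarrow>
    mat_action n g gi (x * y) = mat_action n g gi x * mat_action n g gi y"
  unfolding mat_action_def by (subst ps.mat_hom_mult) (auto intro!: sandwich_mult)

lemma mat_action_add:
  assumes "x \<in> carrier_mat n n" "y \<in> carrier_mat n n"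
  shows "mat_action n g gi (x + y) = mat_action n g gi x + mat_action n g gi y"
proof -
  have c: "const_mat gi \<in> carrier_mat n n" "const_mat g \<in> carrier_mat n n" using g by simp_all
  have "map_mat (psubst (var_action n g gi)) (x + y)
      = map_mat (psubst (var_action n g gi)) x + map_mat (psubst (var_action n g gi)) y"
    using assms by (intro eq_matI) (auto simp: psubst_add)
  then show ?thesis
    unfolding mat_action_def using assms c
    by (auto simp: mult_add_distrib_mat[of _ n n _ n] add_mult_distrib_mat[of _ n n _ _ n])
qed

lemma mat_action_smult:
  assumes "x \<in> carrier_mat n n"
  shows "mat_action n g gi (p \<cdot>\<^sub>m x) = psubst (var_action n g gi) p \<cdot>\<^sub>m mat_action n g gi x"
proof -
  have c: "const_mat gi \<in> carrier_mat n n" "const_mat g \<in> carrier_mat n n" using g by simp_all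
  have "map_mat (psubst (var_action n g gi)) (p \<cdot>\<^sub>m x)
      = psubst (var_action n g gi) p \<cdot>\<^sub>m map_mat (psubst (var_action n g gi)) x"
    by (rule eq_matI) (auto simp: psubst_mult)
  then show ?thesis unfolding mat_action_def using assms c
    by (simp add: mult_smult_distrib[of _ n n _ n] mult_smult_assoc_mat[of _ n n _ n])
qed

lemma mat_action_one: "mat_action n g gi (1\<^sub>m n) = 1\<^sub>m n"
proof -
  have c: "const_mat gi \<in> carrier_mat n n" using g by simp
  show ?thesis unfolding mat_action_def ps.mat_hom_one using c const_g_gi by simp
qed

lemma mat_action_zero: "mat_action n g gi (0\<^sub>m n n) = 0\<^sub>m n n"
proof -
  have c: "const_mat gi \<in> carrier_mat n n" "const_mat g \<in> carrier_mat n n" using g by simp_all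
  have "map_mat (psubst (var_action n g gi)) (0\<^sub>m n n) = 0\<^sub>m n n"
    by (rule eq_matI) (auto simp: psubst_zero)
  then show ?thesis unfolding mat_action_def using c by simp
qed

lemma mat_action_const:
  assumes "a \<in> carrier_mat n n" "g * a = a * g"
  shows "mat_action n g gi (const_mat a) = const_mat a"
proof -
  have "map_mat (psubst (var_action n g gi)) (const_mat a) = const_mat a"
    unfolding const_mat_def by (rule eq_matI) auto
  then have "mat_action n g gi (const_mat a) = const_mat (gi * a * g)"
    unfolding mat_action_def using assms g by (simp add: const_mat_mult[of _ n n _ n])
  also have "gi * a * g = gi * g * a"
    using assms g by (simp add: assoc_mult_mat[of _ n n _ n _ n])
  also have "\<dots> = a" using gi_g assms by simp
  finally show ?thesis .
qed

lemma psubst_generic: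
  "map_mat (psubst (var_action n g gi)) (generic_mat n a) = const_mat g * generic_mat n a * const_mat gi"
  by (rule eq_matI) (use g in \<open>auto simp: generic_mat_def[of n a] var_action_def const_mat_def\<close>)

text \<open>The substitution conjugates the generic matrix by \<open>g\<close>, and the opposite
  conjugation on the matrix factor undoes this.\<close>

lemma mat_action_generic: "mat_action n g gi (generic_mat n a) = generic_mat n a"
proof -
  have c: "const_mat gi \<in> carrier_mat n n" "const_mat g \<in> carrier_mat n n" using g by simp_all
  have "mat_action n g gi (generic_mat n a)
      = (const_mat gi * const_mat g) * generic_mat n a * (const_mat gi * const_mat g)"
    unfolding mat_action_def psubst_generic using c
    by (simp add: assoc_mult_mat[of _ n n _ n _ n] mult_carrier_mat[of _ n n _ n])
  also have "\<dots> = generic_mat n a" unfolding const_g_gi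
    by (simp add: left_mult_one_mat[OF generic_mat_carrier] right_mult_one_mat[OF generic_mat_carrier])
  finally show ?thesis .
qed

text \<open>The trace does not see the conjugation on the matrix factor, so only the substitution
  remains of the action.\<close>

lemma psubst_mtrace_fixed:
  assumes u: "u \<in> carrier_mat n n" "mat_action n g gi u = u"
  shows "psubst (var_action n g gi) (mtrace u) = mtrace u"
proof -
  let ?v = "map_mat (psubst (var_action n g gi)) u"
  have c: "const_mat gi \<in> carrier_mat n n" "const_mat g \<in> carrier_mat n n" "?v \<in> carrier_mat n n"
    using g u by simp_all
  have "psubst (var_action n g gi) (mtrace u) = mtrace ?v"
    using u by (auto simp: mtrace_def psubst_sum intro!: sum.cong)
  also have "?v = (const_mat g * const_mat gi) * ?v"
    using c const_g_gi by simp
  also have "\<dots> = const_mat g * (const_mat gi * ?v)"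
    using c by (simp add: assoc_mult_mat[of _ n n _ n _ n])
  also have "mtrace \<dots> = mtrace ((const_mat gi * ?v) * const_mat g)"
    using c by (intro mtrace_mult_commute) auto
  also have "\<dots> = mtrace u" using u(2) by (simp add: mat_action_def)
  finally show ?thesis .
qed

lemma gen_alg_fixed:
  assumes "x \<in> gen_alg n G" "G \<subseteq> carrier_mat n n"
    and "\<And>x. x \<in> G \<Longrightarrow> mat_action n g gi x = x"
  shows "mat_action n g gi x = x"
  using assms(1,2)
  by (induction rule: gen_alg_induct_carrier)
     (auto simp: assms(3) mat_action_one mat_action_zero mat_action_add mat_action_mult mat_action_smult)

end

text \<open>Fixed matrices are closed under the operations of \<open>gen_alg\<close>, so generators
  suffice. The traces come second: \<open>mtrace u\<close> is fixed because \<open>u\<close>, a word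
  in constants and generic matrices, already is.\<close>

lemma Rbar_subset_invariants:
  assumes A: "A \<subseteq> carrier_mat n n"
  shows "Rbar A n k \<subseteq> invariants A n k"
proof
  fix x assume x: "x \<in> Rbar A n k"
  define G where "G = const_mat ` A \<union> generic_mat n ` {..<k}"
  define H where "H = {mtrace u \<cdot>\<^sub>m 1\<^sub>m n | u. u \<in> gen_alg n G}"
  have GC: "G \<subseteq> carrier_mat n n" using A by (auto simp: G_def)
  have x: "x \<in> gen_alg n (G \<union> H)" using x by (simp add: Rbar_def R_ring_def G_def H_def)
  have GHC: "G \<union> H \<subseteq> carrier_mat n n" using GC by (auto simp: H_def)
  have Gp: "y $$ (i, j) \<in> poly_ring n k" if "y \<in> G" "i < n" "j < n" for y i j
    using that A by (auto simp: G_def const_mat_def generic_mat_def genvars_def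
        intro!: poly_ring_const poly_ring_var)
  have "mtrace u \<in> poly_ring n k" if "u \<in> gen_alg n G" for u
    using gen_alg_poly_ring[OF that GC Gp] gen_alg_carrier[OF that GC]
    by (auto simp: mtrace_def intro!: poly_ring_sum)
  then have Hp: "y $$ (i, j) \<in> poly_ring n k" if "y \<in> G \<union> H" "i < n" "j < n" for y i j
    using that Gp by (auto simp: H_def poly_ring_0)
  have "mat_action n g gi x = x"
    if g: "g \<in> carrier_mat n n" "gi \<in> carrier_mat n n" "g * gi = 1\<^sub>m n" and ga: "\<forall>a\<in>A. g * a = a * g" for g gi
  proof -
    have fG: "mat_action n g gi y = y" if "y \<in> G" for y
      using that A ga g by (auto simp: G_def intro!: mat_action_const mat_action_generic)
    have fH: "mat_action n g gi y = y" if "y \<in> H" for y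
    proof -
      obtain u where u: "y = mtrace u \<cdot>\<^sub>m 1\<^sub>m n" "u \<in> gen_alg n G" using \<open>y \<in> H\<close> by (auto simp: H_def)
      show ?thesis unfolding u(1)
        by (simp add: mat_action_smult[OF g] mat_action_one[OF g]
            psubst_mtrace_fixed[OF g gen_alg_carrier[OF u(2) GC] gen_alg_fixed[OF g u(2) GC fG]])
    qed
    show ?thesis by (rule gen_alg_fixed[OF g x GHC]) (use fG fH in blast)
  qed
  then show "x \<in> invariants A n k"
    using gen_alg_carrier[OF x GHC] gen_alg_poly_ring[OF x GHC Hp] by (auto simp: invariants_def)
qed

section \<open>Symmetric coefficient tensors\<close>

text \<open>A word \<open>w\<close> of length \<open>d\<close> is a monomial in noncommuting
  letters; \<open>vmon\<close> forgets their order and keeps the exponents.\<close>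

definition vmon :: "nat \<Rightarrow> (nat \<Rightarrow> 'v) \<Rightarrow> 'v \<Rightarrow>\<^sub>0 nat" where
  "vmon d w = (\<Sum>t<d. Poly_Mapping.single (w t) 1)"

definition symmetric_on :: "'v set \<Rightarrow> nat \<Rightarrow> ((nat \<Rightarrow> 'v) \<Rightarrow> 'a) \<Rightarrow> bool" where
  "symmetric_on V d c \<longleftrightarrow> (\<forall>w\<in>idx V d. \<forall>\<pi>. \<pi> permutes {..<d} \<longrightarrow> c (restrict (w \<circ> \<pi>) {..<d}) = c w)"

text \<open>The coefficient of a monomial is shared equally among the words that spell it.\<close>

definition sym_coeff :: "'v set \<Rightarrow> (('v \<Rightarrow>\<^sub>0 nat) \<Rightarrow>\<^sub>0 'a::field_char_0) \<Rightarrow> nat \<Rightarrow> (nat \<Rightarrow> 'v) \<Rightarrow> 'a" where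
  "sym_coeff V p d w = Poly_Mapping.lookup p (vmon d w) / of_nat (card {w'\<in>idx V d. vmon d w' = vmon d w})"

definition mdeg :: "'v set \<Rightarrow> ('v \<Rightarrow>\<^sub>0 nat) \<Rightarrow> nat" where
  "mdeg V m = (\<Sum>v\<in>V. Poly_Mapping.lookup m v)"

lemma mdeg_add: "mdeg V (m + m') = mdeg V m + mdeg V m'"
  by (simp add: mdeg_def lookup_add sum.distrib)

lemma mdeg_sum: "mdeg V (\<Sum>i\<in>I. f i) = (\<Sum>i\<in>I. mdeg V (f i))"
  by (simp add: mdeg_def lookup_sum) (rule sum.swap)

lemma mdeg_single: "finite V \<Longrightarrow> v \<in> V \<Longrightarrow> mdeg V (Poly_Mapping.single v 1) = 1"
  by (simp add: mdeg_def lookup_single when_def)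

lemma mdeg_mon: "finite V \<Longrightarrow> w \<in> idx V d \<Longrightarrow> mdeg V (vmon d w) = d"
  by (simp add: vmon_def mdeg_sum mdeg_single[unfolded One_nat_def] idx_mem)

lemma ex_mon:
  assumes "finite V"
  shows "Poly_Mapping.keys m \<subseteq> V \<Longrightarrow> mdeg V m = d \<Longrightarrow> \<exists>w\<in>idx V d. vmon d w = m"
proof (induction d arbitrary: m)
  case 0
  have "m = 0"
  proof (rule poly_mapping_eqI)
    fix v
    show "Poly_Mapping.lookup m v = Poly_Mapping.lookup 0 v"
      using 0 assms by (cases "v \<in> V") (auto simp: mdeg_def in_keys_iff)
  qed
  then show ?case by (auto simp: vmon_def idx_def)
next
  case (Suc d)
  then have "m \<noteq> 0" by (auto simp: mdeg_def)
  then obtain v where v: "v \<in> Poly_Mapping.keys m" by fastforce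
  define m' where "m' = m - Poly_Mapping.single v 1"
  have m: "m = m' + Poly_Mapping.single v 1"
  proof (rule poly_mapping_eqI)
    fix x
    show "Poly_Mapping.lookup m x = Poly_Mapping.lookup (m' + Poly_Mapping.single v 1) x"
      using v by (auto simp: m'_def lookup_add lookup_minus lookup_single when_def in_keys_iff)
  qed
  have vV: "v \<in> V" using v Suc.prems by auto
  have "Poly_Mapping.keys m' \<subseteq> V"
    using Suc.prems(1) by (auto simp: m'_def lookup_minus in_keys_iff)
  moreover have "mdeg V m' = d"
    using Suc.prems(2) unfolding m mdeg_add mdeg_single[OF assms vV] by simp
  ultimately obtain w where w: "w \<in> idx V d" "vmon d w = m'" using Suc.IH by blast
  have "w(d := v) \<in> idx V (Suc d)"
    using w(1) vV unfolding idx_def lessThan_Suc by (auto simp: PiE_iff extensional_def)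
  moreover have "vmon (Suc d) (w(d := v)) = m"
    unfolding m w(2)[symmetric] by (simp add: vmon_def)
  ultimately show ?case by blast
qed

text \<open>Equal monomials mean equal multisets of letters, so the words are rearrangements of each
  other.\<close>

lemma mon_eq_permutes:
  assumes "vmon d w = vmon d w'" "w \<in> idx V d" "w' \<in> idx V d"
  obtains \<pi> where "\<pi> permutes {..<d}" "w = restrict (w' \<circ> \<pi>) {..<d}"
proof -
  have lk: "Poly_Mapping.lookup (vmon d w) v = card {t\<in>{..<d}. w t = v}" for w :: "nat \<Rightarrow> 'a" and v
    by (simp add: vmon_def lookup_sum lookup_single when_def sum.If_cases Int_def)
  have "image_mset w (mset_set {..<d}) = image_mset w' (mset_set {..<d})"
  proof (rule multiset_eqI)
    fix v
    have "card {t\<in>{..<d}. w t = v} = card {t\<in>{..<d}. w' t = v}"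
      using lk[of w v] lk[of w' v] assms(1) by simp
    moreover have "{t. t < d \<and> v = u t} = {t\<in>{..<d}. u t = v}" for u :: "nat \<Rightarrow> 'a" by auto
    ultimately show "count (image_mset w (mset_set {..<d})) v = count (image_mset w' (mset_set {..<d})) v"
      by (simp add: count_image_mset' count_mset_set')
  qed
  then obtain \<pi> where \<pi>: "\<pi> permutes {..<d}" "\<forall>t\<in>{..<d}. w t = w' (\<pi> t)"
    using image_mset_eq_implies_permutes[of "{..<d}" w w'] by auto
  have "w = restrict (w' \<circ> \<pi>) {..<d}"
    using \<pi>(2) assms(2) by (auto simp: fun_eq_iff idx_def PiE_iff extensional_def)
  then show ?thesis using that \<pi>(1) by blast
qed

lemma permute_idx:
  assumes "w \<in> idx V d" "\<pi> permutes {..<d}"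
  shows "restrict (w \<circ> \<pi>) {..<d} \<in> idx V d"
proof -
  have "\<pi> t < d" if "t < d" for t using permutes_in_image[OF assms(2), of t] that by simp
  then show ?thesis using assms(1) by (simp add: idx_def PiE_iff)
qed

lemma mon_permute: "\<pi> permutes {..<d} \<Longrightarrow> vmon d (restrict (w \<circ> \<pi>) {..<d}) = vmon d w"
  unfolding vmon_def by (subst (2) sum.permute[of \<pi>]) simp_all

lemma symmetric_sym_coeff: "symmetric_on V d (sym_coeff V p d)"
  by (simp add: symmetric_on_def sym_coeff_def mon_permute)

text \<open>The degree singles out \<open>e = d\<close>; the words that spell the given monomial
  form one orbit, on which a symmetric \<open>c\<close> is constant.\<close>

lemma lookup_symmetric_sum:
  assumes V: "finite V" and d: "d \<le> D" and w: "w \<in> idx V d" and sym: "symmetric_on V d (c d)"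
  shows "Poly_Mapping.lookup (\<Sum>e\<le>D. \<Sum>w'\<in>idx V e. Poly_Mapping.single (vmon e w') (c e w')) (vmon d w)
       = of_nat (card {w'\<in>idx V d. vmon d w' = vmon d w}) * (c d w :: 'a::field_char_0)"
proof -
  have eq: "vmon e w' = vmon d w \<longleftrightarrow> e = d \<and> vmon d w' = vmon d w" if "w' \<in> idx V e" for e w'
    using mdeg_mon[OF V] that w by metis
  have "Poly_Mapping.lookup (\<Sum>e\<le>D. \<Sum>w'\<in>idx V e. Poly_Mapping.single (vmon e w') (c e w')) (vmon d w)
      = (\<Sum>e\<le>D. \<Sum>w'\<in>idx V e. if vmon e w' = vmon d w then c e w' else 0)"
    by (simp add: lookup_sum lookup_single when_def)
  also have "\<dots> = (\<Sum>e\<le>D. if e = d then \<Sum>w'\<in>idx V d. if vmon d w' = vmon d w then c d w' else 0 else 0)"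
  proof (rule sum.cong[OF refl])
    fix e
    show "(\<Sum>w'\<in>idx V e. if vmon e w' = vmon d w then c e w' else 0)
      = (if e = d then \<Sum>w'\<in>idx V d. if vmon d w' = vmon d w then c d w' else 0 else 0)"
    proof (cases "e = d")
      case False
      then show ?thesis using eq by (auto intro!: sum.neutral)
    qed (auto intro!: sum.cong)
  qed
  also have "\<dots> = (\<Sum>w'\<in>idx V d. if vmon d w' = vmon d w then c d w' else 0)" using d by simp
  also have "\<dots> = (\<Sum>w' | w' \<in> idx V d \<and> vmon d w' = vmon d w. c d w')"
    using finite_idx[OF V] by (intro sum.inter_filter[symmetric])
  also have "\<dots> = (\<Sum>w' | w' \<in> idx V d \<and> vmon d w' = vmon d w. c d w)"
  proof (rule sum.cong[OF refl])
    fix w' assume "w' \<in> {w' \<in> idx V d. vmon d w' = vmon d w}"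
    then obtain \<pi> where "\<pi> permutes {..<d}" "w' = restrict (w \<circ> \<pi>) {..<d}"
      using mon_eq_permutes[of d w' w V] w by auto
    then show "c d w' = c d w" using sym w by (auto simp: symmetric_on_def)
  qed
  finally show ?thesis by simp
qed

lemma mon_class_nonempty:
  assumes "finite V" "w \<in> idx V d"
  shows "of_nat (card {w'\<in>idx V d. vmon d w' = vmon d w}) \<noteq> (0::'a::field_char_0)"
proof -
  have "finite {w'\<in>idx V d. vmon d w' = vmon d w}" using finite_idx[OF assms(1)] by simp
  then show ?thesis using assms(2) by auto
qed

text \<open>Both values times the orbit size give the coefficient of the same monomial, and the size
  is invertible. This turns an identity of polynomials into an identity of tensors.\<close>

lemma symmetric_expansion_unique:
  fixes c c' :: "nat \<Rightarrow> (nat \<Rightarrow> 'v) \<Rightarrow> 'a::field_char_0"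
  assumes V: "finite V" and sym: "\<And>d. symmetric_on V d (c d)" "\<And>d. symmetric_on V d (c' d)"
    and eq: "(\<Sum>e\<le>D. \<Sum>w\<in>idx V e. Poly_Mapping.single (vmon e w) (c e w))
           = (\<Sum>e\<le>D. \<Sum>w\<in>idx V e. Poly_Mapping.single (vmon e w) (c' e w))"
    and d: "d \<le> D" "w \<in> idx V d"
  shows "c d w = c' d w"
  using lookup_symmetric_sum[of V d D w c, OF V d sym(1)] lookup_symmetric_sum[of V d D w c', OF V d sym(2)] eq
    mon_class_nonempty[OF V d(2), where 'a = 'a] by simp

lemma symmetric_expansion:
  fixes p :: "('v \<Rightarrow>\<^sub>0 nat) \<Rightarrow>\<^sub>0 'a::field_char_0"
  assumes V: "finite V" and p: "\<And>m. m \<in> Poly_Mapping.keys p \<Longrightarrow> Poly_Mapping.keys m \<subseteq> V \<and> mdeg V m \<le> D"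
  shows "p = (\<Sum>d\<le>D. \<Sum>w\<in>idx V d. Poly_Mapping.single (vmon d w) (sym_coeff V p d w))"
proof (rule poly_mapping_eqI)
  fix m
  show "Poly_Mapping.lookup p m
    = Poly_Mapping.lookup (\<Sum>d\<le>D. \<Sum>w\<in>idx V d. Poly_Mapping.single (vmon d w) (sym_coeff V p d w)) m"
  proof (cases "\<exists>d\<le>D. \<exists>w\<in>idx V d. vmon d w = m")
    case True
    then obtain d w where dw: "d \<le> D" "w \<in> idx V d" "vmon d w = m" by blast
    show ?thesis
      unfolding dw(3)[symmetric] using mon_class_nonempty[OF V dw(2), where 'a = 'a]
      by (subst lookup_symmetric_sum[of V d D w "sym_coeff V p", OF V dw(1,2) symmetric_sym_coeff])
         (simp add: sym_coeff_def)
  next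
    case False
    then have "m \<notin> Poly_Mapping.keys p" using p ex_mon[OF V] by blast
    moreover have "(\<Sum>d\<le>D. \<Sum>w\<in>idx V d. sym_coeff V p d w when vmon d w = m) = 0"
      using False by (intro sum.neutral ballI) (auto simp: when_def)
    ultimately show ?thesis by (simp add: lookup_sum lookup_single in_keys_iff)
  qed
qed

text \<open>The same matrix \<open>L\<close> acts in every position, which commutes with permuting
  the positions.\<close>

lemma symmetric_transform:
  fixes c :: "(nat \<Rightarrow> 'v) \<Rightarrow> 'a::comm_ring_1"
  assumes sym: "symmetric_on V d c"
  shows "symmetric_on V d (\<lambda>v. \<Sum>w\<in>idx V d. c w * (\<Prod>t<d. L (w t) (v t)))"
  unfolding symmetric_on_def
proof (intro ballI allI impI)
  fix v \<pi> assume v: "v \<in> idx V d" and p: "\<pi> permutes {..<d}"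
  define q where "q = inv_into UNIV \<pi>"
  have q: "q permutes {..<d}" unfolding q_def by (rule permutes_inv[OF p])
  have qp: "q (\<pi> t) = t" "\<pi> (q t) = t" for t unfolding q_def by (simp_all add: permutes_inverses[OF p])
  have lt: "\<pi> t < d \<longleftrightarrow> t < d" "q t < d \<longleftrightarrow> t < d" for t
    using permutes_in_image[OF p, of t] permutes_in_image[OF q, of t] by simp_all
  have "(\<Sum>w\<in>idx V d. c w * (\<Prod>t<d. L (w t) (restrict (v \<circ> \<pi>) {..<d} t)))
      = (\<Sum>w\<in>idx V d. c (restrict (w \<circ> \<pi>) {..<d}) * (\<Prod>t<d. L (w (\<pi> t)) (v (\<pi> t))))"
    by (rule sum.reindex_bij_witness[of _ "\<lambda>w. restrict (w \<circ> \<pi>) {..<d}" "\<lambda>w. restrict (w \<circ> q) {..<d}"])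
       (auto simp: permute_idx[OF _ p] permute_idx[OF _ q] fun_eq_iff qp lt idx_def PiE_iff extensional_def
         intro!: prod.cong arg_cong2[of _ _ _ _ "(*)"] arg_cong[of _ _ c])
  also have "\<dots> = (\<Sum>w\<in>idx V d. c w * (\<Prod>t<d. L (w t) (v t)))"
  proof (rule sum.cong[OF refl])
    fix w assume "w \<in> idx V d"
    then have "c (restrict (w \<circ> \<pi>) {..<d}) = c w" using sym p by (simp add: symmetric_on_def)
    moreover have "(\<Prod>t<d. L (w (\<pi> t)) (v (\<pi> t))) = (\<Prod>t<d. L (w t) (v t))"
      by (subst (2) prod.permute[OF p]) simp
    ultimately show "c (restrict (w \<circ> \<pi>) {..<d}) * (\<Prod>t<d. L (w (\<pi> t)) (v (\<pi> t))) = c w * (\<Prod>t<d. L (w t) (v t))"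
      by simp
  qed
  finally show "(\<Sum>w\<in>idx V d. c w * (\<Prod>t<d. L (w t) (restrict (v \<circ> \<pi>) {..<d} t)))
      = (\<Sum>w\<in>idx V d. c w * (\<Prod>t<d. L (w t) (v t)))" .
qed

lemma symmetric_scale: "symmetric_on V d c \<Longrightarrow> symmetric_on V d (\<lambda>v. r * c v)"
  by (simp add: symmetric_on_def)

lemma symmetric_sum: "(\<And>i. i \<in> I \<Longrightarrow> symmetric_on V d (c i)) \<Longrightarrow> symmetric_on V d (\<lambda>v. \<Sum>i\<in>I. c i v)"
  by (auto simp: symmetric_on_def intro!: sum.cong)

section \<open>Matrices as kernels\<close>

text \<open>Inverse to \<open>mat n n\<close> on functions supported on the square; carries results
  between matrices and kernels.\<close>

definition kern :: "nat \<Rightarrow> 'a::comm_ring_1 mat \<Rightarrow> nat \<times> nat \<Rightarrow> 'a" where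
  "kern n M = (\<lambda>(i, j). if i < n \<and> j < n then M $$ (i, j) else 0)"

lemma kern_apply: "i < n \<Longrightarrow> j < n \<Longrightarrow> kern n M (i, j) = M $$ (i, j)"
  by (simp add: kern_def)

lemma kern_supp: "p \<notin> {..<n} \<times> {..<n} \<Longrightarrow> kern n M p = 0"
  by (cases p) (auto simp: kern_def)

lemma kern_mat: "(\<And>p. p \<notin> {..<n} \<times> {..<n} \<Longrightarrow> x p = 0) \<Longrightarrow> kern n (mat n n x) = x"
  by (auto simp: kern_def fun_eq_iff)

lemma mat_kern: "M \<in> carrier_mat n n \<Longrightarrow> mat n n (kern n M) = M"
  by (auto simp: kern_def)

lemma mat_kmul: "mat n n (kmul {..<n} x y) = mat n n x * mat n n y"
  by (auto simp: kmul_apply scalar_prod_def atLeast0LessThan)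

lemma mat_kone: "mat n n (kone {..<n}) = 1\<^sub>m n"
  by (auto simp: kone_def)

lemma mat_fun_add: "mat n n (x + y) = mat n n x + mat n n y"
  by (auto simp: plus_fun_apply)

lemma mat_fscale: "mat n n (fscale c x) = c \<cdot>\<^sub>m mat n n x"
  by (auto simp: fscale_apply)

lemma mat_fun_zero: "mat n n 0 = 0\<^sub>m n n"
  by (auto simp: zero_fun_apply)

lemma kmul_kern:
  assumes "A \<in> carrier_mat n n" "B \<in> carrier_mat n n"
  shows "kmul {..<n} (kern n A) (kern n B) = kern n (A * B)"
proof -
  have "kern n (A * B) = kern n (mat n n (kmul {..<n} (kern n A) (kern n B)))"
    using assms by (simp add: mat_kmul mat_kern)
  also have "\<dots> = kmul {..<n} (kern n A) (kern n B)"
  proof (rule kern_mat)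
    fix p :: "nat \<times> nat" assume "p \<notin> {..<n} \<times> {..<n}"
    then show "kmul {..<n} (kern n A) (kern n B) p = 0"
      by (cases p) (auto simp: kmul_apply kern_def intro!: sum.neutral)
  qed
  finally show ?thesis by simp
qed

lemma kern_one: "kern n (1\<^sub>m n) = kone {..<n}"
  by (auto simp: kern_def kone_def fun_eq_iff)

lemma mat_foldr: "mat n n (foldr (kmul {..<n}) ys (kone {..<n})) = foldr (*) (map (mat n n) ys) (1\<^sub>m n)"
  by (induction ys) (auto simp: mat_kmul mat_kone)

lemma semisimple_kernel_algebra_kern:
  fixes A :: "'a::field_char_0 mat set"
  assumes ss: "semisimple_subalgebra n A"
  shows "semisimple_kernel_algebra {..<n} (kern n ` A)"
proof -
  have A: "subalgebra n A" using ss by (simp add: semisimple_subalgebra_def)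
  have AC: "a \<in> carrier_mat n n" if "a \<in> A" for a using A that by (auto simp: subalgebra_def)
  have memI: "x \<in> kern n ` A" if "mat n n x \<in> A" "\<And>p. p \<notin> {..<n} \<times> {..<n} \<Longrightarrow> x p = 0" for x
    using that kern_mat[of n x] by (metis image_eqI)
  interpret kernel_algebra "{..<n}" "kern n ` A"
  proof
    show "x p = 0" if "x \<in> kern n ` A" "p \<notin> {..<n} \<times> {..<n}" for x p
      using that(1) kern_supp[OF that(2)] by blast
    show "fs.subspace (kern n ` A)"
    proof (rule fs.subspaceI)
      show "0 \<in> kern n ` A"
        using A by (intro memI) (simp_all add: mat_fun_zero subalgebra_def zero_fun_apply)
    next
      fix x y assume "x \<in> kern n ` A" "y \<in> kern n ` A"
      then obtain a b where "a \<in> A" "b \<in> A" "x = kern n a" "y = kern n b" by blast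
      then show "x + y \<in> kern n ` A"
        using A by (intro memI) (simp_all add: mat_fun_add mat_kern AC subalgebra_def plus_fun_apply kern_supp)
    next
      fix c x assume "x \<in> kern n ` A"
      then obtain a where "a \<in> A" "x = kern n a" by blast
      then show "fscale c x \<in> kern n ` A"
        using A by (intro memI) (simp_all add: mat_fscale mat_kern AC subalgebra_def fscale_apply kern_supp)
    qed
    show "kmul {..<n} x y \<in> kern n ` A" if "x \<in> kern n ` A" "y \<in> kern n ` A" for x y
      using that A by (auto simp: kmul_kern AC subalgebra_def)
    have "1\<^sub>m n \<in> A" using A by (simp add: subalgebra_def)
    then show "kone {..<n} \<in> kern n ` A" unfolding kern_one[symmetric] by (rule imageI)
  qed simp
  show ?thesis
  proof
    fix I assume I: "is_ideal I" and nil: "is_nilpotent I"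
    define I' where "I' = mat n n ` I"
    have IA: "I \<subseteq> kern n ` A" and Isub: "fs.subspace I"
      and Imul: "\<And>a x. a \<in> kern n ` A \<Longrightarrow> x \<in> I \<Longrightarrow> kmul {..<n} a x \<in> I \<and> kmul {..<n} x a \<in> I"
      using I by (auto simp: is_ideal_def)
    have km: "kern n (mat n n x) = x" if "x \<in> I" for x
      using that IA supp by (intro kern_mat) blast
    have "two_sided_ideal n A I'"
      unfolding two_sided_ideal_def
    proof (intro conjI ballI allI)
      show "I' \<subseteq> A" using IA by (auto simp: I'_def mat_kern AC)
      show "0\<^sub>m n n \<in> I'" unfolding I'_def mat_fun_zero[symmetric] by (rule imageI[OF fs.subspace_0[OF Isub]])
      show "x + y \<in> I'" if "x \<in> I'" "y \<in> I'" for x y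
        using that fs.subspace_add[OF Isub] by (auto simp: I'_def mat_fun_add[symmetric])
      show "c \<cdot>\<^sub>m x \<in> I'" if "x \<in> I'" for c x
        using that fs.subspace_scale[OF Isub] by (auto simp: I'_def mat_fscale[symmetric])
      fix a x assume a: "a \<in> A" and "x \<in> I'"
      then obtain y where y: "x = mat n n y" "y \<in> I" by (auto simp: I'_def)
      have "a * x = mat n n (kmul {..<n} (kern n a) y)" "x * a = mat n n (kmul {..<n} y (kern n a))"
        using a by (simp_all add: mat_kmul y(1) mat_kern AC)
      then show "a * x \<in> I'" "x * a \<in> I'" using Imul[OF imageI[OF a] y(2)] by (auto simp: I'_def)
    qed
    moreover have "nilpotent_set n I'"
    proof -
      obtain m where m: "\<And>xs. length xs = m \<Longrightarrow> set xs \<subseteq> I \<Longrightarrow> foldr (kmul {..<n}) xs (kone {..<n}) = 0"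
        using nil unfolding is_nilpotent_def by blast
      \<comment> \<open>Length \<open>m + 1\<close>, because \<open>nilpotent_set\<close> asks for a
        positive length while \<open>is_nilpotent\<close> admits zero.\<close>
      have "foldr (*) xs (1\<^sub>m n) = 0\<^sub>m n n" if xs: "length xs = Suc m" "set xs \<subseteq> I'" for xs
      proof -
        define ys where "ys = map (kern n) xs"
        have "kern n y \<in> I \<and> mat n n (kern n y) = y" if "y \<in> set xs" for y
          using xs(2) that km by (auto simp: I'_def)
        then have ys: "set ys \<subseteq> I" "xs = map (mat n n) ys"
          by (auto simp: ys_def o_def intro!: map_idI[symmetric])
        obtain y zs where yz: "ys = y # zs" "length zs = m" using xs(1) ys(2) by (cases ys) auto
        have "foldr (kmul {..<n}) ys (kone {..<n}) = 0" using m[of zs] ys(1) yz by simp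
        then show ?thesis unfolding ys(2) mat_foldr[symmetric] by (simp add: mat_fun_zero)
      qed
      then show ?thesis unfolding nilpotent_set_def by blast
    qed
    ultimately have "I' = {0\<^sub>m n n}" using ss by (simp add: semisimple_subalgebra_def)
    then have "mat n n x = mat n n 0" if "x \<in> I" for x using that by (auto simp: I'_def mat_fun_zero)
    then show "I \<subseteq> {0}"
      using km fs.subspace_0[OF Isub] by (metis subsetI singletonI)
  qed
qed

text \<open>A singular shift makes \<open>- s\<close> a root of the characteristic polynomial, which
  is monic and hence nonzero.\<close>

lemma finitely_many_singular_shifts:
  fixes B :: "'a::field mat"
  assumes B: "B \<in> carrier_mat n n"
  shows "finite {s. \<not> (\<exists>C\<in>carrier_mat n n. (B + s \<cdot>\<^sub>m 1\<^sub>m n) * C = 1\<^sub>m n)}"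
proof -
  have "char_poly B \<noteq> 0" using degree_monic_char_poly[OF B] by auto
  then have fin: "finite {s. poly (char_poly B) s = 0}" by (rule poly_roots_finite)
  have "{s. \<not> (\<exists>C\<in>carrier_mat n n. (B + s \<cdot>\<^sub>m 1\<^sub>m n) * C = 1\<^sub>m n)} \<subseteq> uminus ` {s. poly (char_poly B) s = 0}"
  proof
    fix s assume s: "s \<in> {s. \<not> (\<exists>C\<in>carrier_mat n n. (B + s \<cdot>\<^sub>m 1\<^sub>m n) * C = 1\<^sub>m n)}"
    have c: "B + s \<cdot>\<^sub>m 1\<^sub>m n \<in> carrier_mat n n" using B by simp
    have "det (B + s \<cdot>\<^sub>m 1\<^sub>m n) = 0"
    proof (rule ccontr)
      assume "det (B + s \<cdot>\<^sub>m 1\<^sub>m n) \<noteq> 0"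
      from det_non_zero_imp_unit[OF c this, of undefined]
      show False using s by (auto simp: Units_def ring_mat_def)
    qed
    moreover have "char_matrix B (- s) = B + s \<cdot>\<^sub>m 1\<^sub>m n" using B by (auto simp: char_matrix_def)
    ultimately have "poly (char_poly B) (- s) = 0"
      using eigenvalue_det[OF B, of "- s"] eigenvalue_root_char_poly[OF B, of "- s"] by simp
    then show "s \<in> uminus ` {s. poly (char_poly B) s = 0}" by force
  qed
  then show ?thesis using fin finite_subset by blast
qed

text \<open>The invertible shifts of \<^term>\<open>b\<close> are cofinite, and both sides are polynomial in the shift.\<close>

lemma commute_tensor_power_of_units:
  fixes T :: "(nat \<Rightarrow> nat) \<times> (nat \<Rightarrow> nat) \<Rightarrow> 'a::field_char_0"
  assumes b: "\<And>p. p \<notin> {..<n} \<times> {..<n} \<Longrightarrow> b p = 0"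
    and comm: "\<And>s gi. gi \<in> carrier_mat n n \<Longrightarrow> (mat n n b + s \<cdot>\<^sub>m 1\<^sub>m n) * gi = 1\<^sub>m n \<Longrightarrow>
      kmul (idx {..<n} N) T (tens {..<n} N (\<lambda>_. kern n (mat n n b + s \<cdot>\<^sub>m 1\<^sub>m n)) id)
      = kmul (idx {..<n} N) (tens {..<n} N (\<lambda>_. kern n (mat n n b + s \<cdot>\<^sub>m 1\<^sub>m n)) id) T"
  shows "kmul (idx {..<n} N) T (tens {..<n} N (\<lambda>_. b) id) = kmul (idx {..<n} N) (tens {..<n} N (\<lambda>_. b) id) T"
proof (rule ext, clarify)
  fix P Q :: "nat \<Rightarrow> nat"
  let ?X = "idx {..<n} N"
  define bs where "bs s = kern n (mat n n b + s \<cdot>\<^sub>m 1\<^sub>m n)" for s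
  have bs: "bs s (i, j) = b (i, j) + s * (if i = j then 1 else 0)" if "i < n" "j < n" for s i j
    using that by (simp add: bs_def kern_apply)
  show "kmul ?X T (tens {..<n} N (\<lambda>_. b) id) (P, Q) = kmul ?X (tens {..<n} N (\<lambda>_. b) id) T (P, Q)"
  proof -
    \<comment> \<open>Entries of the tensor power of the shifted matrix, as polynomials in the
      shift; every factor has degree at most one.\<close>
    define e where "e P Q = (if P \<in> ?X \<and> Q \<in> ?X then \<Prod>t<N. [:b (P t, Q t), if P t = Q t then 1 else 0:] else 0)" for P Q
    have e: "poly (e P Q) s = tens {..<n} N (\<lambda>_. bs s) id (P, Q)" for P Q s
      by (auto simp: e_def tens_def poly_prod bs idx_mem[where S = "{..<n}", simplified] intro!: prod.cong)
    define p where "p = (\<Sum>R\<in>?X. smult (T (P, R)) (e R Q)) - (\<Sum>R\<in>?X. smult (T (R, Q)) (e P R))"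
    have p: "poly p s = kmul ?X T (tens {..<n} N (\<lambda>_. bs s) id) (P, Q) - kmul ?X (tens {..<n} N (\<lambda>_. bs s) id) T (P, Q)" for s
      by (simp add: p_def poly_sum e kmul_apply mult.commute)
    define X where "X = {s. \<not> (\<exists>C\<in>carrier_mat n n. (mat n n b + s \<cdot>\<^sub>m 1\<^sub>m n) * C = 1\<^sub>m n)}"
    have "p = 0"
    proof (rule ccontr)
      assume "p \<noteq> 0"
      then have "finite {s. poly p s = 0}" by (rule poly_roots_finite)
      moreover have "- X \<subseteq> {s. poly p s = 0}" using comm by (auto simp: X_def p bs_def)
      ultimately have "finite (- X)" by (rule finite_subset[rotated])
      moreover have "finite X" unfolding X_def by (rule finitely_many_singular_shifts) simp
      ultimately have "finite (X \<union> - X)" by (intro finite_UnI)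
      then show False using infinite_UNIV_char_0[where 'a = 'a] by simp
    qed
    \<comment> \<open>The value at shift zero is the claim for \<open>b\<close> itself, which may be
      singular.\<close>
    moreover have "bs 0 = b"
      using b by (auto simp: fun_eq_iff bs_def kern_def)
    ultimately show ?thesis using p[of 0] by simp
  qed
qed

lemma sum_PiE_insert:
  fixes f :: "('k \<Rightarrow> 'i) \<Rightarrow> 'b::comm_monoid_add"
  assumes s: "s \<notin> K"
  shows "(\<Sum>P\<in>PiE (insert s K) (\<lambda>_. S). f P) = (\<Sum>i\<in>S. \<Sum>P\<in>PiE K (\<lambda>_. S). f (P(s := i)))"
proof -
  have "(\<Sum>P\<in>PiE (insert s K) (\<lambda>_. S). f P) = (\<Sum>(i, P)\<in>S \<times> PiE K (\<lambda>_. S). f (P(s := i)))"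
  proof (rule sum.reindex_bij_witness[of _ "\<lambda>(i, P). P(s := i)" "\<lambda>P. (P s, P(s := undefined))"])
    fix P assume "P \<in> PiE (insert s K) (\<lambda>_. S)"
    then show "(P s, P(s := undefined)) \<in> S \<times> PiE K (\<lambda>_. S)"
      using fun_upd_in_PiE[of s K P "\<lambda>_. S"] s by auto
  next
    fix x assume "x \<in> S \<times> PiE K (\<lambda>_. S)"
    then obtain i P where x: "x = (i, P)" "i \<in> S" "P \<in> PiE K (\<lambda>_. S)" by blast
    have "P(s := undefined) = P" using PiE_arb[OF x(3) s] fun_upd_triv by metis
    then show "((case x of (i, P) \<Rightarrow> P(s := i)) s, (case x of (i, P) \<Rightarrow> P(s := i))(s := undefined)) = x"
      by (simp add: x(1))
    show "(case x of (i, P) \<Rightarrow> P(s := i)) \<in> PiE (insert s K) (\<lambda>_. S)"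
      using PiE_fun_upd[of i "\<lambda>_. S" s P K] x by simp
  qed simp_all
  then show ?thesis by (simp add: sum.cartesian_product)
qed

lemma sum_idx_Suc:
  "(\<Sum>P\<in>idx S (Suc d). f P) = (\<Sum>i\<in>S. \<Sum>P\<in>idx S d. f (P(d := i)))"
  unfolding idx_def lessThan_Suc by (rule sum_PiE_insert) simp

lemma idx_upd: "P \<in> idx S d \<Longrightarrow> i \<in> S \<Longrightarrow> P(d := i) \<in> idx S (Suc d)"
  using PiE_fun_upd[of i "\<lambda>_. S" d P "{..<d}"] by (simp add: idx_def lessThan_Suc)

lemma finite_genvars: "finite (genvars n k)"
proof -
  have "genvars n k = {..<k} \<times> {..<n} \<times> {..<n}" by (auto simp: genvars_def)
  then show ?thesis by simp
qed

definition triple :: "nat \<Rightarrow> (nat \<Rightarrow> 'u) \<Rightarrow> (nat \<Rightarrow> 'v) \<Rightarrow> (nat \<Rightarrow> 'w) \<Rightarrow> nat \<Rightarrow> 'u \<times> 'v \<times> 'w" where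
  "triple d \<alpha> Q P = (\<lambda>t\<in>{..<d}. (\<alpha> t, Q t, P t))"

lemma triple_apply [simp]: "t < d \<Longrightarrow> triple d \<alpha> Q P t = (\<alpha> t, Q t, P t)"
  by (simp add: triple_def)

lemma triple_idx: "\<alpha> \<in> idx {..<k} d \<Longrightarrow> Q \<in> idx {..<n} d \<Longrightarrow> P \<in> idx {..<n} d \<Longrightarrow> triple d \<alpha> Q P \<in> idx (genvars n k) d"
  by (auto simp: idx_def triple_def genvars_def PiE_iff)

lemma sum_idx_genvars:
  fixes f :: "(nat \<Rightarrow> nat \<times> nat \<times> nat) \<Rightarrow> 'b::comm_monoid_add"
  shows "(\<Sum>w\<in>idx (genvars n k) d. f w)
    = (\<Sum>\<alpha>\<in>idx {..<k} d. \<Sum>Q\<in>idx {..<n} d. \<Sum>P\<in>idx {..<n} d. f (triple d \<alpha> Q P))"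
proof -
  have "(\<Sum>w\<in>idx (genvars n k) d. f w)
      = (\<Sum>(\<alpha>, Q, P)\<in>idx {..<k} d \<times> idx {..<n} d \<times> idx {..<n} d. f (triple d \<alpha> Q P))"
  proof (rule sum.reindex_bij_witness[of _ "\<lambda>(\<alpha>, Q, P). triple d \<alpha> Q P"
      "\<lambda>w. (\<lambda>t\<in>{..<d}. fst (w t), \<lambda>t\<in>{..<d}. fst (snd (w t)), \<lambda>t\<in>{..<d}. snd (snd (w t)))"])
    fix w assume w: "w \<in> idx (genvars n k) d"
    have "fst (w t) < k \<and> fst (snd (w t)) < n \<and> snd (snd (w t)) < n" if "t < d" for t
      using idx_mem[OF w that] by (auto simp: genvars_def)
    then show "(\<lambda>t\<in>{..<d}. fst (w t), \<lambda>t\<in>{..<d}. fst (snd (w t)), \<lambda>t\<in>{..<d}. snd (snd (w t)))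
        \<in> idx {..<k} d \<times> idx {..<n} d \<times> idx {..<n} d"
      by (simp add: idx_def PiE_iff)
    show "(case (\<lambda>t\<in>{..<d}. fst (w t), \<lambda>t\<in>{..<d}. fst (snd (w t)), \<lambda>t\<in>{..<d}. snd (snd (w t))) of
        (\<alpha>, Q, P) \<Rightarrow> triple d \<alpha> Q P) = w"
      using w by (auto simp: triple_def idx_def PiE_iff extensional_def fun_eq_iff)
    then show "(case (\<lambda>t\<in>{..<d}. fst (w t), \<lambda>t\<in>{..<d}. fst (snd (w t)), \<lambda>t\<in>{..<d}. snd (snd (w t))) of
        (\<alpha>, Q, P) \<Rightarrow> f (triple d \<alpha> Q P)) = f w" by simp
  next
    fix x assume "x \<in> idx {..<k} d \<times> idx {..<n} d \<times> idx {..<n} d"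
    then obtain \<alpha> Q P where x: "x = (\<alpha>, Q, P)" "\<alpha> \<in> idx {..<k} d" "Q \<in> idx {..<n} d" "P \<in> idx {..<n} d"
      by blast
    have "restrict \<alpha> {..<d} = \<alpha>" "restrict Q {..<d} = Q" "restrict P {..<d} = P"
      using x(2-4) unfolding idx_def by (simp_all only: PiE_restrict)
    moreover have "(\<lambda>t\<in>{..<d}. fst (triple d \<alpha> Q P t)) = restrict \<alpha> {..<d}"
      "(\<lambda>t\<in>{..<d}. fst (snd (triple d \<alpha> Q P t))) = restrict Q {..<d}"
      "(\<lambda>t\<in>{..<d}. snd (snd (triple d \<alpha> Q P t))) = restrict P {..<d}"
      by (auto intro!: restrict_ext)
    ultimately show "(\<lambda>t\<in>{..<d}. fst ((case x of (\<alpha>, Q, P) \<Rightarrow> triple d \<alpha> Q P) t),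
       \<lambda>t\<in>{..<d}. fst (snd ((case x of (\<alpha>, Q, P) \<Rightarrow> triple d \<alpha> Q P) t)),
       \<lambda>t\<in>{..<d}. snd (snd ((case x of (\<alpha>, Q, P) \<Rightarrow> triple d \<alpha> Q P) t))) = x"
      by (simp add: x(1))
    show "(case x of (\<alpha>, Q, P) \<Rightarrow> triple d \<alpha> Q P) \<in> idx (genvars n k) d"
      using triple_idx[OF x(2-4)] by (simp add: x(1))
  qed
  then show ?thesis by (simp add: sum.cartesian_product)
qed

section \<open>Contraction of tensors\<close>

text \<open>\<open>Rbar\<close> over an arbitrary generating set, so that the contraction argument
  can be stated without reference to \<open>A\<close>.\<close>

definition trace_alg :: "nat \<Rightarrow> 'a::comm_ring_1 mpol mat set \<Rightarrow> 'a mpol mat set" where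
  "trace_alg n G = gen_alg n (G \<union> {mtrace u \<cdot>\<^sub>m 1\<^sub>m n | u. u \<in> gen_alg n G})"

lemma Rbar_eq_trace_alg: "Rbar A n k = trace_alg n (const_mat ` A \<union> generic_mat n ` {..<k})"
  by (simp add: Rbar_def R_ring_def trace_alg_def)

lemma gen_alg_mat_sum:
  assumes "G \<subseteq> carrier_mat n n" "\<And>x. x \<in> I \<Longrightarrow> mat n n (F x) \<in> gen_alg n G"
  shows "mat n n (\<lambda>p. \<Sum>x\<in>I. F x p) \<in> gen_alg n G"
  using assms(2)
proof (induction I rule: infinite_finite_induct)
  case (insert x I)
  have "mat n n (\<lambda>p. \<Sum>y\<in>insert x I. F y p) = mat n n (F x) + mat n n (\<lambda>p. \<Sum>y\<in>I. F y p)"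
    using insert.hyps by (intro eq_matI) auto
  then show ?case using insert by (auto intro: gen_alg.add)
next
  case empty
  have "mat n n (\<lambda>p. \<Sum>y\<in>{}. F y p) = 0\<^sub>m n n" by (intro eq_matI) auto
  then show ?case by (simp add: gen_alg.zero)
next
  case (infinite I)
  have "mat n n (\<lambda>p. \<Sum>y\<in>I. F y p) = 0\<^sub>m n n" using infinite by (intro eq_matI) auto
  then show ?case by (simp add: gen_alg.zero)
qed

text \<open>Summing over one index either closes a cycle of \<open>\<sigma>\<close>, producing a trace, or multiplies two
  adjacent matrices.\<close>

lemma contraction_in_trace_alg:
  fixes Z :: "nat \<Rightarrow> 'a::comm_ring_1 mpol mat"
  assumes G: "G \<subseteq> carrier_mat n n"
  shows "finite K \<Longrightarrow> r \<notin> K \<Longrightarrow> \<sigma> permutes insert r K \<Longrightarrow> (\<And>t. t \<in> insert r K \<Longrightarrow> Z t \<in> gen_alg n G) \<Longrightarrow>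
    mat n n (\<lambda>(i, j). \<Sum>Q\<in>PiE K (\<lambda>_. {..<n}). \<Prod>t\<in>insert r K. Z t $$ ((Q(r := i)) t, (Q(r := j)) (\<sigma> t)))
      \<in> trace_alg n G"
proof (induction K arbitrary: \<sigma> Z rule: finite_induct)
  \<comment> \<open>Only the open position \<open>r\<close> is left; it carries the row and column
    of the result and is never summed over.\<close>
  case empty
  have "\<sigma> r = r" using permutes_in_image[OF empty(2), of r] by simp
  moreover have "Z r \<in> carrier_mat n n" using empty gen_alg_carrier[OF _ G] by simp
  ultimately have "mat n n (\<lambda>(i, j). \<Sum>Q\<in>PiE {} (\<lambda>_. {..<n}). \<Prod>t\<in>insert r {}. Z t $$ ((Q(r := i)) t, (Q(r := j)) (\<sigma> t))) = Z r"
    by (intro eq_matI) auto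
  moreover have "Z r \<in> trace_alg n G"
  proof -
    have "Z r \<in> gen_alg n G" using empty by simp
    then show ?thesis unfolding trace_alg_def by (rule gen_alg_mono) simp
  qed
  ultimately show ?case by simp
next
  case (insert s K)
  let ?M = "insert r K"
  have rs: "r \<noteq> s" and sM: "s \<notin> ?M" and rK: "r \<notin> K" using insert.hyps insert.prems by auto
  have finM: "finite ?M" using insert.hyps by simp
  have \<sigma>: "\<sigma> permutes insert s ?M" using insert.prems by (simp add: insert_commute)
  have inj: "\<sigma> x = \<sigma> y \<longleftrightarrow> x = y" for x y using permutes_inj[OF \<sigma>] by (auto dest: injD)
  have ZG: "Z t \<in> gen_alg n G" if "t \<in> insert s ?M" for t using insert.prems(3) that by auto
  have ZC: "Z t \<in> carrier_mat n n" if "t \<in> insert s ?M" for t using gen_alg_carrier[OF ZG[OF that] G] .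
  \<comment> \<open>Isolates the index \<open>l\<close> at position \<open>s\<close>: it is the row
    of factor \<open>s\<close> and the column of the factor that \<open>\<sigma>\<close> sends to
    \<open>s\<close>.\<close>
  have split: "(\<Sum>Q\<in>PiE (insert s K) (\<lambda>_. {..<n}). \<Prod>t\<in>insert r (insert s K). Z t $$ ((Q(r := i)) t, (Q(r := j)) (\<sigma> t)))
    = (\<Sum>Q\<in>PiE K (\<lambda>_. {..<n}). \<Sum>l<n. Z s $$ (l, (Q(r := j, s := l)) (\<sigma> s)) *
         (\<Prod>t\<in>?M. Z t $$ ((Q(r := i)) t, (Q(r := j, s := l)) (\<sigma> t))))" for i j
  proof -
    have "(\<Prod>t\<in>insert r (insert s K). Z t $$ ((Q(s := l, r := i)) t, (Q(s := l, r := j)) (\<sigma> t)))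
      = Z s $$ (l, (Q(r := j, s := l)) (\<sigma> s)) * (\<Prod>t\<in>?M. Z t $$ ((Q(r := i)) t, (Q(r := j, s := l)) (\<sigma> t)))" for Q l
    proof -
      have "(\<Prod>t\<in>insert r (insert s K). Z t $$ ((Q(s := l, r := i)) t, (Q(s := l, r := j)) (\<sigma> t)))
        = (\<Prod>t\<in>insert s ?M. Z t $$ ((Q(r := i, s := l)) t, (Q(r := j, s := l)) (\<sigma> t)))"
        using rs by (simp only: insert_commute[of r s K] fun_upd_twist[OF rs])
      also have "\<dots> = Z s $$ (l, (Q(r := j, s := l)) (\<sigma> s)) *
          (\<Prod>t\<in>?M. Z t $$ ((Q(r := i, s := l)) t, (Q(r := j, s := l)) (\<sigma> t)))"
        by (simp only: prod.insert[OF finM sM] fun_upd_same)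
      also have "(\<Prod>t\<in>?M. Z t $$ ((Q(r := i, s := l)) t, (Q(r := j, s := l)) (\<sigma> t)))
          = (\<Prod>t\<in>?M. Z t $$ ((Q(r := i)) t, (Q(r := j, s := l)) (\<sigma> t)))"
        using sM by (intro prod.cong refl) auto
      finally show ?thesis .
    qed
    then show ?thesis
      unfolding sum_PiE_insert[OF insert.hyps(2)] by (subst sum.swap) simp
  qed
  have Qlt: "(Q(r := i)) t < n" if "Q \<in> PiE K (\<lambda>_. {..<n})" "i < n" "t \<in> ?M" for Q i t
    using that PiE_mem[OF that(1), of t] by auto
  show ?case
  proof (cases "\<sigma> s = s")
    case True
    let ?N = "mat n n (\<lambda>(i, j). \<Sum>Q\<in>PiE K (\<lambda>_. {..<n}). \<Prod>t\<in>?M. Z t $$ ((Q(r := i)) t, (Q(r := j)) (\<sigma> t)))"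
    have "\<sigma> permutes ?M" using permutes_superset[OF \<sigma>, of ?M] True by auto
    then have N: "?N \<in> trace_alg n G" using insert.IH[of \<sigma> Z] rK ZG by auto
    have ne: "\<sigma> t \<noteq> s" if "t \<in> ?M" for t using inj[of t s] True that sM by auto
    have "(\<Prod>t\<in>?M. Z t $$ ((Q(r := i)) t, (Q(r := j, s := l)) (\<sigma> t)))
        = (\<Prod>t\<in>?M. Z t $$ ((Q(r := i)) t, (Q(r := j)) (\<sigma> t)))" for Q i j l
      using ne by (intro prod.cong refl) auto
    then have "mat n n (\<lambda>(i, j). \<Sum>Q\<in>PiE (insert s K) (\<lambda>_. {..<n}). \<Prod>t\<in>insert r (insert s K). Z t $$ ((Q(r := i)) t, (Q(r := j)) (\<sigma> t)))
        = mtrace (Z s) \<cdot>\<^sub>m ?N"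
      unfolding split using ZC[of s]
      by (intro eq_matI) (auto simp: True mtrace_def sum_product sum_distrib_left sum_distrib_right)
    also have "\<dots> = (mtrace (Z s) \<cdot>\<^sub>m 1\<^sub>m n) * ?N"
      by (subst mult_smult_assoc_mat[of _ n n _ n]) auto
    also have "\<dots> \<in> trace_alg n G"
      unfolding trace_alg_def
    proof (rule gen_alg.mult)
      show "mtrace (Z s) \<cdot>\<^sub>m 1\<^sub>m n \<in> gen_alg n (G \<union> {mtrace u \<cdot>\<^sub>m 1\<^sub>m n |u. u \<in> gen_alg n G})"
        using ZG[of s] by (intro gen_alg.gen) blast
    qed (use N in \<open>simp only: trace_alg_def\<close>)
    finally show ?thesis .
  next
    case False
    \<comment> \<open>\<open>q\<close> precedes \<open>s\<close> in its cycle. Summing over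
      \<open>l\<close> multiplies \<open>Z q\<close> by \<open>Z s\<close>; the product takes the
      place of \<open>Z q\<close>, and the new permutation bypasses \<open>s\<close>.\<close>
    define q where "q = inv_into UNIV \<sigma> s"
    have q: "\<sigma> q = s" unfolding q_def using permutes_inverses[OF \<sigma>] by simp
    have qs: "q \<noteq> s" using q False by auto
    have qM: "q \<in> ?M" using permutes_in_image[OF \<sigma>, of q] q qs by auto
    have sM': "\<sigma> s \<in> ?M" using permutes_in_image[OF \<sigma>, of s] False by auto
    define \<tau> where "\<tau> = \<sigma> \<circ> transpose q s"
    define Y where "Y = Z(q := Z q * Z s)"
    have "\<tau> permutes insert s ?M"
      unfolding \<tau>_def using qM by (intro permutes_compose[OF _ \<sigma>] permutes_swap_id) auto
    moreover have "\<tau> s = s" by (simp add: \<tau>_def q)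
    ultimately have \<tau>: "\<tau> permutes ?M" using permutes_superset[of \<tau> "insert s ?M" ?M] by auto
    have \<tau>q: "\<tau> q = \<sigma> s" by (simp add: \<tau>_def)
    have \<tau>t: "\<tau> t = \<sigma> t" if "t \<in> ?M - {q}" for t
      using that sM by (auto simp: \<tau>_def transpose_def)
    have ne: "\<sigma> t \<noteq> s" if "t \<in> ?M - {q}" for t using inj[of t q] q that by auto
    have YG: "Y t \<in> gen_alg n G" if "t \<in> ?M" for t
      using that ZG[of t] ZG[of s] ZG[of q] qM by (auto simp: Y_def intro: gen_alg.mult)
    have key: "(\<Sum>l<n. Z s $$ (l, (Q(r := j, s := l)) (\<sigma> s)) *
         (\<Prod>t\<in>?M. Z t $$ ((Q(r := i)) t, (Q(r := j, s := l)) (\<sigma> t))))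
       = (\<Prod>t\<in>?M. Y t $$ ((Q(r := i)) t, (Q(r := j)) (\<tau> t)))"
      if Q: "Q \<in> PiE K (\<lambda>_. {..<n})" and ij: "i < n" "j < n" for Q i j
    proof -
      let ?R = "\<Prod>t\<in>?M - {q}. Z t $$ ((Q(r := i)) t, (Q(r := j)) (\<sigma> t))"
      have a: "(Q(r := i)) q < n" and b: "(Q(r := j)) (\<sigma> s) < n"
        using Qlt[OF Q ij(1) qM] Qlt[OF Q ij(2) sM'] by auto
      have "(\<Prod>t\<in>?M. Z t $$ ((Q(r := i)) t, (Q(r := j, s := l)) (\<sigma> t))) = Z q $$ ((Q(r := i)) q, l) * ?R" for l
      proof -
        have "(\<Prod>t\<in>?M - {q}. Z t $$ ((Q(r := i)) t, (Q(r := j, s := l)) (\<sigma> t))) = ?R"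
          using ne by (intro prod.cong refl) auto
        then show ?thesis by (simp only: prod.remove[OF finM qM] q fun_upd_same)
      qed
      then have "(\<Sum>l<n. Z s $$ (l, (Q(r := j, s := l)) (\<sigma> s)) *
         (\<Prod>t\<in>?M. Z t $$ ((Q(r := i)) t, (Q(r := j, s := l)) (\<sigma> t))))
        = (\<Sum>l<n. Z q $$ ((Q(r := i)) q, l) * Z s $$ (l, (Q(r := j)) (\<sigma> s))) * ?R"
        using False by (simp add: sum_distrib_right mult_ac)
      also have "(\<Sum>l<n. Z q $$ ((Q(r := i)) q, l) * Z s $$ (l, (Q(r := j)) (\<sigma> s)))
          = (Z q * Z s) $$ ((Q(r := i)) q, (Q(r := j)) (\<sigma> s))"
        using a b ZC[of q] ZC[of s] qM by (simp add: scalar_prod_def atLeast0LessThan)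
      also have "\<dots> * ?R = Y q $$ ((Q(r := i)) q, (Q(r := j)) (\<tau> q)) *
          (\<Prod>t\<in>?M - {q}. Y t $$ ((Q(r := i)) t, (Q(r := j)) (\<tau> t)))"
        unfolding \<tau>q by (intro arg_cong2[of _ _ _ _ "(*)"] prod.cong) (auto simp: Y_def \<tau>t)
      also have "\<dots> = (\<Prod>t\<in>?M. Y t $$ ((Q(r := i)) t, (Q(r := j)) (\<tau> t)))"
        by (simp only: prod.remove[OF finM qM])
      finally show ?thesis .
    qed
    have "mat n n (\<lambda>(i, j). \<Sum>Q\<in>PiE (insert s K) (\<lambda>_. {..<n}). \<Prod>t\<in>insert r (insert s K). Z t $$ ((Q(r := i)) t, (Q(r := j)) (\<sigma> t)))
        = mat n n (\<lambda>(i, j). \<Sum>Q\<in>PiE K (\<lambda>_. {..<n}). \<Prod>t\<in>?M. Y t $$ ((Q(r := i)) t, (Q(r := j)) (\<tau> t)))"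
      unfolding split by (intro eq_matI) (simp_all add: key del: fun_upd_apply)
    also have "\<dots> \<in> trace_alg n G" by (rule insert.IH[OF rK \<tau> YG])
    finally show ?thesis .
  qed
qed

text \<open>The partial trace, over the first \<open>d\<close> factors, of \<open>T\<close> times
  the tensor product of the generic matrices. Hence the row index of a variable is a column index of
  \<open>T\<close>, and conversely.\<close>

definition tensor_poly :: "nat \<Rightarrow> nat \<Rightarrow> (nat \<Rightarrow> nat) \<Rightarrow> ((nat \<Rightarrow> nat) \<times> (nat \<Rightarrow> nat) \<Rightarrow> 'a::comm_ring_1) \<Rightarrow> 'a mpol mat" where
  "tensor_poly n d \<alpha> T = mat n n (\<lambda>(i, j). \<Sum>Q\<in>idx {..<n} d. \<Sum>P\<in>idx {..<n} d.
     pconst (T (P(d := i), Q(d := j))) * (\<Prod>t<d. pvar (\<alpha> t, Q t, P t)))"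

lemma tensor_poly_add: "tensor_poly n d \<alpha> (x + y) = tensor_poly n d \<alpha> x + tensor_poly n d \<alpha> y"
  by (intro eq_matI) (auto simp: tensor_poly_def plus_fun_apply pc.hom_add distrib_right sum.distrib)

lemma tensor_poly_scale: "tensor_poly n d \<alpha> (fscale c x) = pconst c \<cdot>\<^sub>m tensor_poly n d \<alpha> x"
  by (intro eq_matI) (auto simp: tensor_poly_def fscale_apply pc.hom_mult sum_distrib_left mult.assoc)

lemma tensor_poly_zero: "tensor_poly n d \<alpha> 0 = 0\<^sub>m n n"
  by (intro eq_matI) (auto simp: tensor_poly_def zero_fun_apply)

text \<open>Summing over \<open>P\<close> first multiplies each generic matrix by the coefficient in
  its position; the last position has no generic matrix. A contraction along \<open>\<sigma>\<close>
  with position \<open>d\<close> open remains.\<close>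

lemma tensor_poly_tens:
  assumes A: "A \<subseteq> carrier_mat n n" and \<alpha>: "\<alpha> \<in> idx {..<k} d"
    and M: "\<And>t. t < Suc d \<Longrightarrow> M t \<in> A" and \<sigma>: "\<sigma> permutes {..<Suc d}"
  shows "tensor_poly n d \<alpha> (tens {..<n} (Suc d) (\<lambda>t. kern n (M t)) \<sigma>) \<in> Rbar A n k"
proof -
  define Z where "Z t = (if t = d then const_mat (M t) else generic_mat n (\<alpha> t) * const_mat (M t))" for t
  let ?G = "const_mat ` A \<union> generic_mat n ` {..<k}"
  have G: "?G \<subseteq> carrier_mat n n" using A by auto
  have MC: "M t \<in> carrier_mat n n" if "t < Suc d" for t using M A that by auto
  have Z: "Z t \<in> gen_alg n ?G" if "t \<in> insert d {..<d}" for t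
  proof -
    have "const_mat (M t) \<in> gen_alg n ?G" using that M[of t] by (intro gen_alg.gen) auto
    moreover have "generic_mat n (\<alpha> t) \<in> gen_alg n ?G" if "t < d"
      using idx_mem[OF \<alpha> that] by (intro gen_alg.gen) auto
    ultimately show ?thesis using that by (auto simp: Z_def intro: gen_alg.mult)
  qed
  have \<sigma>': "\<sigma> permutes insert d {..<d}" using \<sigma> by (simp add: lessThan_Suc)
  have "tensor_poly n d \<alpha> (tens {..<n} (Suc d) (\<lambda>t. kern n (M t)) \<sigma>)
    = mat n n (\<lambda>(i, j). \<Sum>Q\<in>PiE {..<d} (\<lambda>_. {..<n}). \<Prod>t\<in>insert d {..<d}. Z t $$ ((Q(d := i)) t, (Q(d := j)) (\<sigma> t)))"
    (is "_ = mat n n (\<lambda>(i, j). ?f i j)")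
  proof (rule eq_matI)
    fix i j assume "i < dim_row (mat n n (\<lambda>(i, j). ?f i j))" "j < dim_col (mat n n (\<lambda>(i, j). ?f i j))"
    then have ij: "i < n" "j < n" by auto
    have "(\<Sum>P\<in>idx {..<n} d. pconst (tens {..<n} (Suc d) (\<lambda>t. kern n (M t)) \<sigma> (P(d := i), Q(d := j))) *
          (\<Prod>t<d. pvar (\<alpha> t, Q t, P t)))
        = (\<Prod>t\<in>insert d {..<d}. Z t $$ ((Q(d := i)) t, (Q(d := j)) (\<sigma> t)))"
      if Q: "Q \<in> idx {..<n} d" for Q
    proof -
      let ?c = "\<lambda>t. (Q(d := j)) (\<sigma> t)"
      have Q': "Q(d := j) \<in> idx {..<n} (Suc d)" using idx_upd[OF Q] ij by simp
      have c: "?c t < n" if "t < Suc d" for t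
        using idx_mem[OF Q', of "\<sigma> t"] permutes_in_image[OF \<sigma>, of t] that by simp
      have "(\<Sum>P\<in>idx {..<n} d. pconst (tens {..<n} (Suc d) (\<lambda>t. kern n (M t)) \<sigma> (P(d := i), Q(d := j))) *
            (\<Prod>t<d. pvar (\<alpha> t, Q t, P t)))
        = (\<Sum>P\<in>idx {..<n} d. pconst (M d $$ (i, ?c d)) * (\<Prod>t<d. pvar (\<alpha> t, Q t, P t) * pconst (M t $$ (P t, ?c t))))"
      proof (rule sum.cong[OF refl])
        fix P assume P: "P \<in> idx {..<n} d"
        have P': "P(d := i) \<in> idx {..<n} (Suc d)" using idx_upd[OF P] ij by simp
        have "tens {..<n} (Suc d) (\<lambda>t. kern n (M t)) \<sigma> (P(d := i), Q(d := j))
            = M d $$ (i, ?c d) * (\<Prod>t<d. M t $$ (P t, ?c t))"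
          unfolding tens_apply[OF P' Q'] prod.lessThan_Suc
          using c ij idx_mem[OF P] by (simp add: kern_apply mult.commute)
        then show "pconst (tens {..<n} (Suc d) (\<lambda>t. kern n (M t)) \<sigma> (P(d := i), Q(d := j))) * (\<Prod>t<d. pvar (\<alpha> t, Q t, P t))
          = pconst (M d $$ (i, ?c d)) * (\<Prod>t<d. pvar (\<alpha> t, Q t, P t) * pconst (M t $$ (P t, ?c t)))"
          by (simp add: pc.hom_mult pc.hom_prod prod.distrib mult_ac)
      qed
      also have "\<dots> = pconst (M d $$ (i, ?c d)) * (\<Prod>t<d. \<Sum>p<n. pvar (\<alpha> t, Q t, p) * pconst (M t $$ (p, ?c t)))"
        unfolding sum_distrib_left[symmetric] idx_def by (subst prod_sum_PiE) auto
      also have "\<dots> = Z d $$ (i, ?c d) * (\<Prod>t<d. Z t $$ (Q t, ?c t))"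
      proof (intro arg_cong2[of _ _ _ _ "(*)"] prod.cong refl)
        show "pconst (M d $$ (i, ?c d)) = Z d $$ (i, ?c d)"
          using MC[of d] ij c[of d] by (simp add: Z_def const_mat_def)
        fix t assume "t \<in> {..<d}"
        then show "(\<Sum>p<n. pvar (\<alpha> t, Q t, p) * pconst (M t $$ (p, ?c t))) = Z t $$ (Q t, ?c t)"
          using MC[of t] c[of t] idx_mem[OF Q, of t]
          by (simp add: Z_def const_mat_def generic_mat_def scalar_prod_def atLeast0LessThan)
      qed
      also have "\<dots> = (\<Prod>t\<in>insert d {..<d}. Z t $$ ((Q(d := i)) t, ?c t))"
        by (subst prod.insert) (auto intro!: prod.cong)
      finally show ?thesis .
    qed
    then show "tensor_poly n d \<alpha> (tens {..<n} (Suc d) (\<lambda>t. kern n (M t)) \<sigma>) $$ (i, j)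
        = mat n n (\<lambda>(i, j). ?f i j) $$ (i, j)"
      using ij by (simp add: tensor_poly_def idx_def)
  qed (simp_all add: tensor_poly_def)
  then show ?thesis
    unfolding Rbar_eq_trace_alg using contraction_in_trace_alg[OF G _ _ \<sigma>' Z] by simp
qed

section \<open>Invariants\<close>

text \<open>Linearity in \<open>T\<close> reduces the claim to the spanning operators.\<close>

lemma tensor_poly_tensor_algebra:
  assumes ss: "semisimple_subalgebra n A" and \<alpha>: "\<alpha> \<in> idx {..<k} d"
    and T: "T \<in> kernel_algebra.tensor_algebra {..<n} (kern n ` A) (Suc d)"
  shows "tensor_poly n d \<alpha> T \<in> Rbar A n k"
proof -
  interpret semisimple_kernel_algebra "{..<n}" "kern n ` A"
    by (rule semisimple_kernel_algebra_kern[OF ss])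
  have A: "A \<subseteq> carrier_mat n n" using ss by (simp add: semisimple_subalgebra_def subalgebra_def)
  let ?C = "{T. tensor_poly n d \<alpha> T \<in> Rbar A n k}"
  have "fs.subspace ?C"
    by (rule fs.subspaceI)
       (auto simp: tensor_poly_add tensor_poly_scale tensor_poly_zero Rbar_def intro: gen_alg.intros)
  moreover have "{tens {..<n} (Suc d) a \<sigma> | a \<sigma>. (\<forall>t<Suc d. a t \<in> kern n ` A) \<and> \<sigma> permutes {..<Suc d}} \<subseteq> ?C"
  proof clarify
    fix a \<sigma> assume a: "\<forall>t<Suc d. a t \<in> kern n ` A" and \<sigma>: "\<sigma> permutes {..<Suc d}"
    then have "\<forall>t. \<exists>M. t < Suc d \<longrightarrow> M \<in> A \<and> a t = kern n M" by blast
    then obtain M where M: "\<And>t. t < Suc d \<Longrightarrow> M t \<in> A \<and> a t = kern n (M t)" by metis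
    have "tens {..<n} (Suc d) a \<sigma> = tens {..<n} (Suc d) (\<lambda>t. kern n (M t)) \<sigma>"
      by (rule tens_cong[OF _ \<sigma>]) (simp_all add: M)
    then show "tensor_poly n d \<alpha> (tens {..<n} (Suc d) a \<sigma>) \<in> Rbar A n k"
      using tensor_poly_tens[OF A \<alpha> _ \<sigma>, of M] M by simp
  qed
  ultimately have "tensor_algebra (Suc d) \<subseteq> ?C"
    unfolding tensor_algebra_def by (intro fs.span_minimal)
  then show ?thesis using T by blast
qed

definition vprod :: "nat \<Rightarrow> (nat \<Rightarrow> nat \<times> nat \<times> nat) \<Rightarrow> 'a::comm_ring_1 mpol" where
  "vprod d w = (\<Prod>t<d. pvar (w t))"

lemma single_vmon: "Poly_Mapping.single (vmon d w) c = pconst c * vprod d w"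
proof -
  have "vprod d w = Poly_Mapping.single (vmon d w) (1 :: 'a)"
    by (induction d) (simp_all add: vprod_def vmon_def pvar_def mult_single flip: single_one)
  then show ?thesis by (simp add: pconst_def mult_single)
qed

text \<open>The matrix of the linear substitution: entry \<open>(w, v)\<close> is the coefficient of
  \<open>x\<^sub>v\<close> in the image of \<open>x\<^sub>w\<close>. Superscripts never
  change.\<close>

definition conj_coeff :: "'a::comm_ring_1 mat \<Rightarrow> 'a mat \<Rightarrow> nat \<times> nat \<times> nat \<Rightarrow> nat \<times> nat \<times> nat \<Rightarrow> 'a" where
  "conj_coeff g gi = (\<lambda>(a, i, j) (b, l, m). if a = b then g $$ (i, l) * gi $$ (m, j) else 0)"

lemma var_action_expansion:
  assumes g: "g \<in> carrier_mat n n" "gi \<in> carrier_mat n n" and w: "w \<in> genvars n k"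
  shows "var_action n g gi w = (\<Sum>v\<in>genvars n k. pconst (conj_coeff g gi w v) * pvar v)"
proof -
  obtain a i j where w': "w = (a, i, j)" "a < k" "i < n" "j < n" using w by (auto simp: genvars_def)
  have V: "genvars n k = {..<k} \<times> {..<n} \<times> {..<n}" by (auto simp: genvars_def)
  have "(\<Sum>v\<in>genvars n k. pconst (conj_coeff g gi w v) * pvar v)
      = (\<Sum>b<k. \<Sum>l<n. \<Sum>m<n. pconst (conj_coeff g gi w (b, l, m)) * pvar (b, l, m))"
    unfolding V by (simp add: sum.cartesian_product)
  also have "\<dots> = (\<Sum>b<k. if b = a then \<Sum>l<n. \<Sum>m<n. pconst (g $$ (i, l) * gi $$ (m, j)) * pvar (a, l, m) else 0)"
    by (intro sum.cong refl) (auto simp: conj_coeff_def w')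
  also have "\<dots> = (\<Sum>l<n. \<Sum>m<n. pconst (g $$ (i, l) * gi $$ (m, j)) * pvar (a, l, m))"
    using w' by simp
  also have "\<dots> = (\<Sum>m<n. (\<Sum>l<n. pconst (g $$ (i, l)) * pvar (a, l, m)) * pconst (gi $$ (m, j)))"
    by (subst sum.swap) (simp add: sum_distrib_right sum_distrib_left pc.hom_mult mult_ac)
  also have "\<dots> = var_action n g gi w"
    using w' g by (simp add: var_action_def const_mat_def generic_mat_def scalar_prod_def atLeast0LessThan)
  finally show ?thesis by simp
qed

lemma psubst_vprod:
  assumes g: "g \<in> carrier_mat n n" "gi \<in> carrier_mat n n" and w: "w \<in> idx (genvars n k) d"
  shows "psubst (var_action n g gi) (vprod d w)
    = (\<Sum>v\<in>idx (genvars n k) d. pconst (\<Prod>t<d. conj_coeff g gi (w t) (v t)) * vprod d v)"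
proof -
  have "psubst (var_action n g gi) (vprod d w)
      = (\<Prod>t<d. \<Sum>v\<in>genvars n k. pconst (conj_coeff g gi (w t) v) * pvar v)"
    unfolding vprod_def ps.hom_prod
    by (intro prod.cong refl) (simp add: var_action_expansion[OF g idx_mem[OF w]])
  also have "\<dots> = (\<Sum>v\<in>idx (genvars n k) d. \<Prod>t<d. pconst (conj_coeff g gi (w t) (v t)) * pvar (v t))"
    unfolding idx_def by (rule prod_sum_PiE) (simp_all add: finite_genvars)
  finally show ?thesis by (simp add: prod.distrib pc.hom_prod vprod_def)
qed

text \<open>On coefficient tensors the substitution acts by the transpose of
  \<open>conj_coeff\<close>, position by position.\<close>

lemma psubst_expansion:
  assumes g: "g \<in> carrier_mat n n" "gi \<in> carrier_mat n n"
  shows "psubst (var_action n g gi) (\<Sum>d\<le>D. \<Sum>w\<in>idx (genvars n k) d. pconst (c d w) * vprod d w)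
    = (\<Sum>d\<le>D. \<Sum>v\<in>idx (genvars n k) d.
        pconst (\<Sum>w\<in>idx (genvars n k) d. c d w * (\<Prod>t<d. conj_coeff g gi (w t) (v t))) * vprod d v)"
proof -
  have "psubst (var_action n g gi) (\<Sum>w\<in>idx (genvars n k) d. pconst (c d w) * vprod d w)
    = (\<Sum>v\<in>idx (genvars n k) d.
        pconst (\<Sum>w\<in>idx (genvars n k) d. c d w * (\<Prod>t<d. conj_coeff g gi (w t) (v t))) * vprod d v)" for d
  proof -
    have "psubst (var_action n g gi) (\<Sum>w\<in>idx (genvars n k) d. pconst (c d w) * vprod d w)
      = (\<Sum>w\<in>idx (genvars n k) d. \<Sum>v\<in>idx (genvars n k) d.
          pconst (c d w * (\<Prod>t<d. conj_coeff g gi (w t) (v t))) * vprod d v)"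
      by (simp add: psubst_sum psubst_mult psubst_vprod[OF g] sum_distrib_left pc.hom_mult mult.assoc)
    also have "\<dots> = (\<Sum>v\<in>idx (genvars n k) d. \<Sum>w\<in>idx (genvars n k) d.
          pconst (c d w * (\<Prod>t<d. conj_coeff g gi (w t) (v t))) * vprod d v)"
      by (rule sum.swap)
    finally show ?thesis by (simp add: pc.hom_sum sum_distrib_right)
  qed
  then show ?thesis by (simp add: psubst_sum)
qed

lemma mat_action_entry:
  assumes "g \<in> carrier_mat n n" "gi \<in> carrier_mat n n" "M \<in> carrier_mat n n" "i < n" "j < n"
  shows "mat_action n g gi M $$ (i, j) = (\<Sum>i'<n. \<Sum>j'<n. pconst (gi $$ (i, i') * g $$ (j', j)) *
      psubst (var_action n g gi) (M $$ (i', j')))"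
  using assms by (simp add: mat_action_def const_mat_def scalar_prod_def atLeast0LessThan
      sum_distrib_left sum_distrib_right pc.hom_mult mult_ac)

lemma sum_rotate: "(\<Sum>i\<in>I. \<Sum>j\<in>J. \<Sum>x\<in>X. f i j x) = (\<Sum>x\<in>X. \<Sum>i\<in>I. \<Sum>j\<in>J. f i j x)"
  for f :: "_ \<Rightarrow> _ \<Rightarrow> _ \<Rightarrow> 'b::comm_monoid_add"
proof -
  have "(\<Sum>j\<in>J. \<Sum>x\<in>X. f i j x) = (\<Sum>x\<in>X. \<Sum>j\<in>J. f i j x)" for i by (rule sum.swap)
  then show ?thesis by (simp only: sum.swap[of _ X I])
qed

lemma sum_exchange:
  fixes a :: "'i \<Rightarrow> 'j \<Rightarrow> 'b::comm_ring_1"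
  shows "(\<Sum>i\<in>I. \<Sum>j\<in>J. a i j * (\<Sum>d\<in>K. \<Sum>v\<in>X d. f i j d v * p d v))
       = (\<Sum>d\<in>K. \<Sum>v\<in>X d. (\<Sum>i\<in>I. \<Sum>j\<in>J. a i j * f i j d v) * p d v)"
proof -
  have "(\<Sum>i\<in>I. \<Sum>j\<in>J. a i j * (\<Sum>d\<in>K. \<Sum>v\<in>X d. f i j d v * p d v))
      = (\<Sum>i\<in>I. \<Sum>j\<in>J. \<Sum>d\<in>K. \<Sum>v\<in>X d. a i j * f i j d v * p d v)"
    by (simp only: sum_distrib_left mult.assoc)
  also have "\<dots> = (\<Sum>d\<in>K. \<Sum>v\<in>X d. \<Sum>i\<in>I. \<Sum>j\<in>J. a i j * f i j d v * p d v)"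
    by (simp only: sum_rotate[of _ K J I] sum_rotate[of _ "X _" J I])
  finally show ?thesis by (simp only: sum_distrib_right)
qed

lemma sum_single_index:
  assumes "finite X" "a \<in> X" "\<And>b. b \<in> X \<Longrightarrow> b \<noteq> a \<Longrightarrow> f b = 0"
  shows "sum f X = f a"
proof -
  have "sum f X = sum f {a}" using assms by (intro sum.mono_neutral_right) auto
  then show ?thesis by simp
qed

lemma invariants_subset_Rbar:
  fixes A :: "'a::field_char_0 mat set"
  assumes ss: "semisimple_subalgebra n A"
  shows "invariants A n k \<subseteq> Rbar A n k"
proof
  fix M assume M: "M \<in> invariants A n k"
  interpret semisimple_kernel_algebra "{..<n}" "kern n ` A"
    by (rule semisimple_kernel_algebra_kern[OF ss])
  have A: "A \<subseteq> carrier_mat n n" using ss by (simp add: semisimple_subalgebra_def subalgebra_def)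
  have MC: "M \<in> carrier_mat n n" and Mp: "\<And>i j. i < n \<Longrightarrow> j < n \<Longrightarrow> M $$ (i, j) \<in> poly_ring n k"
    and Minv: "\<And>g gi. g \<in> carrier_mat n n \<Longrightarrow> gi \<in> carrier_mat n n \<Longrightarrow> g * gi = 1\<^sub>m n \<Longrightarrow>
        (\<forall>a\<in>A. g * a = a * g) \<Longrightarrow> mat_action n g gi M = M"
    using M by (auto simp: invariants_def)
  define V where "V = genvars n k"
  have finV: "finite V" unfolding V_def by (rule finite_genvars)
  have "finite (\<Union>i<n. \<Union>j<n. mdeg V ` Poly_Mapping.keys (M $$ (i, j)))" by simp
  \<comment> \<open>A common degree bound lets all entries be expanded over the same range.\<close>
  then obtain D where D: "\<And>i j m. i < n \<Longrightarrow> j < n \<Longrightarrow> m \<in> Poly_Mapping.keys (M $$ (i, j)) \<Longrightarrow> mdeg V m \<le> D"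
    unfolding finite_nat_set_iff_bounded_le by blast
  define C where "C d i j = sym_coeff V (M $$ (i, j)) d" for d i j
  have Csym: "symmetric_on V d (C d i j)" for d i j unfolding C_def by (rule symmetric_sym_coeff)
  have Mexp: "M $$ (i, j) = (\<Sum>d\<le>D. \<Sum>w\<in>idx V d. pconst (C d i j w) * vprod d w)" if "i < n" "j < n" for i j
  proof -
    have "Poly_Mapping.keys m \<subseteq> V \<and> mdeg V m \<le> D" if "m \<in> Poly_Mapping.keys (M $$ (i, j))" for m
      using Mp[OF \<open>i < n\<close> \<open>j < n\<close>] D[OF \<open>i < n\<close> \<open>j < n\<close> that] that
      unfolding poly_ring_def pvars_def V_def by blast
    then show ?thesis
      unfolding C_def single_vmon[symmetric] by (intro symmetric_expansion[OF finV])
  qed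
  have Cinv: "C d i j v = (\<Sum>i'<n. \<Sum>j'<n. (gi $$ (i, i') * g $$ (j', j)) *
      (\<Sum>w\<in>idx V d. C d i' j' w * (\<Prod>t<d. conj_coeff g gi (w t) (v t))))"
    if g: "g \<in> carrier_mat n n" "gi \<in> carrier_mat n n" "g * gi = 1\<^sub>m n" "\<forall>a\<in>A. g * a = a * g"
      and ij: "i < n" "j < n" and dv: "d \<le> D" "v \<in> idx V d" for g gi i j d v
  proof -
    \<comment> \<open>The coefficient tensor of the transformed matrix. It is again symmetric, so
      uniqueness allows comparison with \<open>C\<close>.\<close>
    define C' where "C' d v = (\<Sum>i'<n. \<Sum>j'<n. (gi $$ (i, i') * g $$ (j', j)) *
      (\<Sum>w\<in>idx V d. C d i' j' w * (\<Prod>t<d. conj_coeff g gi (w t) (v t))))" for d v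
    have "M $$ (i, j) = (\<Sum>i'<n. \<Sum>j'<n. pconst (gi $$ (i, i') * g $$ (j', j)) *
        (\<Sum>d\<le>D. \<Sum>v\<in>idx V d. pconst (\<Sum>w\<in>idx V d. C d i' j' w * (\<Prod>t<d. conj_coeff g gi (w t) (v t))) * vprod d v))"
      using mat_action_entry[OF g(1,2) MC ij] Minv[OF g]
      by (simp add: Mexp psubst_expansion[OF g(1,2)] V_def)
    also have "\<dots> = (\<Sum>d\<le>D. \<Sum>v\<in>idx V d. pconst (C' d v) * vprod d v)"
      unfolding sum_exchange
      by (simp only: C'_def pc.hom_sum pc.hom_mult)
    finally have eq: "(\<Sum>d\<le>D. \<Sum>w\<in>idx V d. Poly_Mapping.single (vmon d w) (C d i j w))
        = (\<Sum>d\<le>D. \<Sum>v\<in>idx V d. Poly_Mapping.single (vmon d v) (C' d v))"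
      unfolding single_vmon Mexp[OF ij] .
    have C'sym: "symmetric_on V d (C' d)" for d
      unfolding C'_def by (intro symmetric_sum symmetric_scale symmetric_transform Csym)
    show ?thesis
      using symmetric_expansion_unique[OF finV _ C'sym eq dv] Csym unfolding C'_def by blast
  qed
  \<comment> \<open>Position \<open>d\<close> holds the row and column of the entry. Column indices
    of variables go to the rows of \<open>T\<close> and row indices to its columns; in this
    arrangement \<open>gi\<close> acts on the left and \<open>g\<close> on the right in every
    position alike.\<close>
  define T where "T d \<alpha> = (\<lambda>(P, Q). if P \<in> idx {..<n} (Suc d) \<and> Q \<in> idx {..<n} (Suc d)
      then C d (P d) (Q d) (triple d \<alpha> Q P) else 0)" for d \<alpha>
  have triple_upd: "triple d \<alpha> (Q(d := j)) (P(d := i)) = triple d \<alpha> Q P" for d \<alpha> Q P and i j :: nat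
    by (auto simp: triple_def)
  have T_upd: "T d \<alpha> (P(d := i), Q(d := j)) = C d i j (triple d \<alpha> Q P)"
    if "P \<in> idx {..<n} d" "Q \<in> idx {..<n} d" "i < n" "j < n" for d \<alpha> P Q i j
    using that idx_upd[of P "{..<n}" d i] idx_upd[of Q "{..<n}" d j]
    by (simp add: T_def triple_upd del: fun_upd_apply) simp
  have TinR: "tensor_poly n d \<alpha> (T d \<alpha>) \<in> Rbar A n k" if dD: "d \<le> D" and \<alpha>: "\<alpha> \<in> idx {..<k} d" for d \<alpha>
  proof (rule tensor_poly_tensor_algebra[OF ss \<alpha>], rule bicommutant_tensor_power)
    show "T d \<alpha> p = 0" if "p \<notin> idx {..<n} (Suc d) \<times> idx {..<n} (Suc d)" for p
      using that by (auto simp: T_def split: prod.splits)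
    let ?X = "idx {..<n} (Suc d)"
    have unit_comm: "kmul ?X (T d \<alpha>) (tens {..<n} (Suc d) (\<lambda>_. kern n g) id)
        = kmul ?X (tens {..<n} (Suc d) (\<lambda>_. kern n g) id) (T d \<alpha>)"
      if g: "g \<in> carrier_mat n n" "gi \<in> carrier_mat n n" "g * gi = 1\<^sub>m n" "\<forall>a\<in>A. g * a = a * g" for g gi
    proof -
      let ?G = "tens {..<n} (Suc d) (\<lambda>_. kern n g) id"
      let ?GI = "tens {..<n} (Suc d) (\<lambda>_. kern n gi) id"
      have "T d \<alpha> = kmul ?X ?GI (kmul ?X (T d \<alpha>) ?G)"
      proof (rule ext, clarify)
        fix P Q :: "nat \<Rightarrow> nat"
        show "T d \<alpha> (P, Q) = kmul ?X ?GI (kmul ?X (T d \<alpha>) ?G) (P, Q)"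
        proof (cases "P \<in> ?X \<and> Q \<in> ?X")
          case False
          then show ?thesis by (auto simp: kmul_apply T_def tens_def)
        next
          case True
          let ?I = "idx {..<n} d"
          have PQ: "P d < n" "Q d < n" "\<And>t. t < d \<Longrightarrow> P t < n" "\<And>t. t < d \<Longrightarrow> Q t < n"
            using True idx_mem[of P "{..<n}" "Suc d"] idx_mem[of Q "{..<n}" "Suc d"] by auto
          let ?v = "triple d \<alpha> Q P"
          have v: "?v \<in> idx V d"
            unfolding V_def idx_def triple_def using PQ idx_mem[OF \<alpha>]
            by (auto simp: genvars_def PiE_iff)
          have sw: "(\<Sum>w\<in>idx V d. C d i' j' w * (\<Prod>t<d. conj_coeff g gi (w t) (?v t)))
            = (\<Sum>Q'\<in>?I. \<Sum>P'\<in>?I. C d i' j' (triple d \<alpha> Q' P') *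
                (\<Prod>t<d. g $$ (Q' t, Q t) * gi $$ (P t, P' t)))" for i' j'
          proof -
            have "(\<Sum>w\<in>idx V d. C d i' j' w * (\<Prod>t<d. conj_coeff g gi (w t) (?v t)))
              = (\<Sum>\<beta>\<in>idx {..<k} d. \<Sum>Q'\<in>?I. \<Sum>P'\<in>?I. C d i' j' (triple d \<beta> Q' P') *
                (\<Prod>t<d. if \<beta> t = \<alpha> t then g $$ (Q' t, Q t) * gi $$ (P t, P' t) else 0))"
              unfolding V_def sum_idx_genvars by (simp add: conj_coeff_def)
            also have "\<dots> = (\<Sum>Q'\<in>?I. \<Sum>P'\<in>?I. C d i' j' (triple d \<alpha> Q' P') *
                (\<Prod>t<d. if \<alpha> t = \<alpha> t then g $$ (Q' t, Q t) * gi $$ (P t, P' t) else 0))"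
            \<comment> \<open>The substitution keeps superscripts, so only the summand with the
              given \<open>\<alpha>\<close> survives.\<close>
            proof (rule sum_single_index[OF _ \<alpha>])
              fix \<beta> assume "\<beta> \<in> idx {..<k} d" "\<beta> \<noteq> \<alpha>"
              then obtain t where t: "t < d" "\<beta> t \<noteq> \<alpha> t" using idx_eq_iff[OF _ \<alpha>] by blast
              have z: "(\<Prod>t<d. if \<beta> t = \<alpha> t then g $$ (Q' t, Q t) * gi $$ (P t, P' t) else 0) = 0" for P' Q'
                using t by (intro prod_zero) auto
              show "(\<Sum>Q'\<in>?I. \<Sum>P'\<in>?I. C d i' j' (triple d \<beta> Q' P') *
                (\<Prod>t<d. if \<beta> t = \<alpha> t then g $$ (Q' t, Q t) * gi $$ (P t, P' t) else 0)) = 0"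
                by (simp only: z mult_zero_right sum.neutral_const)
            qed (simp add: finite_idx)
            finally show ?thesis by simp
          qed
          have GI: "?GI (P, P'(d := i')) = gi $$ (P d, i') * (\<Prod>t<d. gi $$ (P t, P' t))"
            if "P' \<in> ?I" "i' < n" for P' i'
            using that True PQ idx_upd[of P' "{..<n}" d i'] idx_mem[OF that(1)]
            by (simp add: tens_apply kern_apply mult.commute)
          have GG: "?G (Q'(d := j'), Q) = g $$ (j', Q d) * (\<Prod>t<d. g $$ (Q' t, Q t))"
            if "Q' \<in> ?I" "j' < n" for Q' j'
            using that True PQ idx_upd[of Q' "{..<n}" d j'] idx_mem[OF that(1)]
            by (simp add: tens_apply kern_apply mult.commute)
          have "T d \<alpha> (P, Q) = C d (P d) (Q d) ?v" using True by (simp add: T_def)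
          also have "\<dots> = (\<Sum>i'<n. \<Sum>j'<n. (gi $$ (P d, i') * g $$ (j', Q d)) *
              (\<Sum>Q'\<in>?I. \<Sum>P'\<in>?I. C d i' j' (triple d \<alpha> Q' P') *
                (\<Prod>t<d. g $$ (Q' t, Q t) * gi $$ (P t, P' t))))"
            unfolding sw[symmetric] by (rule Cinv[OF g PQ(1,2) dD v])
          also have "\<dots> = (\<Sum>i'<n. \<Sum>j'<n. \<Sum>Q'\<in>?I. \<Sum>P'\<in>?I.
              (gi $$ (P d, i') * (\<Prod>t<d. gi $$ (P t, P' t))) * (C d i' j' (triple d \<alpha> Q' P') *
                (g $$ (j', Q d) * (\<Prod>t<d. g $$ (Q' t, Q t)))))"
            by (simp add: sum_distrib_left prod.distrib mult_ac)
          also have "\<dots> = (\<Sum>i'<n. \<Sum>P'\<in>?I. \<Sum>j'<n. \<Sum>Q'\<in>?I.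
              (gi $$ (P d, i') * (\<Prod>t<d. gi $$ (P t, P' t))) * (C d i' j' (triple d \<alpha> Q' P') *
                (g $$ (j', Q d) * (\<Prod>t<d. g $$ (Q' t, Q t)))))"
            by (intro sum.cong refl sum_rotate)
          also have "\<dots> = (\<Sum>i'<n. \<Sum>P'\<in>?I. \<Sum>j'<n. \<Sum>Q'\<in>?I.
              ?GI (P, P'(d := i')) * (T d \<alpha> (P'(d := i'), Q'(d := j')) * ?G (Q'(d := j'), Q)))"
            by (intro sum.cong refl) (simp only: GI GG T_upd lessThan_iff)
          also have "\<dots> = kmul ?X ?GI (kmul ?X (T d \<alpha>) ?G) (P, Q)"
            unfolding kmul_apply sum_idx_Suc sum_distrib_left ..
          finally show ?thesis .
        qed
      qed
      then have "kmul ?X ?G (T d \<alpha>) = kmul ?X (kmul ?X ?G ?GI) (kmul ?X (T d \<alpha>) ?G)"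
        by (simp add: kmul_assoc)
      also have "kmul ?X ?G ?GI = kone ?X"
        by (simp add: tens_mul kmul_kern g kern_one tens_one)
      also have "kmul ?X (kone ?X) (kmul ?X (T d \<alpha>) ?G) = kmul ?X (T d \<alpha>) ?G"
      proof (rule kmul_one_left)
        fix p assume "p \<notin> ?X \<times> ?X"
        then show "kmul ?X (T d \<alpha>) ?G p = 0"
          by (cases p) (auto simp: kmul_apply T_def tens_def intro!: sum.neutral)
      qed (simp add: finite_idx)
      finally show ?thesis by (rule sym)
    qed
    fix b assume b: "b \<in> centralizer"
    show "kmul ?X (T d \<alpha>) (tens {..<n} (Suc d) (\<lambda>_. b) id) = kmul ?X (tens {..<n} (Suc d) (\<lambda>_. b) id) (T d \<alpha>)"
    proof (rule commute_tensor_power_of_units)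
      show bs: "b p = 0" if "p \<notin> {..<n} \<times> {..<n}" for p using b that unfolding centralizer_def by blast
      fix s gi assume gi: "gi \<in> carrier_mat n n" "(mat n n b + s \<cdot>\<^sub>m 1\<^sub>m n) * gi = 1\<^sub>m n"
      \<comment> \<open>Scalar shifts stay in the centralizer, so an invertible one is among its
        units.\<close>
      have "(mat n n b + s \<cdot>\<^sub>m 1\<^sub>m n) * a = a * (mat n n b + s \<cdot>\<^sub>m 1\<^sub>m n)" if a: "a \<in> A" for a
      proof -
        have aC: "a \<in> carrier_mat n n" using a A by auto
        have "kmul {..<n} (kern n a) b = kmul {..<n} b (kern n a)"
          using b a unfolding centralizer_def by blast
        then have "mat n n (kmul {..<n} (kern n a) b) = mat n n (kmul {..<n} b (kern n a))" by simp
        then have "a * mat n n b = mat n n b * a" by (simp add: mat_kmul mat_kern aC)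
        then show ?thesis using aC
          by (simp add: add_mult_distrib_mat[of _ n n _ _ n] mult_add_distrib_mat[of _ n n _ n]
              mult_smult_distrib[of _ n n _ n] mult_smult_assoc_mat[of _ n n _ n])
      qed
      then show "kmul ?X (T d \<alpha>) (tens {..<n} (Suc d) (\<lambda>_. kern n (mat n n b + s \<cdot>\<^sub>m 1\<^sub>m n)) id)
        = kmul ?X (tens {..<n} (Suc d) (\<lambda>_. kern n (mat n n b + s \<cdot>\<^sub>m 1\<^sub>m n)) id) (T d \<alpha>)"
        using gi by (intro unit_comm[of _ gi]) auto
    qed
  qed
  have GC: "const_mat ` A \<union> generic_mat n ` {..<k} \<union> {mtrace u \<cdot>\<^sub>m 1\<^sub>m n |u. u \<in> R_ring A n k} \<subseteq> carrier_mat n n"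
    using A by auto
  \<comment> \<open>Contracting the tensors \<open>T d \<alpha>\<close> recovers the symmetric
    expansion of every entry, grouped by degree and superscripts.\<close>
  have "M = mat n n (\<lambda>p. \<Sum>d\<le>D. \<Sum>\<alpha>\<in>idx {..<k} d. tensor_poly n d \<alpha> (T d \<alpha>) $$ p)"
  proof (rule eq_matI)
    fix i j assume "i < dim_row (mat n n (\<lambda>p. \<Sum>d\<le>D. \<Sum>\<alpha>\<in>idx {..<k} d. tensor_poly n d \<alpha> (T d \<alpha>) $$ p))"
      "j < dim_col (mat n n (\<lambda>p. \<Sum>d\<le>D. \<Sum>\<alpha>\<in>idx {..<k} d. tensor_poly n d \<alpha> (T d \<alpha>) $$ p))"
    then have ij: "i < n" "j < n" by auto
    have "M $$ (i, j) = (\<Sum>d\<le>D. \<Sum>\<alpha>\<in>idx {..<k} d. \<Sum>Q\<in>idx {..<n} d. \<Sum>P\<in>idx {..<n} d.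
        pconst (C d i j (triple d \<alpha> Q P)) * vprod d (triple d \<alpha> Q P))"
      unfolding Mexp[OF ij] V_def sum_idx_genvars ..
    also have "\<dots> = (\<Sum>d\<le>D. \<Sum>\<alpha>\<in>idx {..<k} d. tensor_poly n d \<alpha> (T d \<alpha>) $$ (i, j))"
      using ij by (auto simp: tensor_poly_def vprod_def T_upd simp del: fun_upd_apply intro!: sum.cong)
    finally show "M $$ (i, j) = mat n n (\<lambda>p. \<Sum>d\<le>D. \<Sum>\<alpha>\<in>idx {..<k} d. tensor_poly n d \<alpha> (T d \<alpha>) $$ p) $$ (i, j)"
      using ij by simp
  qed (use MC in auto)
  also have "\<dots> \<in> Rbar A n k"
    unfolding Rbar_def
  proof (intro gen_alg_mat_sum[OF GC])
    fix d \<alpha> assume "d \<in> {..D}" "\<alpha> \<in> idx {..<k} d"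
    then have "tensor_poly n d \<alpha> (T d \<alpha>) \<in> Rbar A n k" using TinR by simp
    moreover have "mat n n (\<lambda>p. tensor_poly n d \<alpha> (T d \<alpha>) $$ p) = tensor_poly n d \<alpha> (T d \<alpha>)"
      by (intro eq_matI) (auto simp: tensor_poly_def)
    ultimately show "mat n n (\<lambda>p. tensor_poly n d \<alpha> (T d \<alpha>) $$ p) \<in> gen_alg n
        (const_mat ` A \<union> generic_mat n ` {..<k} \<union> {mtrace u \<cdot>\<^sub>m 1\<^sub>m n |u. u \<in> R_ring A n k})"
      by (simp add: Rbar_def)
  qed
  finally show "M \<in> Rbar A n k" .
qed

theorem theorem5p11:
  fixes A :: "'a::field_char_0 mat set" and n k :: nat
  assumes "semisimple_subalgebra n A"
  shows "invariants A n k = Rbar A n k"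
proof
  show "invariants A n k \<subseteq> Rbar A n k" by (rule invariants_subset_Rbar[OF assms])
  show "Rbar A n k \<subseteq> invariants A n k"
    using assms by (intro Rbar_subset_invariants) (simp add: semisimple_subalgebra_def subalgebra_def)
qed

end
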